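(* Let $n \geq 2$ be an integer, let $a>1$, and let $q,p \geq 2$ satisfy $$\frac{n}{2}\left(\frac12-\frac1p\right) < \frac1q \leq \frac{2n-1}{2}\left(\frac12-\frac1p\right).$$ Set $s = n\left(\frac12-\frac1p\right)-\frac{a}{q}$ and let $\alpha \in \mathbb{R}$. Suppose that there is a constant $C = C(a,n,p,q,\alpha)$ such that for every $u_0 \in \dot{H}^{s,\alpha}_\omega$ the solution $u$ of $$ i\partial_t u(t,x) + D^a u(t,x) = 0,\quad (t,x)\in\mathbb{R}\times\mathbb{R}^n,\qquad u(0,\cdot)=u_0, $$ satisfies $$\Vert u\Vert_{L_t^q L_x^p(\mathbb{R}\times\mathbb{R}^n)} \leq C\,\Vert u_0\Vert_{\dot{H}^{s,\alpha}_\omega}.$$ Then $\alpha \geq \frac{2}{q}+\frac{n}{p}-\frac{n}{2}$.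
   Context: $D=(-\Delta)^{1/2}$ is the Fourier multiplier with symbol $|\xi|$ on $\mathbb{R}^n$. The solution of the equation is $u(t)=e^{itD^a}u_0$, defined through the Fourier multiplier $e^{it|\xi|^a}$. The norm is $\Vert u\Vert_{L_t^qL_x^p} = \big(\int_{\mathbb{R}} \Vert u(t,\cdot)\Vert_{L^p(\mathbb{R}^n)}^q\,dt\big)^{1/q}$. The spherical Laplacian is $\Delta_\omega=\sum_{1\leq i<j\leq n}\Omega_{ij}^2$ with $\Omega_{ij}=x_i\partial_j-x_j\partial_i$, and $\Lambda_\omega=(1-\Delta_\omega)^{1/2}$. Powers of $\Lambda_\omega$ are defined spectrally, i.e. via the expansion in spherical harmonics in the angular variable; they commute with $D$ and with the Fourier transform. The Sobolev space with angular regularity $\alpha$ is $\dot{H}^{s,\alpha}_\omega = D^{-s}\Lambda_\omega^{-\alpha}L^2(\mathbb{R}^n)$, with norm $\Vert u_0\Vert_{\dot{H}^{s,\alpha}_\omega}=\Vert D^s\Lambda_\omega^\alpha u_0\Vert_{L^2(\mathbb{R}^n)}$. *)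

theory Defs
  imports "HOL-Analysis.Analysis"
begin

section \<open>Differential operators\<close>

definition partial :: "'n::finite \<Rightarrow> (real^'n \<Rightarrow> 'b::real_normed_vector) \<Rightarrow> real^'n \<Rightarrow> 'b" where
  "partial i f x = frechet_derivative f (at x) (axis i 1)"

definition laplacian :: "(real^'n::finite \<Rightarrow> 'b::real_normed_vector) \<Rightarrow> real^'n \<Rightarrow> 'b" where
  "laplacian f x = (\<Sum>i\<in>UNIV. partial i (partial i f) x)"

definition rot_deriv :: "'n::finite \<Rightarrow> 'n \<Rightarrow> (real^'n \<Rightarrow> 'b::real_normed_vector) \<Rightarrow> real^'n \<Rightarrow> 'b" where
  "rot_deriv i j f x = x $ i *\<^sub>R partial j f x - x $ j *\<^sub>R partial i f x"

text \<open>The index type carries no order, so the sum of the squares of the rotation fields over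
  the pairs \<open>i < j\<close> is written as half the sum over all ordered pairs; the square is
  symmetric in \<open>i\<close>, \<open>j\<close> and vanishes for \<open>i = j\<close>.\<close>

definition sph_laplacian :: "(real^'n::finite \<Rightarrow> 'b::real_normed_vector) \<Rightarrow> real^'n \<Rightarrow> 'b" where
  "sph_laplacian f x = (1/2) *\<^sub>R (\<Sum>i\<in>UNIV. \<Sum>j\<in>UNIV. rot_deriv i j (rot_deriv i j f) x)"


section \<open>Tempered distributions and the Fourier transform\<close>

definition schwartz :: "(real^'n::finite \<Rightarrow> complex) set" where
  "schwartz = {\<phi>. \<forall>js.
      (\<forall>x. (foldr partial js \<phi>) differentiable (at x)) \<and>
      (\<forall>m::nat. bounded (range (\<lambda>x. norm x ^ m *\<^sub>R foldr partial js \<phi> x)))}"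

text \<open>A tempered distribution is represented by its action on test functions; only the values
  on \<^const>\<open>schwartz\<close> matter. Linearity and continuity are not required separately: they hold
  automatically for the distributions considered below, all of which are weak limits of tempered
  functions.\<close>

type_synonym 'n distribution = "(real^'n \<Rightarrow> complex) \<Rightarrow> complex"

definition inv_fourier :: "(real^'n::finite \<Rightarrow> complex) \<Rightarrow> real^'n \<Rightarrow> complex" where
  "inv_fourier \<psi> \<xi> =
     complex_of_real (1 / (2 * pi) ^ CARD('n)) * (LINT x|lborel. cis (x \<bullet> \<xi>) * \<psi> x)"

definition represents :: "(real^'n::finite \<Rightarrow> complex) \<Rightarrow> 'n distribution \<Rightarrow> bool" where
  "represents f u \<longleftrightarrow> f \<in> borel_measurable lborel \<and>
     (\<forall>\<psi>\<in>schwartz. integrable lborel (\<lambda>x. f x * \<psi> x) \<and> u \<psi> = (LINT x|lborel. f x * \<psi> x))"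


section \<open>Expansion in spherical harmonics\<close>

definition spherical_harmonics :: "nat \<Rightarrow> (real^'n::finite \<Rightarrow> real) set" where
  "spherical_harmonics k = {Y. real_polynomial_function Y \<and>
     (\<forall>c x. Y (c *\<^sub>R x) = c ^ k * Y x) \<and> (\<forall>x. laplacian Y x = 0)}"

text \<open>\<open>f\<close> has the form \<open>f (r \<omega>) = \<Sum>Y. c Y r * Y \<omega>\<close> with spherical harmonics \<open>Y\<close> of
  degree \<open>k\<close>, on which minus the spherical Laplacian has the eigenvalue \<open>\<mu>\<close>.\<close>

definition harmonic_component :: "nat \<Rightarrow> real \<Rightarrow> (real^'n::finite \<Rightarrow> complex) \<Rightarrow> bool" where
  "harmonic_component k \<mu> f \<longleftrightarrow> (\<exists>B c. finite B \<and> B \<subseteq> spherical_harmonics k \<and>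
     (\<forall>Y\<in>B. \<forall>x. sph_laplacian Y x = - \<mu> * Y x) \<and>
     (\<forall>x. f x = (\<Sum>Y\<in>B. c Y (norm x) * complex_of_real (Y (x /\<^sub>R norm x)))))"

text \<open>The Fourier transform of \<open>u\<close> is the sum of the \<open>U k\<close> in the sense of tempered
  distributions. The transform is taken by duality: its value at the inverse transform of
  \<open>\<psi>\<close> is \<open>u \<psi>\<close>.\<close>

definition harmonic_expansion ::
  "'n::finite distribution \<Rightarrow> (nat \<Rightarrow> real) \<Rightarrow> (nat \<Rightarrow> real^'n \<Rightarrow> complex) \<Rightarrow> bool" where
  "harmonic_expansion u \<mu> U \<longleftrightarrow> (\<forall>k. harmonic_component k (\<mu> k) (U k)) \<and>
     (\<forall>\<psi>\<in>schwartz. (\<forall>k. integrable lborel (\<lambda>\<xi>. U k \<xi> * inv_fourier \<psi> \<xi>)) \<and>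
        (\<lambda>k. LINT \<xi>|lborel. U k \<xi> * inv_fourier \<psi> \<xi>) sums u \<psi>)"

text \<open>\<open>v = m(D) \<Lambda>\<^sub>\<omega>\<^sup>\<beta> u\<close> for a radial symbol \<open>m\<close>. Since the angular operator commutes with
  the Fourier transform, both factors act on the harmonic components of the transform of
  \<open>u\<close>: it multiplies the component with eigenvalue \<open>\<mu>\<close> by \<open>(1 + \<mu>) powr (\<beta> / 2)\<close>. Working
  componentwise gives a meaning to symbols which are not smooth at the origin even when the
  transform of \<open>u\<close> is not a function, as happens for negative angular regularity.\<close>

definition radial_angular_multiplier ::
  "(real^'n::finite \<Rightarrow> complex) \<Rightarrow> real \<Rightarrow> 'n distribution \<Rightarrow> 'n distribution \<Rightarrow> bool" where
  "radial_angular_multiplier m \<beta> u v \<longleftrightarrow> (\<exists>\<mu> U. harmonic_expansion u \<mu> U \<and>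
     harmonic_expansion v \<mu> (\<lambda>k \<xi>. complex_of_real ((1 + \<mu> k) powr (\<beta> / 2)) * m \<xi> * U k \<xi>))"

definition D_Lambda ::
  "real \<Rightarrow> real \<Rightarrow> 'n::finite distribution \<Rightarrow> 'n distribution \<Rightarrow> bool" where
  "D_Lambda s \<alpha> = radial_angular_multiplier (\<lambda>\<xi>. complex_of_real (norm \<xi> powr s)) \<alpha>"


section \<open>Norms\<close>

definition ennreal_powr :: "ennreal \<Rightarrow> real \<Rightarrow> ennreal" where
  "ennreal_powr x r = (if x = \<infinity> then \<infinity> else ennreal (enn2real x powr r))"

text \<open>The infimum only selects the representing function, which is unique almost everywhere; the
  norm is infinite if the distribution is not a function.\<close>

definition Lp_norm :: "real \<Rightarrow> 'n::finite distribution \<Rightarrow> ennreal" where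
  "Lp_norm p u = (INF f\<in>{f. represents f u}.
     ennreal_powr (\<integral>\<^sup>+x. ennreal (norm (f x) powr p) \<partial>lborel) (1 / p))"

definition LqLp_norm :: "real \<Rightarrow> real \<Rightarrow> (real \<Rightarrow> 'n::finite distribution) \<Rightarrow> ennreal" where
  "LqLp_norm q p u =
     ennreal_powr (\<integral>\<^sup>+t. ennreal_powr (Lp_norm p (u t)) q \<partial>lborel) (1 / q)"

definition hdot :: "real \<Rightarrow> real \<Rightarrow> 'n::finite distribution set" where
  "hdot s \<alpha> = {u. \<exists>g. Lp_norm 2 g < \<infinity> \<and> D_Lambda (- s) (- \<alpha>) g u}"

text \<open>Again the infimum only selects the value of \<open>D\<^sup>s \<Lambda>\<^sub>\<omega>\<^sup>\<alpha> u\<close>, which is unique.\<close>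

definition hdot_norm :: "real \<Rightarrow> real \<Rightarrow> 'n::finite distribution \<Rightarrow> ennreal" where
  "hdot_norm s \<alpha> u = (INF g\<in>{g. D_Lambda s \<alpha> u g}. Lp_norm 2 g)"


section \<open>The equation\<close>

text \<open>\<open>u t = exp (i t D\<^sup>a) u0\<close>, the solution of \<open>i \<partial>\<^sub>t u + D\<^sup>a u = 0\<close> with \<open>u 0 = u0\<close>.\<close>

definition is_solution ::
  "real \<Rightarrow> 'n::finite distribution \<Rightarrow> (real \<Rightarrow> 'n distribution) \<Rightarrow> bool" where
  "is_solution a u0 u \<longleftrightarrow>
     (\<forall>t. radial_angular_multiplier (\<lambda>\<xi>. cis (t * norm \<xi> powr a)) 0 u0 (u t))"

end

theory Submission
  imports Defs "HOL-Probability.Probability"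
begin

text \<open>
  The necessary condition comes from a Knapp example. Write \<open>n\<close> for the dimension, \<open>e\<close> for a
  coordinate vector and \<open>d = 1 / sqrt M\<close> for a large integer \<open>M\<close>. The Fourier transform of the datum is
  \<open>((1 + \<omega> \<bullet> e) / 2) ^ M\<close> on the shell \<open>1 \<le> norm \<xi> \<le> 1 + d\<close>, where \<open>\<omega> = \<xi> / norm \<xi>\<close>; up to
  Gaussian tails this is the indicator function of a ball of radius \<open>d\<close> around \<open>e\<close>. There
  \<open>norm \<xi> powr a\<close> equals \<open>1 + a * (\<xi> \<bullet> e - 1)\<close> up to \<open>O(norm (\<xi> - e)\<^sup>2)\<close>, so for times up to
  order \<open>1 / d\<^sup>2\<close> the evolution only translates the datum. Its space-time norm is therefore at least
  of order \<open>d powr (n - n / p - 2 / q)\<close>. Angular derivatives of the bump cost a factor \<open>1 / d\<close>, so the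
  right-hand side of the estimate is at most of order \<open>d powr (n / 2 - \<beta>)\<close> with \<open>\<beta> = max \<alpha> 0\<close>. Letting
  \<open>d\<close> tend to \<open>0\<close> forces \<open>\<beta> \<ge> 2 / q + n / p - n / 2\<close>. The lower bound on \<open>1 / q\<close> says that this
  threshold is positive, hence \<open>\<beta> = \<alpha>\<close>.

  Angular regularity is measured through spherical harmonics. On the unit sphere, multiplication by a
  coordinate sends harmonics of degree \<open>k\<close> to sums of harmonics of degrees \<open>k + 1\<close> and \<open>k - 1\<close>
  (\<open>sphere_expansion_mult_coord\<close>), so the bump is a finite sum of harmonics. The rotation fields
  generate rotations, which preserve Lebesgue measure; thus the spherical Laplacian is symmetric and
  harmonics of different degrees are orthogonal (\<open>spherical_harmonics_orthogonal\<close>). For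
  \<open>0 \<le> \<beta> \<le> 1\<close> the norm of order \<open>\<beta>\<close> is then dominated by mass and angular energy, both of
  which are explicit for a power of a linear function (\<open>bump_sobolev_bound\<close>).

  On the Fourier side two facts suffice. The \<open>L\<^sup>2\<close> norm of the datum is bounded by the inequality half
  of Plancherel (\<open>fourier_bessel\<close>). The \<open>L\<^sup>p\<close> norm of the solution is bounded below by testing
  it against a Gaussian wave packet that moves along with it (\<open>bump_evolution_lower\<close>,
  \<open>Lp_norm_lower\<close>), which works for every function representing the solution.
\<close>

section \<open>Partial derivatives of polynomial functions\<close>

lemma partial_eq: "(f has_derivative f') (at x) \<Longrightarrow> partial i f x = f' (axis i 1)"
  by (metis frechet_derivative_at partial_def)

lemma has_derivative_partial:
  fixes f :: "real^'n::finite \<Rightarrow> real"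
  assumes "f differentiable (at x)"
  shows "(f has_derivative (\<lambda>h. \<Sum>i\<in>UNIV. h $ i * partial i f x)) (at x)"
proof -
  obtain f' where f': "(f has_derivative f') (at x)"
    using assms by (auto simp: differentiable_def)
  then interpret f': bounded_linear f' by (rule has_derivative_bounded_linear)
  have "f' h = (\<Sum>i\<in>UNIV. h $ i * partial i f x)" for h
  proof -
    have "f' h = f' (\<Sum>i\<in>UNIV. h $ i *\<^sub>R axis i 1)"
      using basis_expansion[of h] by (simp add: scalar_mult_eq_scaleR)
    then show ?thesis by (simp add: f'.sum f'.scaleR partial_eq[OF f'])
  qed
  then have "f' = (\<lambda>h. \<Sum>i\<in>UNIV. h $ i * partial i f x)" by (rule ext)
  then show ?thesis using f' by simp
qed

lemma polynomial_component [intro!]: "real_polynomial_function (\<lambda>x::real^'n::finite. x $ i)"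
  by (intro real_polynomial_function.intros(1) bounded_linear_vec_nth)

lemma partial_const [simp]: "partial i (\<lambda>x. c) = (\<lambda>x. 0)"
  by (simp add: fun_eq_iff partial_eq[OF has_derivative_const])

lemma partial_coord: "partial i (\<lambda>x::real^'n::finite. x $ j) = (\<lambda>x. if i = j then 1 else 0)"
proof
  fix x :: "real^'n"
  have "((\<lambda>x::real^'n. x $ j) has_derivative (\<lambda>h. h $ j)) (at x)"
    by (intro bounded_linear_imp_has_derivative bounded_linear_vec_nth)
  from partial_eq[OF this, of i] show "partial i (\<lambda>x::real^'n. x $ j) x = (if i = j then 1 else 0)"
    by (auto simp: axis_def)
qed

lemma partial_add:
  fixes f g :: "real^'n::finite \<Rightarrow> real"
  assumes "real_polynomial_function f" "real_polynomial_function g"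
  shows "partial i (\<lambda>x. f x + g x) = (\<lambda>x. partial i f x + partial i g x)"
  using partial_eq[OF has_derivative_add[OF has_derivative_partial[OF differentiable_at_real_polynomial_function[OF assms(1)]]
      has_derivative_partial[OF differentiable_at_real_polynomial_function[OF assms(2)]]], of i]
  by (simp add: fun_eq_iff axis_def if_distrib[where f="\<lambda>y. y * _"] cong: if_cong)

lemma partial_mult:
  fixes f g :: "real^'n::finite \<Rightarrow> real"
  assumes "real_polynomial_function f" "real_polynomial_function g"
  shows "partial i (\<lambda>x. f x * g x) = (\<lambda>x. f x * partial i g x + partial i f x * g x)"
  using partial_eq[OF has_derivative_mult[OF has_derivative_partial[OF differentiable_at_real_polynomial_function[OF assms(1)]]
      has_derivative_partial[OF differentiable_at_real_polynomial_function[OF assms(2)]]], of i]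
  by (simp add: fun_eq_iff axis_def if_distrib[where f="\<lambda>y. y * _"] cong: if_cong)

lemma partial_cmult:
  fixes f :: "real^'n::finite \<Rightarrow> real"
  assumes "real_polynomial_function f"
  shows "partial i (\<lambda>x. c * f x) = (\<lambda>x. c * partial i f x)"
  using partial_mult[of "\<lambda>x. c" f i] assms by (simp add: real_polynomial_function.intros(2))

lemma partial_diff:
  fixes f g :: "real^'n::finite \<Rightarrow> real"
  assumes "real_polynomial_function f" "real_polynomial_function g"
  shows "partial i (\<lambda>x. f x - g x) = (\<lambda>x. partial i f x - partial i g x)"
  using partial_add[of f "\<lambda>x. (-1) * g x" i] partial_cmult[of g i "-1"] assms
  by (simp add: real_polynomial_function.intros real_polynomial_function_minus)

lemma partial_linear:
  fixes f :: "real^'n::finite \<Rightarrow> real"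
  assumes "bounded_linear f"
  shows "partial i f = (\<lambda>x. f (axis i 1))"
  using assms by (intro ext partial_eq bounded_linear_imp_has_derivative)

lemma partial_sum:
  fixes f :: "'a \<Rightarrow> real^'n::finite \<Rightarrow> real"
  assumes "finite S" "\<And>s. s \<in> S \<Longrightarrow> real_polynomial_function (f s)"
  shows "partial i (\<lambda>x. \<Sum>s\<in>S. f s x) = (\<lambda>x. \<Sum>s\<in>S. partial i (f s) x)"
  using assms
proof (induction S rule: finite_induct)
  case (insert s S)
  then show ?case
    by (simp add: partial_add real_polynomial_function_sum)
qed simp

lemma polynomial_partial [intro]:
  fixes f :: "real^'n::finite \<Rightarrow> real"
  assumes "real_polynomial_function f"
  shows "real_polynomial_function (partial i f)"
  using assms
  by induction (auto simp: partial_linear partial_add partial_mult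
      intro: real_polynomial_function.intros)

text \<open>The commutator of two partial derivatives is a derivation that kills linear
  functions, hence all polynomials; this is the induction below.\<close>

lemma partial_commute:
  fixes f :: "real^'n::finite \<Rightarrow> real"
  assumes "real_polynomial_function f"
  shows "partial i (partial j f) = partial j (partial i f)"
  using assms
proof induction
  case (mult f g)
  then show ?case
    by (simp add: partial_mult partial_add polynomial_partial real_polynomial_function.intros)
      (auto simp: fun_eq_iff algebra_simps)
qed (simp_all add: partial_linear partial_add polynomial_partial)

lemma polynomial_rot_deriv [intro]:
  fixes f :: "real^'n::finite \<Rightarrow> real"
  assumes "real_polynomial_function f"
  shows "real_polynomial_function (rot_deriv i j f)"
  unfolding rot_deriv_def real_scaleR_def using assms
  by (intro real_polynomial_function_diff real_polynomial_function.intros(4)) auto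

lemma laplacian_add:
  fixes f g :: "real^'n::finite \<Rightarrow> real"
  assumes "real_polynomial_function f" "real_polynomial_function g"
  shows "laplacian (\<lambda>x. f x + g x) = (\<lambda>x. laplacian f x + laplacian g x)"
  using assms by (simp add: laplacian_def fun_eq_iff partial_add polynomial_partial sum.distrib)

lemma laplacian_mult:
  fixes f g :: "real^'n::finite \<Rightarrow> real"
  assumes "real_polynomial_function f" "real_polynomial_function g"
  shows "laplacian (\<lambda>x. f x * g x) = (\<lambda>x. f x * laplacian g x
    + 2 * (\<Sum>i\<in>UNIV. partial i f x * partial i g x) + laplacian f x * g x)"
proof
  fix x
  have "partial i (partial i (\<lambda>x. f x * g x)) x = f x * partial i (partial i g) x
      + 2 * (partial i f x * partial i g x) + partial i (partial i f) x * g x" for i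
    using assms
    by (simp add: partial_mult partial_add polynomial_partial real_polynomial_function.intros)
  then show "laplacian (\<lambda>x. f x * g x) x = f x * laplacian g x
    + 2 * (\<Sum>i\<in>UNIV. partial i f x * partial i g x) + laplacian f x * g x"
    by (simp add: laplacian_def sum.distrib sum_distrib_left sum_distrib_right)
qed

lemma laplacian_const [simp]: "laplacian (\<lambda>x. c) = (\<lambda>x. 0)"
  by (simp add: laplacian_def fun_eq_iff)

lemma laplacian_cmult:
  fixes f :: "real^'n::finite \<Rightarrow> real"
  assumes "real_polynomial_function f"
  shows "laplacian (\<lambda>x. c * f x) = (\<lambda>x. c * laplacian f x)"
  using laplacian_mult[of "\<lambda>x. c" f] assms by (simp add: real_polynomial_function.intros(2))

lemma partial_laplacian:
  fixes f :: "real^'n::finite \<Rightarrow> real"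
  assumes f: "real_polynomial_function f"
  shows "laplacian (partial i f) = partial i (laplacian f)"
proof -
  have *: "partial j (partial j (partial i f)) = partial i (partial j (partial j f))" for j
    using partial_commute[OF f, of i j] partial_commute[OF polynomial_partial[OF f, of j], of i j] by metis
  have "partial i (laplacian f) = (\<lambda>x. \<Sum>j\<in>UNIV. partial i (partial j (partial j f)) x)"
    unfolding laplacian_def by (rule partial_sum) (use f in auto)
  then show ?thesis by (simp add: laplacian_def fun_eq_iff *)
qed

section \<open>Spherical harmonics\<close>

definition euler_field :: "(real^'n::finite \<Rightarrow> real) \<Rightarrow> real^'n \<Rightarrow> real" where
  "euler_field f x = (\<Sum>i\<in>UNIV. x $ i * partial i f x)"

lemma has_derivative_ray:
  fixes f :: "real^'n::finite \<Rightarrow> real"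
  assumes "real_polynomial_function f"
  shows "((\<lambda>c. f (c *\<^sub>R x)) has_derivative (\<lambda>h. \<Sum>i\<in>UNIV. (h * x $ i) * partial i f (c *\<^sub>R x))) (at c)"
proof -
  have "((\<lambda>c. c *\<^sub>R x) has_derivative (\<lambda>h. h *\<^sub>R x)) (at c)"
    by (auto intro!: derivative_eq_intros)
  from has_derivative_compose[OF this has_derivative_partial[OF differentiable_at_real_polynomial_function[OF assms]]]
  show ?thesis by simp
qed

text \<open>Differentiate \<open>f (c *\<^sub>R x) = c ^ k * f x\<close> in \<open>c\<close> at \<open>c = 1\<close>.\<close>

lemma euler_homogeneous:
  fixes f :: "real^'n::finite \<Rightarrow> real"
  assumes f: "real_polynomial_function f" and h: "\<And>c x. f (c *\<^sub>R x) = c ^ k * f x"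
  shows "euler_field f = (\<lambda>x. real k * f x)"
proof
  fix x
  have "((\<lambda>c. f (c *\<^sub>R x)) has_derivative (\<lambda>h. \<Sum>i\<in>UNIV. (h * x $ i) * partial i f (1 *\<^sub>R x))) (at 1)"
    by (rule has_derivative_ray[OF f])
  moreover have "((\<lambda>c. f (c *\<^sub>R x)) has_derivative (\<lambda>t. t * (real k * f x))) (at 1)"
    unfolding h by (auto intro!: derivative_eq_intros)
  ultimately have "(\<lambda>h. \<Sum>i\<in>UNIV. (h * x $ i) * partial i f (1 *\<^sub>R x)) = (\<lambda>t. t * (real k * f x))"
    by (rule has_derivative_unique)
  from fun_cong[OF this, of 1] show "euler_field f x = real k * f x"
    by (simp add: euler_field_def)
qed

text \<open>For \<open>c \<noteq> 0\<close> the chain rule allows division by \<open>c\<close>; the case \<open>c = 0\<close>, which the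
  notion of homogeneity includes, follows by continuity.\<close>

lemma partial_homogeneous:
  fixes f :: "real^'n::finite \<Rightarrow> real"
  assumes f: "real_polynomial_function f" and h: "\<And>c x. f (c *\<^sub>R x) = c ^ Suc k * f x"
  shows "partial i f (c *\<^sub>R x) = c ^ k * partial i f x"
proof -
  have nz: "partial i f (c *\<^sub>R x) = c ^ k * partial i f x" if "c \<noteq> 0" for c
  proof -
    have "((\<lambda>x. c *\<^sub>R x) has_derivative (\<lambda>h. c *\<^sub>R h)) (at x)"
      by (auto intro!: derivative_eq_intros)
    from has_derivative_compose[OF this has_derivative_partial[OF differentiable_at_real_polynomial_function[OF f]]]
    have "partial i (\<lambda>x. f (c *\<^sub>R x)) x = (\<Sum>j\<in>UNIV. (c *\<^sub>R axis i 1) $ j * partial j f (c *\<^sub>R x))"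
      by (rule partial_eq)
    also have "\<dots> = c * partial i f (c *\<^sub>R x)"
      by (simp add: axis_def if_distrib[where f="\<lambda>y. y * _"] if_distrib[where f="\<lambda>y. _ * y"] cong: if_cong)
    finally have "c * (c ^ k * partial i f x) = c * partial i f (c *\<^sub>R x)"
      unfolding h partial_cmult[OF f] by (simp add: mult.assoc)
    then show ?thesis using that by auto
  qed
  show ?thesis
  proof (cases "c = 0")
    case True
    have "((\<lambda>c. partial i f (c *\<^sub>R x)) \<longlongrightarrow> partial i f (0 *\<^sub>R x)) (at 0)"
      using has_derivative_continuous[OF has_derivative_ray[OF polynomial_partial[OF f, of i], of x 0]]
      by (simp add: continuous_at)
    moreover have "((\<lambda>c. partial i f (c *\<^sub>R x)) \<longlongrightarrow> 0 ^ k * partial i f x) (at 0)"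
    proof (rule Lim_transform_eventually)
      show "((\<lambda>c. c ^ k * partial i f x) \<longlongrightarrow> 0 ^ k * partial i f x) (at 0)"
        by (auto intro!: tendsto_eq_intros)
      show "\<forall>\<^sub>F c in at 0. c ^ k * partial i f x = partial i f (c *\<^sub>R x)"
        using nz by (auto simp: eventually_at_filter)
    qed
    ultimately show ?thesis using True tendsto_unique[OF at_neq_bot] by metis
  qed (use nz in simp)
qed

text \<open>The polar decomposition of the Laplacian, read off by expanding the squares of the
  rotation fields. It gives the eigenvalue of a spherical harmonic and the action on the bump alike.\<close>

lemma sph_laplacian_euler:
  fixes f :: "real^'n::finite \<Rightarrow> real"
  assumes f: "real_polynomial_function f"
  shows "sph_laplacian f x = (norm x)\<^sup>2 * laplacian f x - euler_field (euler_field f) x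
    - (real CARD('n) - 2) * euler_field f x"
proof -
  define S where "S = (\<Sum>i\<in>UNIV. \<Sum>j\<in>UNIV. x $ i * x $ j * partial i (partial j f) x)"
  have S': "(\<Sum>i\<in>UNIV. \<Sum>j\<in>UNIV. x $ i * x $ j * partial j (partial i f) x) = S"
    unfolding S_def by (simp add: partial_commute[OF f])
  have N: "(norm x)\<^sup>2 = (\<Sum>i\<in>UNIV. x $ i * x $ i)"
    by (simp add: power2_norm_eq_inner inner_vec_def)
  have p: "partial i (\<lambda>x. x $ j * g x) x = x $ j * partial i g x + (if i = j then g x else 0)"
    if "real_polynomial_function g" for g i j
    using partial_mult[OF polynomial_component[of j] that, of i] by (simp add: partial_coord)
  have pr: "real_polynomial_function (\<lambda>x::real^'n. x $ i * g x)" if "real_polynomial_function g" for g i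
    using that by auto
  have r: "partial l (rot_deriv i j f) x = (x $ i * partial l (partial j f) x + (if l = i then partial j f x else 0))
     - (x $ j * partial l (partial i f) x + (if l = j then partial i f x else 0))" for i j l
    unfolding rot_deriv_def real_scaleR_def
    using partial_diff[OF pr[OF polynomial_partial[OF f, of j], of i] pr[OF polynomial_partial[OF f, of i], of j], of l]
    by (simp add: p polynomial_partial f)
  have E: "euler_field (euler_field f) x = euler_field f x + S"
  proof -
    have "partial j (euler_field f) x = (\<Sum>i\<in>UNIV. x $ i * partial j (partial i f) x) + partial j f x" for j
      unfolding euler_field_def
      by (subst partial_sum) (auto simp: p polynomial_partial f sum.distrib)
    then show ?thesis
      by (simp add: euler_field_def[of "euler_field f"])
        (simp add: euler_field_def S_def algebra_simps sum.distrib sum_distrib_left)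
  qed
  have "rot_deriv i j (rot_deriv i j f) x =
      (x $ i * x $ i) * partial j (partial j f) x + (x $ j * x $ j) * partial i (partial i f) x
      - x $ i * x $ j * partial j (partial i f) x - x $ i * x $ j * partial i (partial j f) x
      - x $ i * partial i f x - x $ j * partial j f x
      + (if i = j then x $ i * partial i f x else 0) + (if i = j then x $ i * partial i f x else 0)" for i j
    unfolding rot_deriv_def[of i j "rot_deriv i j f"] real_scaleR_def r
    by (auto simp: algebra_simps)
  moreover have T1: "(\<Sum>i\<in>UNIV. \<Sum>j\<in>UNIV. (x $ i * x $ i) * partial j (partial j f) x) = (norm x)\<^sup>2 * laplacian f x"
    unfolding N laplacian_def by (simp add: sum_product)
  moreover have T2: "(\<Sum>i\<in>UNIV. \<Sum>j\<in>UNIV. (x $ j * x $ j) * partial i (partial i f) x) = (norm x)\<^sup>2 * laplacian f x"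
    unfolding T1[symmetric] by (rule sum.swap)
  moreover have T3: "(\<Sum>i\<in>UNIV. \<Sum>j\<in>(UNIV::'n set). x $ i * partial i f x) = real CARD('n) * euler_field f x"
    "(\<Sum>i\<in>(UNIV::'n set). \<Sum>j\<in>UNIV. x $ j * partial j f x) = real CARD('n) * euler_field f x"
    "(\<Sum>i\<in>UNIV. \<Sum>j\<in>UNIV. (if i = j then x $ i * partial i f x else 0)) = euler_field f x"
    by (simp_all add: euler_field_def sum_distrib_left)
  note T = T1 T2 T3
  ultimately have "(\<Sum>i\<in>UNIV. \<Sum>j\<in>UNIV. rot_deriv i j (rot_deriv i j f) x) =
      2 * ((norm x)\<^sup>2 * laplacian f x) - 2 * S - 2 * real CARD('n) * euler_field f x + 2 * euler_field f x"
    by (simp only: sum.distrib sum_subtractf T S' flip: S_def)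
  then show ?thesis
    unfolding sph_laplacian_def E by (simp add: algebra_simps)
qed

lemma spherical_harmonics_eigenvalue:
  fixes Y :: "real^'n::finite \<Rightarrow> real"
  assumes "Y \<in> spherical_harmonics k"
  shows "sph_laplacian Y x = - (real k * (real k + real CARD('n) - 2)) * Y x"
proof -
  have Y: "real_polynomial_function Y" "\<And>c x. Y (c *\<^sub>R x) = c ^ k * Y x" "\<And>x. laplacian Y x = 0"
    using assms by (auto simp: spherical_harmonics_def)
  have "euler_field (\<lambda>x. real k * Y x) x = real k * euler_field Y x"
    by (simp add: euler_field_def partial_cmult[OF Y(1)] sum_distrib_left mult.left_commute)
  then show ?thesis
    unfolding sph_laplacian_euler[OF Y(1)] euler_homogeneous[OF Y(1,2)]
    by (simp add: Y(3) euler_homogeneous[OF Y(1,2)] algebra_simps)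
qed

lemma spherical_harmonics_zero: "(\<lambda>x. 0) \<in> spherical_harmonics k"
  by (auto simp: spherical_harmonics_def)

lemma spherical_harmonics_add:
  "\<lbrakk>f \<in> spherical_harmonics k; g \<in> spherical_harmonics k\<rbrakk> \<Longrightarrow> (\<lambda>x. f x + g x) \<in> spherical_harmonics k"
  by (auto simp: spherical_harmonics_def laplacian_add algebra_simps)

lemma spherical_harmonics_cmult:
  "f \<in> spherical_harmonics k \<Longrightarrow> (\<lambda>x. c * f x) \<in> spherical_harmonics k"
  by (auto simp: spherical_harmonics_def laplacian_cmult algebra_simps)

lemma spherical_harmonics_partial:
  assumes "f \<in> spherical_harmonics (Suc k)"
  shows "partial i f \<in> spherical_harmonics k"
proof -
  have f: "real_polynomial_function f" "\<And>c x. f (c *\<^sub>R x) = c ^ Suc k * f x" "laplacian f = (\<lambda>x. 0)"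
    using assms by (auto simp: spherical_harmonics_def)
  show ?thesis
    using partial_homogeneous[OF f(1,2)] polynomial_partial[OF f(1)] partial_laplacian[OF f(1), of i]
    by (simp add: spherical_harmonics_def f(3))
qed

text \<open>The product \<open>x $ i * H x\<close> has Laplacian \<open>2 * partial i H x\<close>. Since
  \<open>partial i H\<close> is again harmonic, the Laplacian of \<open>x \<bullet> x * partial i H x\<close> is a multiple of
  \<open>partial i H x\<close>, and the denominator is the one that makes the two contributions cancel.\<close>

lemma spherical_harmonics_mult_coord:
  fixes H :: "real^'n::finite \<Rightarrow> real"
  assumes H: "H \<in> spherical_harmonics (Suc k)"
  shows "(\<lambda>x. x $ i * H x - x \<bullet> x * (partial i H x / (2 * real k + real CARD('n))))
    \<in> spherical_harmonics (Suc (Suc k))"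
proof -
  define d where "d = 2 * real k + real CARD('n)"
  have d: "d > 0" by (simp add: d_def add_nonneg_pos)
  have f: "real_polynomial_function H" "\<And>c x. H (c *\<^sub>R x) = c ^ Suc k * H x" "laplacian H = (\<lambda>x. 0)"
    using H by (auto simp: spherical_harmonics_def)
  define G where "G = (\<lambda>x. (-1/d) * partial i H x)"
  have G: "G \<in> spherical_harmonics k"
    unfolding G_def by (intro spherical_harmonics_cmult spherical_harmonics_partial H)
  have g: "real_polynomial_function G" "\<And>c x. G (c *\<^sub>R x) = c ^ k * G x" "laplacian G = (\<lambda>x. 0)"
    using G by (auto simp: spherical_harmonics_def)
  define q where "q = (\<lambda>x::real^'n. \<Sum>j\<in>UNIV. x $ j * x $ j)"
  have q: "real_polynomial_function q"
    unfolding q_def by (intro real_polynomial_function.intros(4) real_polynomial_function_sum) auto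
  have pq: "partial j q = (\<lambda>x. 2 * x $ j)" for j
    unfolding q_def
    by (subst partial_sum)
      (auto simp: partial_mult[OF polynomial_component polynomial_component] partial_coord fun_eq_iff
        if_distrib[where f="\<lambda>y. y * _"] if_distrib[where f="\<lambda>y. _ * y"] sum.distrib cong: if_cong)
  have lq: "laplacian q = (\<lambda>x. 2 * real CARD('n))"
    by (simp add: laplacian_def pq partial_cmult[OF polynomial_component] partial_coord fun_eq_iff)
  have lx: "laplacian (\<lambda>x::real^'n. x $ i) = (\<lambda>x. 0)"
    by (simp add: laplacian_def partial_coord fun_eq_iff)
  have 1: "laplacian (\<lambda>x. x $ i * H x) = (\<lambda>x. 2 * partial i H x)"
    unfolding laplacian_mult[OF polynomial_component f(1)] lx f(3)
    by (simp add: partial_coord if_distrib[where f="\<lambda>y. y * _"] cong: if_cong)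
  have 2: "laplacian (\<lambda>x. q x * G x) = (\<lambda>x. 2 * d * G x)"
  proof
    fix x
    have "laplacian (\<lambda>x. q x * G x) x = 4 * euler_field G x + 2 * real CARD('n) * G x"
      unfolding laplacian_mult[OF q g(1)] lq pq g(3) by (simp add: euler_field_def sum_distrib_left)
    also have "\<dots> = 2 * d * G x"
      unfolding euler_homogeneous[OF g(1,2)] by (simp add: d_def algebra_simps)
    finally show "laplacian (\<lambda>x. q x * G x) x = 2 * d * G x" .
  qed
  have qi: "x \<bullet> x = q x" for x by (simp add: q_def inner_vec_def)
  have pH: "real_polynomial_function (\<lambda>x. x $ i * H x)" using f(1) by auto
  have pG: "real_polynomial_function (\<lambda>x. q x * G x)" using q g(1) by auto
  have e: "(\<lambda>x. x $ i * H x - x \<bullet> x * (partial i H x / (2 * real k + real CARD('n))))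
    = (\<lambda>x. x $ i * H x + q x * G x)"
    by (simp add: fun_eq_iff qi G_def flip: d_def)
  have "laplacian (\<lambda>x. x $ i * H x + q x * G x) = (\<lambda>x. 0)"
    unfolding laplacian_add[OF pH pG] 1 2 using d by (simp add: G_def)
  moreover have "c * x $ i * H (c *\<^sub>R x) + q (c *\<^sub>R x) * G (c *\<^sub>R x) = c ^ Suc (Suc k) * (x $ i * H x + q x * G x)" for c x
    unfolding f(2) g(2) by (simp add: q_def algebra_simps sum_distrib_left)
  ultimately show ?thesis
    unfolding e spherical_harmonics_def using pH pG
    by (auto intro!: real_polynomial_function.intros(3))
qed

text \<open>Only the values on the unit sphere are prescribed, which is what makes the factor
  \<open>x \<bullet> x\<close> in the multiplication rule harmless.\<close>

definition sphere_expansion :: "nat \<Rightarrow> (real^'n::finite \<Rightarrow> real) set" where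
  "sphere_expansion M = {f. \<exists>H. (\<forall>k. H k \<in> spherical_harmonics k) \<and>
     (\<forall>x. norm x = 1 \<longrightarrow> f x = (\<Sum>k\<le>M. H k x))}"

lemma sphere_expansion_cong:
  assumes "f \<in> sphere_expansion M" "\<And>x. norm x = 1 \<Longrightarrow> f x = g x"
  shows "g \<in> sphere_expansion M"
  using assms by (auto simp: sphere_expansion_def)

lemma sphere_expansion_add:
  assumes "f \<in> sphere_expansion M" "g \<in> sphere_expansion M"
  shows "(\<lambda>x. f x + g x) \<in> sphere_expansion M"
proof -
  obtain H H' where "\<forall>k. H k \<in> spherical_harmonics k" "\<forall>k. H' k \<in> spherical_harmonics k"
    "\<forall>x. norm x = 1 \<longrightarrow> f x = (\<Sum>k\<le>M. H k x)" "\<forall>x. norm x = 1 \<longrightarrow> g x = (\<Sum>k\<le>M. H' k x)"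
    using assms by (auto simp: sphere_expansion_def)
  then show ?thesis
    unfolding sphere_expansion_def
    by (intro CollectI exI[of _ "\<lambda>k x. H k x + H' k x"]) (auto simp: spherical_harmonics_add sum.distrib)
qed

lemma sphere_expansion_single:
  assumes "f \<in> spherical_harmonics k" "k \<le> M"
  shows "f \<in> sphere_expansion M"
proof -
  have "(\<lambda>x. if j = k then f x else 0) \<in> spherical_harmonics j" for j
    using assms spherical_harmonics_zero by (cases "j = k") auto
  then show ?thesis unfolding sphere_expansion_def
    by (intro CollectI exI[of _ "\<lambda>j x. if j = k then f x else 0"]) (use assms in auto)
qed

lemma sphere_expansion_sum:
  assumes "finite S" "\<And>k. k \<in> S \<Longrightarrow> f k \<in> sphere_expansion M"
  shows "(\<lambda>x. \<Sum>k\<in>S. f k x) \<in> sphere_expansion M"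
  using assms
proof (induction S rule: finite_induct)
  case empty
  show ?case using sphere_expansion_single[OF spherical_harmonics_zero, of 0 M] by simp
next
  case (insert k S)
  then show ?case using sphere_expansion_add[of "f k" M] by simp
qed

text \<open>On the sphere the term subtracted in \<open>spherical_harmonics_mult_coord\<close> is itself a
  harmonic of degree \<open>k - 1\<close>, so the degree grows by at most one.\<close>

lemma sphere_expansion_mult_coord:
  fixes H :: "real^'n::finite \<Rightarrow> real"
  assumes H: "H \<in> spherical_harmonics k" and k: "k \<le> M"
  shows "(\<lambda>x. x $ i * H x) \<in> sphere_expansion (Suc M)"
proof (cases k)
  case 0
  have c: "H x = H 0" for x
  proof -
    have "H (0 *\<^sub>R x) = 0 ^ 0 * H x" using H unfolding spherical_harmonics_def 0 by blast
    then show ?thesis by simp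
  qed
  have "(\<lambda>x::real^'n. x $ i) \<in> spherical_harmonics 1"
    by (auto simp: spherical_harmonics_def laplacian_def partial_coord)
  from spherical_harmonics_cmult[OF this, of "H 0"] have "(\<lambda>x. H 0 * x $ i) \<in> sphere_expansion (Suc M)"
    by (rule sphere_expansion_single) simp
  then show ?thesis by (rule sphere_expansion_cong) (metis c mult.commute)
next
  case (Suc m)
  let ?d = "2 * real m + real CARD('n)"
  have "(\<lambda>x. (1 / ?d) * partial i H x) \<in> sphere_expansion (Suc M)"
    using k Suc by (intro sphere_expansion_single[of _ m] spherical_harmonics_cmult spherical_harmonics_partial) (use H in auto)
  moreover have "(\<lambda>x. x $ i * H x - x \<bullet> x * (partial i H x / ?d)) \<in> sphere_expansion (Suc M)"
    using k Suc by (intro sphere_expansion_single[of _ "Suc (Suc m)"] spherical_harmonics_mult_coord) (use H in auto)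
  ultimately have "(\<lambda>x. (1 / ?d) * partial i H x + (x $ i * H x - x \<bullet> x * (partial i H x / ?d)))
    \<in> sphere_expansion (Suc M)"
    by (rule sphere_expansion_add)
  then show ?thesis by (rule sphere_expansion_cong) (simp add: norm_eq_1)
qed

lemma sphere_expansion_bump:
  "(\<lambda>x::real^'n::finite. ((1 + x $ i) / 2) ^ M) \<in> sphere_expansion M"
proof (induction M)
  case 0
  have "(\<lambda>x::real^'n. 1) \<in> spherical_harmonics 0" by (auto simp: spherical_harmonics_def)
  then show ?case by (auto intro: sphere_expansion_single)
next
  case (Suc M)
  then obtain H where H: "\<forall>k. H k \<in> spherical_harmonics k"
    "\<forall>x::real^'n. norm x = 1 \<longrightarrow> ((1 + x $ i) / 2) ^ M = (\<Sum>k\<le>M. H k x)"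
    by (auto simp: sphere_expansion_def)
  define H' where "H' k x = (1/2) * H k x" for k x
  have H': "H' k \<in> spherical_harmonics k" for k
    unfolding H'_def using H by (intro spherical_harmonics_cmult) auto
  have "(\<lambda>x. \<Sum>k\<le>M. H' k x + x $ i * H' k x) \<in> sphere_expansion (Suc M)"
    by (intro sphere_expansion_sum sphere_expansion_add sphere_expansion_mult_coord[OF H']
        sphere_expansion_single[OF H']) auto
  then show ?case
  proof (rule sphere_expansion_cong)
    fix x :: "real^'n"
    assume "norm x = 1"
    then have "((1 + x $ i) / 2) ^ Suc M = (1 + x $ i) / 2 * (\<Sum>k\<le>M. H k x)" using H by simp
    then show "(\<Sum>k\<le>M. H' k x + x $ i * H' k x) = ((1 + x $ i) / 2) ^ Suc M"
      by (simp add: H'_def sum_distrib_left algebra_simps sum.distrib add_divide_distrib)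
  qed
qed

lemma partial_bump:
  "partial j (\<lambda>x::real^'n::finite. ((1 + x $ i) / 2) ^ m) =
     (\<lambda>x. (if j = i then real m / 2 * ((1 + x $ i) / 2) ^ (m - 1) else 0))"
proof
  fix x :: "real^'n"
  have "((\<lambda>x::real^'n. x $ i) has_derivative (\<lambda>h. h $ i)) (at x)"
    by (intro bounded_linear_imp_has_derivative bounded_linear_vec_nth)
  then have "((\<lambda>x::real^'n. ((1 + x $ i) / 2) ^ m) has_derivative
    (\<lambda>h. real m * (h $ i / 2) * ((1 + x $ i) / 2) ^ (m - 1))) (at x)"
    by (auto intro!: derivative_eq_intros)
  from partial_eq[OF this, of j] show "partial j (\<lambda>x::real^'n. ((1 + x $ i) / 2) ^ m) x =
    (if j = i then real m / 2 * ((1 + x $ i) / 2) ^ (m - 1) else 0)"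
    by (cases "j = i") (auto simp: axis_def)
qed

lemma polynomial_bump_power [intro]: "real_polynomial_function (\<lambda>x::real^'n::finite. ((1 + x $ i) / 2) ^ m)"
  by (intro real_polynomial_function_power real_polynomial_function_divide real_polynomial_function.intros(2,3)) auto

text \<open>The spherical Laplacian of \<open>P ^ M\<close> consists of a nonnegative second order term and a
  first order term of size \<open>n * M\<close>. In the energy density the former has a favourable sign, so only
  one factor \<open>M\<close>, not \<open>M\<^sup>2\<close>, is lost: the bump varies on the angular scale \<open>1 / sqrt M\<close>.\<close>

lemma bump_energy_bound:
  fixes x :: "real^'n::finite"
  assumes x: "norm x = 1" and M: "M \<ge> 1" and n: "CARD('n) \<ge> 2" and P_def: "P = (1 + x $ i) / 2"
  shows "- (P ^ M * sph_laplacian (\<lambda>x. ((1 + x $ i) / 2) ^ M) x)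
    \<le> real CARD('n) * real M * P ^ (2 * M - 2)"
proof -
  let ?Q = "\<lambda>x::real^'n. ((1 + x $ i) / 2) ^ M"
  let ?R = "\<lambda>x::real^'n. ((1 + x $ i) / 2) ^ (M - 1)"
  have xi: "\<bar>x $ i\<bar> \<le> 1" using component_le_norm_cart[of x i] x by simp
  then have P: "0 \<le> P" "P \<le> 1" unfolding P_def by auto
  have L: "laplacian ?Q x = real M / 2 * (real (M - 1) / 2 * P ^ (M - 2))"
    unfolding laplacian_def partial_bump
    using partial_cmult[OF polynomial_bump_power, of i "real M / 2" i "M - 1"]
    by (subst sum.remove[of _ i]) (auto simp: partial_bump P_def numeral_2_eq_2)
  have E: "euler_field ?Q = (\<lambda>x. real M / 2 * (x $ i * ?R x))"
    by (simp add: fun_eq_iff euler_field_def partial_bump if_distrib[where f="\<lambda>y. _ * y"] cong: if_cong)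
  have xR: "real_polynomial_function (\<lambda>x::real^'n. x $ i * ?R x)"
    by (intro real_polynomial_function.intros(4)) auto
  have EE: "euler_field (euler_field ?Q) x =
     real M / 2 * (x $ i * (x $ i * (real (M - 1) / 2 * P ^ (M - 2)) + P ^ (M - 1)))"
  proof -
    have "partial j (\<lambda>x. real M / 2 * (x $ i * ?R x)) x = (if j = i then
       real M / 2 * (x $ i * (real (M - 1) / 2 * P ^ (M - 2)) + P ^ (M - 1)) else 0)" for j
      unfolding partial_cmult[OF xR] partial_mult[OF polynomial_component polynomial_bump_power] partial_coord partial_bump
      by (auto simp: P_def numeral_2_eq_2)
    then show ?thesis unfolding E
      by (simp add: euler_field_def if_distrib[where f="\<lambda>y. _ * y"] cong: if_cong)
  qed
  have "sph_laplacian ?Q x = real M / 2 * (real (M - 1) / 2) * P ^ (M - 2) * (1 - (x $ i)\<^sup>2)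
     - (real CARD('n) - 1) * (real M / 2) * (x $ i * P ^ (M - 1))"
    unfolding sph_laplacian_euler[OF polynomial_bump_power] EE L
    unfolding E x by (simp add: P_def power2_eq_square field_simps)
  moreover have "real M / 2 * (real (M - 1) / 2) * P ^ (M - 2) * (1 - (x $ i)\<^sup>2) \<ge> 0"
    using xi P by (intro mult_nonneg_nonneg) (auto simp: abs_square_le_1)
  moreover have "x $ i * P ^ (M - 1) \<le> P ^ (M - 1)"
    using xi P mult_right_mono[of "x $ i" 1 "P ^ (M - 1)"] by simp
  then have "(real CARD('n) - 1) * (real M / 2) * (x $ i * P ^ (M - 1)) \<le>
      (real CARD('n) - 1) * (real M / 2) * P ^ (M - 1)"
    using n by (intro mult_left_mono mult_nonneg_nonneg) auto
  ultimately have "- sph_laplacian ?Q x \<le> (real CARD('n) - 1) * (real M / 2) * P ^ (M - 1)"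
    by simp
  also have "\<dots> \<le> real CARD('n) * real M * P ^ (M - 1)"
    using P n by (intro mult_mono) auto
  finally have "P ^ M * (- sph_laplacian ?Q x) \<le> P ^ M * (real CARD('n) * real M * P ^ (M - 1))"
    using P by (intro mult_left_mono) auto
  also have "\<dots> \<le> P ^ (M - 1) * (real CARD('n) * real M * P ^ (M - 1))"
    using P by (intro mult_right_mono power_decreasing) auto
  also have "\<dots> = real CARD('n) * real M * P ^ ((M - 1) + (M - 1))"
    by (simp only: power_add mult_ac)
  also have "(M - 1) + (M - 1) = 2 * M - 2" by simp
  finally show ?thesis by simp
qed

section \<open>Rotations and orthogonality\<close>

text \<open>The rotation by \<open>\<theta>\<close> in the plane of the coordinates \<open>i\<close> and \<open>j\<close>, for \<open>i \<noteq> j\<close>, whose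
  generator is the field of \<^const>\<open>rot_deriv\<close>.\<close>

definition plane_rotation :: "'n::finite \<Rightarrow> 'n \<Rightarrow> real \<Rightarrow> real^'n \<Rightarrow> real^'n" where
  "plane_rotation i j \<theta> x = x + ((cos \<theta> - 1) * x $ i - sin \<theta> * x $ j) *\<^sub>R axis i 1
     + (sin \<theta> * x $ i + (cos \<theta> - 1) * x $ j) *\<^sub>R axis j 1"

lemma plane_rotation_0 [simp]: "plane_rotation i j 0 x = x"
  by (simp add: plane_rotation_def)

lemma norm_plane_rotation [simp]:
  assumes "i \<noteq> j"
  shows "norm (plane_rotation i j \<theta> x) = norm x"
proof -
  define a where "a = (cos \<theta> - 1) * x $ i - sin \<theta> * x $ j"
  define b where "b = sin \<theta> * x $ i + (cos \<theta> - 1) * x $ j"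
  have [simp]: "axis i (1::real) \<bullet> axis j 1 = 0" "axis j (1::real) \<bullet> axis i 1 = 0"
    using assms by (simp_all add: inner_axis_axis)
  have [simp]: "axis i (1::real) \<bullet> axis i 1 = 1" "axis j (1::real) \<bullet> axis j 1 = 1"
    by (simp_all add: inner_axis_axis)
  have [simp]: "axis k (1::real) \<bullet> x = x $ k" "x \<bullet> axis k 1 = x $ k" for k
    by (simp_all add: inner_axis' inner_axis)
  have s: "(sin \<theta>)\<^sup>2 = 1 - (cos \<theta>)\<^sup>2" by (simp add: sin_squared_eq)
  have "plane_rotation i j \<theta> x \<bullet> plane_rotation i j \<theta> x = x \<bullet> x + 2 * a * x $ i + 2 * b * x $ j + a\<^sup>2 + b\<^sup>2"
    unfolding plane_rotation_def a_def[symmetric] b_def[symmetric]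
    by (simp add: inner_simps power2_eq_square algebra_simps)
  also have "a\<^sup>2 + b\<^sup>2 = ((cos \<theta> - 1)\<^sup>2 + (sin \<theta>)\<^sup>2) * ((x $ i)\<^sup>2 + (x $ j)\<^sup>2)"
    unfolding a_def b_def by algebra
  then have "x \<bullet> x + 2 * a * x $ i + 2 * b * x $ j + a\<^sup>2 + b\<^sup>2 = x \<bullet> x"
    unfolding s unfolding a_def b_def by (simp add: power2_eq_square algebra_simps)
  finally show ?thesis by (simp add: norm_eq)
qed

lemma linear_plane_rotation: "linear (plane_rotation i j \<theta>)"
  unfolding plane_rotation_def by (rule linearI) (simp_all add: algebra_simps)

lemma plane_rotation_scaleR: "plane_rotation i j \<theta> (c *\<^sub>R x) = c *\<^sub>R plane_rotation i j \<theta> x"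
  by (simp add: linear_plane_rotation linear_cmul)

text \<open>Tonelli's theorem with the coordinate \<open>i\<close> integrated first.\<close>

lemma nn_integral_lborel_axis:
  fixes g :: "real^'n::finite \<Rightarrow> ennreal"
  assumes g [measurable]: "g \<in> borel_measurable borel"
  shows "(\<integral>\<^sup>+x. g x \<partial>lborel) = (\<integral>\<^sup>+u. (\<integral>\<^sup>+y. g (y *\<^sub>R axis i 1 + (\<Sum>b\<in>Basis - {axis i 1}. u b *\<^sub>R b)) \<partial>lborel)
      \<partial>(\<Pi>\<^sub>M b\<in>Basis - {axis i 1}. lborel))"
proof -
  interpret product_sigma_finite "\<lambda>_::real^'n. lborel :: real measure" by standard
  let ?b = "axis i (1::real)"
  let ?R = "\<Pi>\<^sub>M b\<in>Basis - {?b}. lborel"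
  let ?T = "\<lambda>f::real^'n \<Rightarrow> real. \<Sum>b\<in>Basis. f b *\<^sub>R b"
  have B: "Basis = insert ?b (Basis - {?b})" by (auto simp: axis_in_Basis_iff)
  have "(\<integral>\<^sup>+x. g x \<partial>lborel) = (\<integral>\<^sup>+f. g (?T f) \<partial>(\<Pi>\<^sub>M b\<in>Basis. lborel))"
    by (subst lborel_eq) (simp add: nn_integral_distr)
  also have "\<dots> = (\<integral>\<^sup>+f. g (?T f) \<partial>(\<Pi>\<^sub>M b\<in>insert ?b (Basis - {?b}). lborel))"
    using B by simp
  also have "\<dots> = (\<integral>\<^sup>+u. (\<integral>\<^sup>+y. g (?T (u(?b := y))) \<partial>lborel) \<partial>?R)"
    using B by (intro product_nn_integral_insert) auto
  finally have *: "(\<integral>\<^sup>+x. g x \<partial>lborel) = (\<integral>\<^sup>+u. (\<integral>\<^sup>+y. g (?T (u(?b := y))) \<partial>lborel) \<partial>?R)" .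
  have "?T (u(?b := y)) = y *\<^sub>R ?b + (\<Sum>b\<in>Basis - {?b}. u b *\<^sub>R b)" for u y
    by (subst sum.remove[of _ ?b]) (auto simp: axis_in_Basis_iff intro!: sum.cong)
  then show ?thesis unfolding * by presburger
qed

text \<open>Along the axis of the shear the map is a translation.\<close>

lemma distr_lborel_shear:
  assumes ij: "i \<noteq> j"
  shows "distr lborel borel (\<lambda>x::real^'n::finite. x + (c * x $ j) *\<^sub>R axis i 1) = lborel"
proof (rule measure_eqI)
  let ?S = "\<lambda>x::real^'n. x + (c * x $ j) *\<^sub>R axis i 1"
  fix A assume "A \<in> sets (distr lborel borel ?S)"
  then have A [measurable]: "A \<in> sets borel" by simp
  let ?v = "\<lambda>u::real^'n \<Rightarrow> real. \<Sum>b\<in>Basis - {axis i 1}. u b *\<^sub>R b"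
  have s: "?S (y *\<^sub>R axis i 1 + ?v u) = (c * ?v u $ j + 1 * y) *\<^sub>R axis i 1 + ?v u" for y u
    using ij by (simp add: algebra_simps axis_def)
  have "emeasure (distr lborel borel ?S) A = (\<integral>\<^sup>+x. indicator A (?S x) \<partial>lborel)"
    by (subst nn_integral_distr[symmetric, of _ _ borel]) auto
  also have "\<dots> = (\<integral>\<^sup>+u. (\<integral>\<^sup>+y. indicator A (?S (y *\<^sub>R axis i 1 + ?v u)) \<partial>lborel)
      \<partial>(\<Pi>\<^sub>M b\<in>Basis - {axis i 1}. lborel))"
    by (rule nn_integral_lborel_axis) measurable
  also have "\<dots> = (\<integral>\<^sup>+u. (\<integral>\<^sup>+y. indicator A (y *\<^sub>R axis i 1 + ?v u) \<partial>lborel)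
      \<partial>(\<Pi>\<^sub>M b\<in>Basis - {axis i 1}. lborel))"
  proof (rule nn_integral_cong)
    fix u :: "real^'n \<Rightarrow> real"
    have m: "(\<lambda>y::real. y *\<^sub>R axis i 1 + ?v u) \<in> borel \<rightarrow>\<^sub>M borel"
      by (intro borel_measurable_continuous_onI continuous_intros)
    have "(\<integral>\<^sup>+y. indicator A (y *\<^sub>R axis i 1 + ?v u) \<partial>lborel) =
       ennreal \<bar>1\<bar> * (\<integral>\<^sup>+y. indicator A ((c * ?v u $ j + 1 * y) *\<^sub>R axis i 1 + ?v u) \<partial>lborel)"
      by (rule nn_integral_real_affine[OF measurable_compose[OF m borel_measurable_indicator[OF A]]]) simp
    then show "(\<integral>\<^sup>+y. indicator A (?S (y *\<^sub>R axis i 1 + ?v u)) \<partial>lborel) =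
       (\<integral>\<^sup>+y. indicator A (y *\<^sub>R axis i 1 + ?v u) \<partial>lborel)"
      unfolding s by simp
  qed
  also have "\<dots> = (\<integral>\<^sup>+x. indicator A x \<partial>lborel)"
    by (rule nn_integral_lborel_axis[symmetric]) measurable
  finally show "emeasure (distr lborel borel ?S) A = emeasure lborel A" by simp
qed simp

text \<open>A rotation is a product of three shears, with parameters \<open>- tan (\<theta> / 2)\<close>,
  \<open>sin \<theta>\<close> and \<open>- tan (\<theta> / 2)\<close>; the restriction on \<open>\<theta>\<close> makes the tangent finite, and small
  angles suffice for differentiation at \<open>0\<close>.\<close>

lemma distr_lborel_plane_rotation:
  fixes i j :: "'n::finite"
  assumes ij: "i \<noteq> j" and \<theta>: "sin \<theta> \<noteq> 0"
  shows "distr lborel borel (plane_rotation i j \<theta>) = lborel"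
proof -
  \<comment> \<open>The half-angle formula for \<open>- tan (\<theta> / 2)\<close>.\<close>
  define t where "t = - ((1 - cos \<theta>) / sin \<theta>)"
  let ?S = "\<lambda>i j c (x::real^'n). x + (c * x $ j) *\<^sub>R axis i 1"
  have [measurable]: "?S i j c \<in> borel_measurable borel" for i j c by measurable
  have ts: "t * sin \<theta> = cos \<theta> - 1" using \<theta> by (simp add: t_def)
  have tc: "t * (1 + cos \<theta>) = - sin \<theta>"
  proof -
    have "(1 - cos \<theta>) * (1 + cos \<theta>) = sin \<theta> * sin \<theta>"
      using sin_cos_squared_add[of \<theta>] by (simp add: power2_eq_square algebra_simps)
    then show ?thesis using \<theta> by (simp add: t_def)
  qed
  have "plane_rotation i j \<theta> = ?S i j t \<circ> (?S j i (sin \<theta>) \<circ> ?S i j t)"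
  proof
    fix x :: "real^'n"
    let ?y = "?S j i (sin \<theta>) (?S i j t x)"
    have "sin \<theta> * (x $ i + t * x $ j) = sin \<theta> * x $ i + (cos \<theta> - 1) * x $ j"
      unfolding ts[symmetric] by (simp add: algebra_simps)
    moreover have yj: "?y $ j = sin \<theta> * x $ i + cos \<theta> * x $ j"
      using ij calculation by (simp add: axis_def algebra_simps)
    moreover have "t * x $ j + t * ?y $ j = (cos \<theta> - 1) * x $ i - sin \<theta> * x $ j"
    proof -
      have "t * x $ j + t * ?y $ j = (t * sin \<theta>) * x $ i + (t * (1 + cos \<theta>)) * x $ j"
        unfolding yj by (simp only: algebra_simps)
      then show ?thesis unfolding ts tc by simp
    qed
    moreover have "?y = x + (t * x $ j) *\<^sub>R axis i 1 + (sin \<theta> * (x $ i + t * x $ j)) *\<^sub>R axis j 1"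
      using ij by (simp add: axis_def)
    moreover define d b where "d = ?y $ j" and "b = sin \<theta> * (x $ i + t * x $ j)"
    ultimately have "plane_rotation i j \<theta> x = x + (t * x $ j + t * d) *\<^sub>R axis i 1 + b *\<^sub>R axis j 1"
      and y: "?y = x + (t * x $ j) *\<^sub>R axis i 1 + b *\<^sub>R axis j 1"
      unfolding plane_rotation_def by simp_all
    then have "plane_rotation i j \<theta> x = ?y + (t * d) *\<^sub>R axis i 1"
      unfolding y by (simp add: scaleR_left_distrib)
    then show "plane_rotation i j \<theta> x = (?S i j t \<circ> (?S j i (sin \<theta>) \<circ> ?S i j t)) x"
      unfolding comp_apply d_def .
  qed
  then show ?thesis
    using ij distr_distr[of "?S i j t" borel borel "?S j i (sin \<theta>) \<circ> ?S i j t" lborel]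
      distr_distr[of "?S j i (sin \<theta>)" borel borel "?S i j t" lborel]
    by (simp add: distr_lborel_shear)
qed

lemma has_real_derivative_rotation:
  fixes f :: "real^'n::finite \<Rightarrow> real"
  assumes f: "real_polynomial_function f" and ij: "i \<noteq> j"
  shows "((\<lambda>\<theta>. f (plane_rotation i j \<theta> x)) has_real_derivative
    rot_deriv i j f (plane_rotation i j \<theta> x)) (at \<theta>)"
proof -
  let ?y = "plane_rotation i j \<theta> x"
  have y: "?y $ i = cos \<theta> * x $ i - sin \<theta> * x $ j" "?y $ j = sin \<theta> * x $ i + cos \<theta> * x $ j"
    using ij by (simp_all add: plane_rotation_def axis_def algebra_simps)
  have "((\<lambda>\<theta>. plane_rotation i j \<theta> x) has_derivative
     (\<lambda>h. (h * - ?y $ j) *\<^sub>R axis i 1 + (h * ?y $ i) *\<^sub>R axis j 1)) (at \<theta>)"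
    unfolding y unfolding plane_rotation_def
    by (auto intro!: derivative_eq_intros simp: algebra_simps)
  from has_derivative_compose[OF this has_derivative_partial[OF differentiable_at_real_polynomial_function[OF f]]]
  have "((\<lambda>\<theta>. f (plane_rotation i j \<theta> x)) has_derivative
     (\<lambda>h. \<Sum>k\<in>UNIV. ((h * - ?y $ j) *\<^sub>R axis i 1 + (h * ?y $ i) *\<^sub>R axis j 1) $ k * partial k f ?y)) (at \<theta>)" .
  also have "(\<lambda>h. \<Sum>k\<in>UNIV. ((h * - ?y $ j) *\<^sub>R axis i 1 + (h * ?y $ i) *\<^sub>R axis j 1) $ k * partial k f ?y)
    = (*) (rot_deriv i j f ?y)"
    by (simp add: fun_eq_iff rot_deriv_def axis_def algebra_simps sum.distrib sum_subtractf
        if_distrib[where f="\<lambda>y. y * _"] if_distrib[where f="\<lambda>y. _ * y"] cong: if_cong)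
  finally show ?thesis by (simp add: has_field_derivative_def)
qed

lemma rot_deriv_self [simp]: "rot_deriv i i f = (\<lambda>x. 0)"
  by (simp add: rot_deriv_def fun_eq_iff)

text \<open>Rotation fields are tangential: they differentiate along a curve that stays on the
  sphere.\<close>

lemma rot_deriv_sphere_cong:
  fixes f :: "real^'n::finite \<Rightarrow> real"
  assumes f: "real_polynomial_function f" and g: "real_polynomial_function g"
    and eq: "\<And>x. norm x = 1 \<Longrightarrow> f x = g x" and x: "norm x = 1"
  shows "rot_deriv i j f x = rot_deriv i j g x"
proof (cases "i = j")
  case False
  have e: "(\<lambda>\<theta>. f (plane_rotation i j \<theta> x)) = (\<lambda>\<theta>. g (plane_rotation i j \<theta> x))"
    using False x by (intro ext eq) simp
  show ?thesis
    using has_real_derivative_rotation[OF f False, of x 0] has_real_derivative_rotation[OF g False, of x 0]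
    unfolding e by (auto dest: DERIV_unique)
qed simp

lemma sph_laplacian_sphere_cong:
  fixes f :: "real^'n::finite \<Rightarrow> real"
  assumes "real_polynomial_function f" "real_polynomial_function g"
    and "\<And>x. norm x = 1 \<Longrightarrow> f x = g x" and "norm x = 1"
  shows "sph_laplacian f x = sph_laplacian g x"
proof -
  have "rot_deriv i j (rot_deriv i j f) x = rot_deriv i j (rot_deriv i j g) x" for i j
    using assms by (intro rot_deriv_sphere_cong polynomial_rot_deriv) auto
  then show ?thesis by (simp add: sph_laplacian_def)
qed

lemma continuous_on_polynomial: "real_polynomial_function f \<Longrightarrow> continuous_on A f"
  by (simp add: continuous_on_polymonial_function real_polynomial_function_eq)

lemma measurable_polynomial:
  "real_polynomial_function f \<Longrightarrow> f \<in> borel_measurable borel"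
  by (intro borel_measurable_continuous_onI continuous_on_polynomial)

lemma polynomial_bounded_unit_ball:
  fixes f :: "real^'n::finite \<Rightarrow> real"
  assumes "real_polynomial_function f"
  shows "\<exists>B\<ge>0. \<forall>x. norm x \<le> 1 \<longrightarrow> \<bar>f x\<bar> \<le> B"
proof -
  have "bounded (f ` cball 0 1)"
    by (intro compact_imp_bounded compact_continuous_image continuous_on_polynomial assms compact_cball)
  then obtain B where "B > 0" "\<And>x. x \<in> cball 0 1 \<Longrightarrow> \<bar>f x\<bar> \<le> B"
    by (auto simp: bounded_pos)
  then show ?thesis by (intro exI[of _ B]) auto
qed

abbreviation dir :: "real^'n::finite \<Rightarrow> real^'n" where
  "dir \<xi> \<equiv> \<xi> /\<^sub>R norm \<xi>"

lemma norm_dir_le: "norm (dir \<xi>) \<le> 1"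
  by (cases "\<xi> = 0") auto

lemma integrable_radial_polynomial:
  fixes f :: "real^'n::finite \<Rightarrow> real"
  assumes w: "integrable lborel (\<lambda>\<xi>::real^'n. w (norm \<xi>) :: real)" and f: "real_polynomial_function f"
  shows "integrable lborel (\<lambda>\<xi>. w (norm \<xi>) * f (dir \<xi>))"
proof -
  obtain B where B: "B \<ge> 0" "\<And>x. norm x \<le> 1 \<Longrightarrow> \<bar>f x\<bar> \<le> B" using polynomial_bounded_unit_ball[OF f] by blast
  note [measurable] = measurable_polynomial[OF f] borel_measurable_integrable[OF w]
  show ?thesis
  proof (rule Bochner_Integration.integrable_bound)
    show "integrable lborel (\<lambda>\<xi>::real^'n. B * w (norm \<xi>))" using w by simp
    show "(\<lambda>\<xi>. w (norm \<xi>) * f (dir \<xi>)) \<in> borel_measurable lborel" by measurable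
    show "AE \<xi> in lborel. norm (w (norm \<xi>) * f (dir \<xi>)) \<le> norm (B * w (norm \<xi>))"
    proof (rule AE_I2)
      fix \<xi> :: "real^'n"
      show "norm (w (norm \<xi>) * f (dir \<xi>)) \<le> norm (B * w (norm \<xi>))"
        using B(2)[OF norm_dir_le[of \<xi>]] B(1) by (simp add: abs_mult mult.commute[of B] mult_left_mono)
    qed
  qed
qed

text \<open>The integral of \<open>w (norm \<xi>) * f (dir \<xi>)\<close> does not change when \<open>f\<close> is rotated. The
  difference quotients thus have integral zero, and dominated convergence passes to the derivative.\<close>

lemma integral_rot_deriv_eq_0:
  fixes f :: "real^'n::finite \<Rightarrow> real"
  assumes w: "integrable lborel (\<lambda>\<xi>::real^'n. w (norm \<xi>) :: real)" and f: "real_polynomial_function f"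
  shows "(LINT \<xi>|lborel. w (norm \<xi>) * rot_deriv i j f (dir \<xi>)) = 0"
proof (cases "i = j")
  case ij: False
  obtain B where B: "B \<ge> 0" "\<And>x. norm x \<le> 1 \<Longrightarrow> \<bar>rot_deriv i j f x\<bar> \<le> B"
    using polynomial_bounded_unit_ball[OF polynomial_rot_deriv[OF f, of i j]] by blast
  note [measurable] = measurable_polynomial[OF f] measurable_polynomial[OF polynomial_rot_deriv[OF f, of i j]] borel_measurable_integrable[OF w]
  have [measurable]: "plane_rotation i j \<theta> \<in> borel_measurable borel" for \<theta>
    by (intro borel_measurable_continuous_onI linear_continuous_on
        linear_plane_rotation[unfolded linear_conv_bounded_linear])
  let ?R = "plane_rotation i j"
  have inv: "(LINT \<xi>|lborel. w (norm \<xi>) * f (?R \<theta> (dir \<xi>))) = (LINT \<xi>|lborel. w (norm \<xi>) * f (dir \<xi>))"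
    and int: "integrable lborel (\<lambda>\<xi>. w (norm \<xi>) * f (?R \<theta> (dir \<xi>)))"
    if \<theta>: "sin \<theta> \<noteq> 0" for \<theta>
  proof -
    have e: "w (norm (?R \<theta> \<xi>)) * f (dir (?R \<theta> \<xi>))
      = w (norm \<xi>) * f (?R \<theta> (dir \<xi>))" for \<xi>
      using ij by (simp add: plane_rotation_scaleR)
    show "integrable lborel (\<lambda>\<xi>. w (norm \<xi>) * f (?R \<theta> (dir \<xi>)))"
      using integrable_radial_polynomial[OF w f]
      unfolding e[symmetric]
      by (subst (asm) distr_lborel_plane_rotation[OF ij \<theta>, symmetric])
        (subst (asm) integrable_distr_eq, auto)
    have "(LINT \<xi>|lborel. w (norm \<xi>) * f (dir \<xi>)) = (LINT \<xi>|distr lborel borel (?R \<theta>). w (norm \<xi>) * f (dir \<xi>))"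
      by (simp add: distr_lborel_plane_rotation[OF ij \<theta>])
    also have "\<dots> = (LINT \<xi>|lborel. w (norm \<xi>) * f (?R \<theta> (dir \<xi>)))"
      unfolding e[symmetric] by (rule integral_distr) measurable
    finally show "(LINT \<xi>|lborel. w (norm \<xi>) * f (?R \<theta> (dir \<xi>))) = (LINT \<xi>|lborel. w (norm \<xi>) * f (dir \<xi>))" ..
  qed
  define q where "q m \<xi> = w (norm \<xi>) * ((f (?R (inverse (real (Suc m))) (dir \<xi>)) - f (dir \<xi>)) / inverse (real (Suc m)))" for m \<xi>
  have [measurable]: "q m \<in> borel_measurable lborel" for m
    unfolding q_def by measurable
  have q0: "(LINT \<xi>|lborel. q m \<xi>) = 0" for m
  proof -
    have "inverse (real (Suc m)) \<le> 1" by (simp add: inverse_le_1_iff)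
    then have sin: "sin (inverse (real (Suc m))) \<noteq> 0"
      using pi_gt3 by (intro less_imp_neq[symmetric] sin_gt_zero) auto
    have "(LINT \<xi>|lborel. q m \<xi>) = (LINT \<xi>|lborel. real (Suc m) * (w (norm \<xi>) * f (?R (inverse (real (Suc m))) (dir \<xi>)) - w (norm \<xi>) * f (dir \<xi>)))"
      by (rule arg_cong[where f="integral\<^sup>L lborel"]) (simp add: q_def fun_eq_iff divide_inverse right_diff_distrib mult_ac del: of_nat_Suc)
    also have "\<dots> = 0"
      using int[OF sin] integrable_radial_polynomial[OF w f] by (simp add: inv[OF sin] del: of_nat_Suc)
    finally show ?thesis .
  qed
  have "(\<lambda>m. LINT \<xi>|lborel. q m \<xi>) \<longlonglongrightarrow> (LINT \<xi>|lborel. w (norm \<xi>) * rot_deriv i j f (dir \<xi>))"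
  proof (rule integral_dominated_convergence)
    show "integrable lborel (\<lambda>\<xi>::real^'n. B * norm (w (norm \<xi>)))" using w by auto
    show "AE \<xi> in lborel. (\<lambda>m. q m \<xi>) \<longlonglongrightarrow> w (norm \<xi>) * rot_deriv i j f (dir \<xi>)"
    proof (rule AE_I2)
      fix \<xi> :: "real^'n"
      have "((\<lambda>h. (f (?R h (dir \<xi>)) - f (dir \<xi>)) / h) \<longlongrightarrow> rot_deriv i j f (dir \<xi>)) (at 0)"
        using has_real_derivative_rotation[OF f ij, of "dir \<xi>" 0] by (simp add: DERIV_def)
      moreover have "filterlim (\<lambda>m. inverse (real (Suc m))) (at 0) sequentially"
        unfolding filterlim_at using LIMSEQ_inverse_real_of_nat by auto
      ultimately show "(\<lambda>m. q m \<xi>) \<longlonglongrightarrow> w (norm \<xi>) * rot_deriv i j f (dir \<xi>)"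
        unfolding q_def by (intro tendsto_mult tendsto_const) (rule filterlim_compose)
    qed
    show "AE \<xi> in lborel. norm (q m \<xi>) \<le> B * norm (w (norm \<xi>))" for m
    proof (rule AE_I2)
      fix \<xi> :: "real^'n"
      define h where "h = inverse (real (Suc m))"
      have h: "h > 0" by (simp add: h_def)
      obtain z where "f (?R h (dir \<xi>)) - f (?R 0 (dir \<xi>))
         = (h - 0) * rot_deriv i j f (?R z (dir \<xi>))"
        using MVT2[OF h, of "\<lambda>\<theta>. f (?R \<theta> (dir \<xi>))" "\<lambda>\<theta>. rot_deriv i j f (?R \<theta> (dir \<xi>))"]
          has_real_derivative_rotation[OF f ij] by blast
      then have "q m \<xi> = w (norm \<xi>) * rot_deriv i j f (?R z (dir \<xi>))"
        unfolding q_def h_def[symmetric] using h by simp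
      then show "norm (q m \<xi>) \<le> B * norm (w (norm \<xi>))"
        using B(2)[of "?R z (dir \<xi>)"] norm_dir_le[of \<xi>] ij
        by (simp add: abs_mult mult.commute[of B] mult_left_mono)
    qed
  qed measurable
  then show ?thesis by (simp add: q0 LIMSEQ_const_iff)
qed simp

lemma rot_deriv_mult:
  fixes f g :: "real^'n::finite \<Rightarrow> real"
  assumes "real_polynomial_function f" "real_polynomial_function g"
  shows "rot_deriv i j (\<lambda>x. f x * g x) = (\<lambda>x. f x * rot_deriv i j g x + rot_deriv i j f x * g x)"
  by (simp add: rot_deriv_def partial_mult[OF assms] fun_eq_iff algebra_simps)

lemma rot_deriv_sum:
  fixes f :: "'a \<Rightarrow> real^'n::finite \<Rightarrow> real"
  assumes "finite S" "\<And>s. s \<in> S \<Longrightarrow> real_polynomial_function (f s)"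
  shows "rot_deriv i j (\<lambda>x. \<Sum>s\<in>S. f s x) = (\<lambda>x. \<Sum>s\<in>S. rot_deriv i j (f s) x)"
  by (simp add: rot_deriv_def partial_sum[OF assms] fun_eq_iff sum_distrib_left sum_subtractf)

lemma sph_laplacian_sum:
  fixes f :: "'a \<Rightarrow> real^'n::finite \<Rightarrow> real"
  assumes S: "finite S" and f: "\<And>s. s \<in> S \<Longrightarrow> real_polynomial_function (f s)"
  shows "sph_laplacian (\<lambda>x. \<Sum>s\<in>S. f s x) = (\<lambda>x. \<Sum>s\<in>S. sph_laplacian (f s) x)"
proof
  fix x
  have r: "rot_deriv i j (rot_deriv i j (\<lambda>x. \<Sum>s\<in>S. f s x)) = (\<lambda>x. \<Sum>s\<in>S. rot_deriv i j (rot_deriv i j (f s)) x)" for i j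
    by (subst rot_deriv_sum, use S f in auto)+
  have "(\<Sum>i\<in>UNIV. \<Sum>j\<in>UNIV. \<Sum>s\<in>S. rot_deriv i j (rot_deriv i j (f s)) x)
    = (\<Sum>s\<in>S. \<Sum>i\<in>UNIV. \<Sum>j\<in>UNIV. rot_deriv i j (rot_deriv i j (f s)) x)"
    by (simp add: sum.swap[of _ S])
  then show "sph_laplacian (\<lambda>x. \<Sum>s\<in>S. f s x) x = (\<Sum>s\<in>S. sph_laplacian (f s) x)"
    by (simp add: sph_laplacian_def r flip: sum_divide_distrib)
qed

lemma sph_laplacian_symmetric:
  fixes f g :: "real^'n::finite \<Rightarrow> real"
  assumes w: "integrable lborel (\<lambda>\<xi>::real^'n. w (norm \<xi>) :: real)"
    and f: "real_polynomial_function f" and g: "real_polynomial_function g"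
  shows "(LINT \<xi>|lborel. w (norm \<xi>) * (sph_laplacian f (dir \<xi>) * g (dir \<xi>)))
    = (LINT \<xi>|lborel. w (norm \<xi>) * (f (dir \<xi>) * sph_laplacian g (dir \<xi>)))"
proof -
  define I where "I h = (LINT \<xi>|lborel. w (norm \<xi>) * h (dir \<xi>))" for h :: "real^'n \<Rightarrow> real"
  note int = integrable_radial_polynomial[OF w]
  have I_add: "I (\<lambda>x. h x + k x) = I h + I k" if "real_polynomial_function h" "real_polynomial_function k" for h k
    unfolding I_def using int[OF that(1)] int[OF that(2)] by (simp add: distrib_left)
  have I_cmult: "I (\<lambda>x. c * h x) = c * I h" for h c
    unfolding I_def by (simp add: mult.left_commute[of _ c])
  have I_sum: "I (\<lambda>x. \<Sum>s\<in>S. h s x) = (\<Sum>s\<in>S. I (h s))" if "\<And>s. real_polynomial_function (h s)" for h :: "'n \<Rightarrow> _" and S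
    unfolding I_def using int[OF that] by (simp add: sum_distrib_left)
  note pm = real_polynomial_function.intros(4)
  have parts: "I (\<lambda>x. rot_deriv i j (rot_deriv i j f) x * g x) = - I (\<lambda>x. rot_deriv i j f x * rot_deriv i j g x)"
    if f: "real_polynomial_function f" and g: "real_polynomial_function g" for f g i j
  proof -
    have "I (rot_deriv i j (\<lambda>x. rot_deriv i j f x * g x)) = 0"
      unfolding I_def using f g by (intro integral_rot_deriv_eq_0[OF w] pm) auto
    then show ?thesis
      unfolding rot_deriv_mult[OF polynomial_rot_deriv[OF f] g]
      by (subst (asm) I_add) (auto intro!: pm f g)
  qed
  have lap: "I (\<lambda>x. sph_laplacian f x * g x) = - (1/2) * (\<Sum>i\<in>UNIV. \<Sum>j\<in>UNIV. I (\<lambda>x. rot_deriv i j f x * rot_deriv i j g x))"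
    if f: "real_polynomial_function f" and g: "real_polynomial_function g" for f g
  proof -
    have "I (\<lambda>x. sph_laplacian f x * g x) = I (\<lambda>x. (1/2) * (\<Sum>i\<in>UNIV. \<Sum>j\<in>UNIV. rot_deriv i j (rot_deriv i j f) x * g x))"
      by (simp add: sph_laplacian_def sum_distrib_right)
    also have "\<dots> = (1/2) * (\<Sum>i\<in>UNIV. \<Sum>j\<in>UNIV. I (\<lambda>x. rot_deriv i j (rot_deriv i j f) x * g x))"
      unfolding I_cmult
      by (subst I_sum, rule real_polynomial_function_sum, simp, intro pm polynomial_rot_deriv f g, subst I_sum)
        (auto intro!: pm f g)
    finally show ?thesis by (simp add: parts[OF f g] sum_negf)
  qed
  have "I (\<lambda>x. sph_laplacian f x * g x) = I (\<lambda>x. sph_laplacian g x * f x)"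
    unfolding lap[OF f g] lap[OF g f] by (simp add: mult.commute)
  then show ?thesis by (simp add: I_def mult.commute)
qed

lemma spherical_harmonics_orthogonal:
  fixes Y Z :: "real^'n::finite \<Rightarrow> real"
  assumes w: "integrable lborel (\<lambda>\<xi>::real^'n. w (norm \<xi>) :: real)"
    and Y: "Y \<in> spherical_harmonics k" and Z: "Z \<in> spherical_harmonics l"
    and kl: "k \<noteq> l" and n: "CARD('n) \<ge> 2"
  shows "(LINT \<xi>|lborel. w (norm \<xi>) * (Y (dir \<xi>) * Z (dir \<xi>))) = 0"
proof -
  have pY: "real_polynomial_function Y" and pZ: "real_polynomial_function Z"
    using Y Z by (auto simp: spherical_harmonics_def)
  have e: "w (norm \<xi>) * (- c * Y (dir \<xi>) * Z (dir \<xi>)) = - c * (w (norm \<xi>) * (Y (dir \<xi>) * Z (dir \<xi>)))"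
    "w (norm \<xi>) * (Y (dir \<xi>) * (- c * Z (dir \<xi>))) = - c * (w (norm \<xi>) * (Y (dir \<xi>) * Z (dir \<xi>)))" for c \<xi>
    by simp_all
  from sph_laplacian_symmetric[OF w pY pZ]
  have "(real k * (real k + real CARD('n) - 2)) * (LINT \<xi>|lborel. w (norm \<xi>) * (Y (dir \<xi>) * Z (dir \<xi>)))
     = (real l * (real l + real CARD('n) - 2)) * (LINT \<xi>|lborel. w (norm \<xi>) * (Y (dir \<xi>) * Z (dir \<xi>)))"
    unfolding spherical_harmonics_eigenvalue[OF Y] spherical_harmonics_eigenvalue[OF Z] e by simp
  moreover have "(real k - real l) * (real k + real l + (real CARD('n) - 2)) \<noteq> 0"
    using kl n by auto
  then have "real k * (real k + real CARD('n) - 2) \<noteq> real l * (real l + real CARD('n) - 2)"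
    by (simp add: algebra_simps)
  ultimately show ?thesis by simp
qed

text \<open>Parseval's identity for a finite expansion, with an arbitrary radial weight.\<close>

lemma harmonic_sum_inner:
  fixes H :: "nat \<Rightarrow> real^'n::finite \<Rightarrow> real"
  assumes w: "integrable lborel (\<lambda>\<xi>::real^'n. w (norm \<xi>) :: real)"
    and H: "\<And>k. H k \<in> spherical_harmonics k" and n: "CARD('n) \<ge> 2"
  shows "(LINT \<xi>|lborel. w (norm \<xi>) * ((\<Sum>k\<le>M. b k * H k (dir \<xi>)) * (\<Sum>k\<le>M. c k * H k (dir \<xi>))))
    = (\<Sum>k\<le>M. b k * c k * (LINT \<xi>|lborel. w (norm \<xi>) * (H k (dir \<xi>))\<^sup>2))"
proof -
  have p: "real_polynomial_function (\<lambda>x. H k x * H l x)" for k l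
    using H[of k] H[of l] by (auto simp: spherical_harmonics_def)
  have "(LINT \<xi>|lborel. w (norm \<xi>) * ((\<Sum>k\<le>M. b k * H k (dir \<xi>)) * (\<Sum>k\<le>M. c k * H k (dir \<xi>))))
    = (LINT \<xi>|lborel. (\<Sum>k\<le>M. \<Sum>l\<le>M. (b k * c l) * (w (norm \<xi>) * (H k (dir \<xi>) * H l (dir \<xi>)))))"
    unfolding sum_product unfolding sum_distrib_left
    by (intro Bochner_Integration.integral_cong sum.cong refl) (simp add: mult_ac)
  also have "\<dots> = (\<Sum>k\<le>M. \<Sum>l\<le>M. (b k * c l) * (LINT \<xi>|lborel. w (norm \<xi>) * (H k (dir \<xi>) * H l (dir \<xi>))))"
    using integrable_radial_polynomial[OF w p] by simp
  also have "\<dots> = (\<Sum>k\<le>M. \<Sum>l\<le>M. if k = l then b k * c k * (LINT \<xi>|lborel. w (norm \<xi>) * (H k (dir \<xi>))\<^sup>2) else 0)"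
    by (intro sum.cong refl) (simp add: spherical_harmonics_orthogonal[OF w H H _ n] power2_eq_square)
  finally show ?thesis by (simp add: sum.delta)
qed

section \<open>Fourier integrals\<close>

lemma cis_measurable [measurable]: "cis \<in> borel_measurable borel"
  by (intro borel_measurable_continuous_onI continuous_intros)

lemma lborel_prod_coords:
  fixes f :: "'n::finite \<Rightarrow> real \<Rightarrow> 'b::{real_normed_field,banach,second_countable_topology}"
  assumes f: "\<And>i. integrable lborel (f i)"
  shows integrable_lborel_prod_coords: "integrable lborel (\<lambda>x::real^'n. \<Prod>i\<in>UNIV. f i (x $ i))"
    and integral_lborel_prod_coords: "(LINT x|(lborel :: (real^'n) measure). (\<Prod>i\<in>UNIV. f i (x $ i))) = (\<Prod>i\<in>UNIV. (LINT y|lborel. f i y))"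
proof -
  interpret product_sigma_finite "\<lambda>_::real^'n. lborel :: real measure" by standard
  define ix where "ix = (\<lambda>b::real^'n. SOME i. b = axis i 1)"
  have ix [simp]: "ix (axis i 1) = i" for i by (simp add: ix_def axis_eq_axis)
  have B: "(Basis :: (real^'n) set) = (\<lambda>i. axis i 1) ` UNIV" by (auto simp: Basis_vec_def)
  have inj: "inj (\<lambda>i::'n. axis i (1::real))" by (auto simp: inj_def axis_eq_axis)
  let ?T = "\<lambda>u::real^'n \<Rightarrow> real. \<Sum>b\<in>Basis. u b *\<^sub>R b"
  have T: "?T u $ i = u (axis i 1)" for u i
    unfolding cart_eq_inner_axis by (rule inner_sum_left_Basis) (simp add: axis_in_Basis_iff)
  have e: "(\<Prod>i\<in>UNIV. f i (?T u $ i)) = (\<Prod>b\<in>Basis. f (ix b) (u b))" for u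
    unfolding T unfolding B by (subst prod.reindex[OF inj]) simp
  have fm [measurable]: "f i \<in> borel_measurable borel" for i
    using borel_measurable_integrable[OF f[of i]] by simp
  have m: "(\<lambda>x::real^'n. \<Prod>i\<in>UNIV. f i (x $ i)) \<in> borel_measurable borel" by measurable
  have T_m: "?T \<in> (\<Pi>\<^sub>M b\<in>Basis. lborel) \<rightarrow>\<^sub>M borel" by measurable
  show "integrable lborel (\<lambda>x::real^'n. \<Prod>i\<in>UNIV. f i (x $ i))"
    by (subst lborel_eq, subst integrable_distr_eq[OF T_m m], subst e)
      (intro product_integrable_prod f, simp)
  have "(LINT x|(lborel :: (real^'n) measure). (\<Prod>i\<in>UNIV. f i (x $ i))) = (\<Prod>b\<in>(Basis::(real^'n) set). (LINT y|lborel. f (ix b) y))"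
    by (subst lborel_eq, subst integral_distr[OF T_m m], subst e)
      (intro product_integral_prod f, simp)
  also have "\<dots> = (\<Prod>i\<in>UNIV. (LINT y|lborel. f i y))"
    unfolding B by (subst prod.reindex[OF inj]) simp
  finally show "(LINT x|(lborel :: (real^'n) measure). (\<Prod>i\<in>UNIV. f i (x $ i))) = (\<Prod>i\<in>UNIV. (LINT y|lborel. f i y))" .
qed

text \<open>Frequency scale \<open>c\<close>, hence width \<open>1 / c\<close>; the Fourier transform of \<open>gauss c\<close> is a multiple
  of \<open>gauss (1 / c)\<close>.\<close>

definition gauss :: "real \<Rightarrow> 'a::real_normed_vector \<Rightarrow> real" where
  "gauss c x = exp (- (c\<^sup>2 * (norm x)\<^sup>2) / 2)"

lemma gauss_nonneg [simp]: "gauss c x \<ge> 0" and gauss_le_1 [simp]: "gauss c x \<le> 1"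
  by (simp_all add: gauss_def)

lemma gauss_minus [simp]: "gauss c (- x) = gauss c x"
  by (simp add: gauss_def)

lemma gauss_measurable [measurable]: "gauss c \<in> borel_measurable borel"
  unfolding gauss_def[abs_def] by measurable

lemma gauss_real:
  assumes c: "c > 0"
  shows integrable_gauss_real: "integrable lborel (\<lambda>x. cis (x * t) * complex_of_real (gauss c x))"
    and integral_gauss_real: "(LINT x|lborel. cis (x * t) * complex_of_real (gauss c x)) = complex_of_real (sqrt (2 * pi) / c * gauss (1 / c) t)"
proof -
  have g1: "gauss 1 x = sqrt (2 * pi) * std_normal_density x" for x :: real
    by (simp add: gauss_def std_normal_density_def)
  interpret N: real_distribution std_normal_distribution by (rule real_dist_normal_dist)
  have i1: "integrable lborel (\<lambda>x. cis (x * t) * complex_of_real (gauss 1 x))" for t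
  proof -
    have "integrable std_normal_distribution (\<lambda>x. iexp (t * x))" by (rule N.integrable_const_bound[of _ 1]) auto
    then have "integrable lborel (\<lambda>x. std_normal_density x *\<^sub>R iexp (t * x))"
      by (subst (asm) integrable_density) auto
    then have "integrable lborel (\<lambda>x. complex_of_real (sqrt (2 * pi)) * (std_normal_density x *\<^sub>R iexp (t * x)))"
      by (rule integrable_mult_right)
    then show ?thesis
      by (simp add: g1 cis_conv_exp scaleR_conv_of_real mult_ac)
  qed
  have v1: "(LINT x|lborel. cis (x * t) * complex_of_real (gauss 1 x)) = complex_of_real (sqrt (2 * pi) * gauss 1 t)" for t
  proof -
    have "complex_of_real (exp (- (t^2) / 2)) = (LINT x|std_normal_distribution. iexp (t * x))"
      using fun_cong[OF char_std_normal_distribution, of t] by (simp add: char_def)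
    also have "\<dots> = (LINT x|lborel. std_normal_density x *\<^sub>R iexp (t * x))"
      by (subst integral_density) auto
    finally have a: "(LINT x|lborel. std_normal_density x *\<^sub>R iexp (t * x)) = complex_of_real (exp (- (t^2) / 2))" ..
    have "(LINT x|lborel. cis (x * t) * complex_of_real (gauss 1 x))
      = (LINT x|lborel. complex_of_real (sqrt (2 * pi)) * (std_normal_density x *\<^sub>R iexp (t * x)))"
      by (intro Bochner_Integration.integral_cong refl) (simp add: g1 cis_conv_exp scaleR_conv_of_real mult_ac)
    also have "\<dots> = complex_of_real (sqrt (2 * pi)) * complex_of_real (exp (- (t^2) / 2))"
      unfolding a[symmetric] by (rule integral_mult_right_zero)
    finally show ?thesis by (simp add: gauss_def)
  qed
  have s: "cis (x * t) * complex_of_real (gauss c x) = cis ((0 + c * x) * (t / c)) * complex_of_real (gauss 1 (0 + c * x))" for x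
    using c by (simp add: gauss_def power_mult_distrib)
  show "integrable lborel (\<lambda>x. cis (x * t) * complex_of_real (gauss c x))"
    unfolding s using lborel_integrable_real_affine[OF i1[of "t / c"], of c 0] c by simp
  have "complex_of_real (sqrt (2 * pi) * gauss 1 (t / c)) = \<bar>c\<bar> *\<^sub>R (LINT x|lborel. cis (x * t) * complex_of_real (gauss c x))"
    unfolding s v1[symmetric] using c by (intro lborel_integral_real_affine) simp
  then have "complex_of_real c * (LINT x|lborel. cis (x * t) * complex_of_real (gauss c x)) = complex_of_real (sqrt (2 * pi) * gauss (1 / c) t)"
    using c by (simp add: scaleR_conv_of_real gauss_def power_divide)
  then show "(LINT x|lborel. cis (x * t) * complex_of_real (gauss c x)) = complex_of_real (sqrt (2 * pi) / c * gauss (1 / c) t)"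
    using c by (simp add: field_simps)
qed

lemma cis_sum: "finite S \<Longrightarrow> cis (\<Sum>i\<in>S. f i) = (\<Prod>i\<in>S. cis (f i))"
  by (induction S rule: finite_induct) (simp_all flip: cis_mult)

lemma gauss_prod: "gauss c (x::real^'n::finite) = (\<Prod>i\<in>UNIV. gauss c (x $ i))"
proof -
  have "(norm x)\<^sup>2 = (\<Sum>i\<in>UNIV. (norm (x $ i))\<^sup>2)"
    unfolding power2_norm_eq_inner by (simp add: inner_vec_def)
  then show ?thesis
    by (simp add: gauss_def exp_sum sum_distrib_left sum_negf sum_divide_distrib flip: exp_sum)
qed

lemma fourier_gauss:
  fixes t :: "real^'n::finite"
  assumes c: "c > 0"
  shows integrable_cis_gauss: "integrable lborel (\<lambda>x. cis (x \<bullet> t) * complex_of_real (gauss c x))"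
    and integral_cis_gauss: "(LINT x|lborel. cis (x \<bullet> t) * complex_of_real (gauss c x))
      = complex_of_real ((sqrt (2 * pi) / c) ^ CARD('n) * gauss (1 / c) t)"
proof -
  have e: "(\<lambda>x. cis (x \<bullet> t) * complex_of_real (gauss c x)) = (\<lambda>x::real^'n. \<Prod>i\<in>UNIV. cis (x $ i * t $ i) * complex_of_real (gauss c (x $ i)))"
    by (simp add: inner_vec_def cis_sum gauss_prod[of c "_::real^'n"] prod.distrib)
  show "integrable lborel (\<lambda>x. cis (x \<bullet> t) * complex_of_real (gauss c x))"
    unfolding e by (intro integrable_lborel_prod_coords integrable_gauss_real c)
  show "(LINT x|lborel. cis (x \<bullet> t) * complex_of_real (gauss c x))
      = complex_of_real ((sqrt (2 * pi) / c) ^ CARD('n) * gauss (1 / c) t)"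
    unfolding e
    by (subst integral_lborel_prod_coords[OF integrable_gauss_real[OF c]])
      (simp add: integral_gauss_real[OF c] gauss_prod[of _ t] prod_dividef prod.distrib power_divide)
qed

lemma integrable_gauss:
  assumes c: "c > 0" shows "integrable lborel (gauss c :: real^'n::finite \<Rightarrow> real)"
  using integrable_norm[OF integrable_cis_gauss[OF c, of 0]] by (simp add: norm_mult)

lemma integral_gauss:
  assumes c: "c > 0" shows "(LINT x|(lborel :: (real^'n::finite) measure). gauss c x) = (sqrt (2 * pi) / c) ^ CARD('n)"
proof -
  have "complex_of_real (LINT x|(lborel :: (real^'n) measure). gauss c x) = complex_of_real ((sqrt (2 * pi) / c) ^ CARD('n))"
    using integral_cis_gauss[OF c, of "0::real^'n"] by (simp add: gauss_def[of _ 0])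
  then show ?thesis by (simp only: of_real_eq_iff)
qed

lemma lborel_translate:
  fixes f :: "'a::euclidean_space \<Rightarrow> 'b::{banach,second_countable_topology}"
  assumes f: "integrable lborel f"
  shows integrable_lborel_translate: "integrable lborel (\<lambda>x. f (c + x))"
    and integral_lborel_translate: "(LINT x|lborel. f (c + x)) = (LINT x|lborel. f x)"
proof -
  have m: "f \<in> borel_measurable borel" using borel_measurable_integrable[OF f] by simp
  have "integrable (distr lborel borel ((+) c)) f" using f by (simp add: lborel_distr_plus)
  then show "integrable lborel (\<lambda>x. f (c + x))"
    by (subst (asm) integrable_distr_eq) (auto simp: m)
  have "(LINT x|lborel. f x) = (LINT x|distr lborel borel ((+) c). f x)"
    by (simp add: lborel_distr_plus)
  also have "\<dots> = (LINT x|lborel. f (c + x))"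
    by (rule integral_distr) (auto simp: m)
  finally show "(LINT x|lborel. f (c + x)) = (LINT x|lborel. f x)" ..
qed

lemma lborel_distr_uminus_euclidean:
  "distr lborel borel uminus = (lborel :: 'a::euclidean_space measure)"
  by (subst (2) lborel_affine[of "-1" 0]) (auto simp: density_1)

text \<open>The unnormalized Fourier integral with positive sign in the exponent.\<close>

definition fourier :: "(real^'n::finite \<Rightarrow> complex) \<Rightarrow> real^'n \<Rightarrow> complex" where
  "fourier G x = (LINT \<xi>|lborel. cis (x \<bullet> \<xi>) * G \<xi>)"

lemma inv_fourier_eq_fourier:
  "inv_fourier \<psi> (\<xi>::real^'n::finite) = complex_of_real (1 / (2 * pi) ^ CARD('n)) * fourier \<psi> \<xi>"
  by (simp add: inv_fourier_def fourier_def inner_commute)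

lemma borel_measurable_fourier [measurable (raw)]:
  assumes "integrable lborel G"
  shows "fourier G \<in> borel_measurable borel"
proof -
  note [measurable] = borel_measurable_integrable[OF assms]
  show ?thesis unfolding fourier_def[abs_def] by measurable
qed

lemma integrable_fourier_integrand:
  assumes "integrable lborel G"
  shows "integrable lborel (\<lambda>\<xi>. cis (x \<bullet> \<xi>) * G \<xi>)"
proof -
  note [measurable] = borel_measurable_integrable[OF assms]
  show ?thesis
    by (rule Bochner_Integration.integrable_bound[OF assms]) (auto simp: norm_mult)
qed

lemma norm_fourier_le:
  assumes "integrable lborel G"
  shows "norm (fourier G x) \<le> (LINT \<xi>|lborel. norm (G \<xi>))"
  unfolding fourier_def
  by (rule order_trans[OF integral_norm_bound]) (simp add: norm_mult)

lemma integrable_fourier_mult: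
  assumes G: "integrable lborel G" and \<psi>: "integrable lborel \<psi>"
  shows "integrable lborel (\<lambda>x. fourier G x * \<psi> x)"
proof (rule Bochner_Integration.integrable_bound)
  note [measurable] = borel_measurable_fourier[OF G]
  note [measurable] = borel_measurable_integrable[OF \<psi>]
  show "integrable lborel (\<lambda>x. complex_of_real (LINT \<xi>|lborel. norm (G \<xi>)) * \<psi> x)"
    using \<psi> by simp
  show "(\<lambda>x. fourier G x * \<psi> x) \<in> borel_measurable lborel" by measurable
  show "AE x in lborel. norm (fourier G x * \<psi> x) \<le> norm (complex_of_real (LINT \<xi>|lborel. norm (G \<xi>)) * \<psi> x)"
  proof (rule AE_I2)
    fix x
    have "norm (fourier G x) \<le> \<bar>LINT \<xi>|lborel. norm (G \<xi>)\<bar>"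
      using norm_fourier_le[OF G, of x] by linarith
    then show "norm (fourier G x * \<psi> x) \<le> norm (complex_of_real (LINT \<xi>|lborel. norm (G \<xi>)) * \<psi> x)"
      by (simp add: norm_mult mult_right_mono)
  qed
qed

text \<open>Fubini's theorem. With a Schwartz function \<open>\<psi>\<close> it identifies the distribution whose
  Fourier transform is \<open>G\<close>; with Gaussians it drives the \<open>L\<^sup>2\<close> bound.\<close>

lemma fourier_duality:
  fixes G \<psi> :: "real^'n::finite \<Rightarrow> complex"
  assumes G: "integrable lborel G" and \<psi>: "integrable lborel \<psi>"
  shows "(LINT x|lborel. fourier G x * \<psi> x) = (LINT \<xi>|lborel. G \<xi> * fourier \<psi> \<xi>)"
proof -
  note [measurable] = borel_measurable_integrable[OF G] borel_measurable_integrable[OF \<psi>]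
  have I: "integrable (lborel \<Otimes>\<^sub>M lborel) (\<lambda>(x, \<xi>). cis (x \<bullet> \<xi>) * G \<xi> * \<psi> x)"
  proof (rule lborel_pair.Fubini_integrable)
    show "(\<lambda>(x, \<xi>). cis (x \<bullet> \<xi>) * G \<xi> * \<psi> x) \<in> borel_measurable (lborel \<Otimes>\<^sub>M lborel)"
      by measurable
    show "integrable lborel (\<lambda>x. LINT \<xi>|lborel. norm (case (x, \<xi>) of (x, \<xi>) \<Rightarrow> cis (x \<bullet> \<xi>) * G \<xi> * \<psi> x))"
      using integrable_norm[OF \<psi>] by (simp add: norm_mult)
    show "AE x in lborel. integrable lborel (\<lambda>\<xi>. case (x, \<xi>) of (x, \<xi>) \<Rightarrow> cis (x \<bullet> \<xi>) * G \<xi> * \<psi> x)"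
      using integrable_fourier_integrand[OF G] by simp
  qed
  have "(LINT x|lborel. fourier G x * \<psi> x) = (LINT x|lborel. (LINT \<xi>|lborel. cis (x \<bullet> \<xi>) * G \<xi> * \<psi> x))"
    by (simp add: fourier_def)
  also have "\<dots> = (LINT \<xi>|lborel. (LINT x|lborel. cis (x \<bullet> \<xi>) * G \<xi> * \<psi> x))"
    by (rule lborel_pair.Fubini_integral[OF I, symmetric])
  also have "\<dots> = (LINT \<xi>|lborel. G \<xi> * fourier \<psi> \<xi>)"
  proof (rule Bochner_Integration.integral_cong[OF refl])
    fix \<xi>
    have "(\<lambda>x. cis (x \<bullet> \<xi>) * G \<xi> * \<psi> x) = (\<lambda>x. G \<xi> * (cis (\<xi> \<bullet> x) * \<psi> x))"
      by (simp add: fun_eq_iff inner_commute)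
    then show "(LINT x|lborel. cis (x \<bullet> \<xi>) * G \<xi> * \<psi> x) = G \<xi> * fourier \<psi> \<xi>"
      by (simp only: integral_mult_right_zero fourier_def)
  qed
  finally show ?thesis .
qed

lemma nn_integral_gauss_kernel:
  fixes \<xi> :: "real^'n::finite"
  assumes c: "c > 0"
  shows "(\<integral>\<^sup>+\<eta>. ennreal ((sqrt (2 * pi) / c) ^ CARD('n) * gauss (1 / c) (\<xi> - \<eta>)) \<partial>lborel) = ennreal ((2 * pi) ^ CARD('n))"
proof -
  define K where "K = (\<lambda>\<zeta>::real^'n. (sqrt (2 * pi) / c) ^ CARD('n) * gauss (1 / c) \<zeta>)"
  have K: "integrable lborel K"
    unfolding K_def using integrable_gauss[of "1 / c"] c by auto
  have "(LINT \<zeta>|lborel. K \<zeta>) = (sqrt (2 * pi) / c) ^ CARD('n) * (sqrt (2 * pi) / (1 / c)) ^ CARD('n)"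
    unfolding K_def by (subst integral_mult_right_zero, subst integral_gauss) (use c in auto)
  also have "\<dots> = (sqrt (2 * pi) * sqrt (2 * pi)) ^ CARD('n)"
    unfolding power_mult_distrib[symmetric] using c by simp
  finally have v: "(LINT \<zeta>|lborel. K \<zeta>) = (2 * pi) ^ CARD('n)" by simp
  have e: "K (\<xi> - \<eta>) = K (- \<xi> + \<eta>)" for \<eta>
    unfolding K_def using gauss_minus[of "1 / c" "\<xi> - \<eta>"] by simp
  have "(\<integral>\<^sup>+\<eta>. ennreal (K (\<xi> - \<eta>)) \<partial>lborel) = ennreal (LINT \<eta>|lborel. K (- \<xi> + \<eta>))"
    unfolding e by (rule nn_integral_eq_integral[OF integrable_lborel_translate[OF K]]) (use c in \<open>auto simp: K_def\<close>)
  then show ?thesis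
    unfolding integral_lborel_translate[OF K] v by (simp add: K_def)
qed

lemma lborel_reflect:
  fixes f :: "'a::euclidean_space \<Rightarrow> 'b::{banach,second_countable_topology}"
  assumes f: "integrable lborel f"
  shows integrable_lborel_reflect: "integrable lborel (\<lambda>x. f (- x))"
    and integral_lborel_reflect: "(LINT x|lborel. f (- x)) = (LINT x|lborel. f x)"
proof -
  have m: "f \<in> borel_measurable borel" using borel_measurable_integrable[OF f] by simp
  have "integrable (distr lborel borel uminus) f" using f by (simp add: lborel_distr_uminus_euclidean)
  then show "integrable lborel (\<lambda>x. f (- x))"
    by (subst (asm) integrable_distr_eq) (auto simp: m)
  have "(LINT x|lborel. f x) = (LINT x|distr lborel borel uminus. f x)"
    by (simp add: lborel_distr_uminus_euclidean)
  also have "\<dots> = (LINT x|lborel. f (- x))"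
    by (rule integral_distr) (auto simp: m)
  finally show "(LINT x|lborel. f (- x)) = (LINT x|lborel. f x)" ..
qed

lemma nn_integral_lborel_reflect:
  fixes f :: "'a::euclidean_space \<Rightarrow> ennreal"
  assumes [measurable]: "f \<in> borel_measurable borel"
  shows "(\<integral>\<^sup>+x. f (- x) \<partial>lborel) = (\<integral>\<^sup>+x. f x \<partial>lborel)"
proof -
  have "(\<integral>\<^sup>+x. f x \<partial>lborel) = (\<integral>\<^sup>+x. f x \<partial>distr lborel borel uminus)"
    by (simp add: lborel_distr_uminus_euclidean)
  also have "\<dots> = (\<integral>\<^sup>+x. f (- x) \<partial>lborel)"
    by (rule nn_integral_distr) auto
  finally show ?thesis ..
qed

text \<open>With the Gaussian weight the left-hand side is a double integral of
  \<open>G \<xi> * cnj (G \<eta>)\<close> against the Fourier transform of the weight at \<open>\<xi> - \<eta>\<close>. This is a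
  positive kernel of total mass \<open>(2 * pi) ^ n\<close> in either variable, so Schur's test gives the bound
  independently of the width of the weight.\<close>

lemma fourier_gauss_weighted:
  fixes G :: "real^'n::finite \<Rightarrow> complex"
  assumes G: "integrable lborel G" and c: "c > 0"
  shows "(\<integral>\<^sup>+x. ennreal ((norm (fourier G x))\<^sup>2 * gauss c x) \<partial>lborel)
    \<le> ennreal ((2 * pi) ^ CARD('n)) * (\<integral>\<^sup>+\<xi>. ennreal ((norm (G \<xi>))\<^sup>2) \<partial>lborel)"
proof -
  note Gm [measurable] = borel_measurable_integrable[OF G]
  define N where "N = CARD('n)"
  define K where "K = (\<lambda>\<zeta>::real^'n. (sqrt (2 * pi) / c) ^ N * gauss (1 / c) \<zeta>)"
  have K0: "K \<zeta> \<ge> 0" for \<zeta> using c by (simp add: K_def)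
  let ?P = "\<lambda>\<xi> \<eta>. ennreal ((norm (G \<xi>))\<^sup>2 / 2) * ennreal (K (\<xi> - \<eta>))"
  let ?Q = "\<lambda>\<xi> \<eta>. ennreal ((norm (G \<eta>))\<^sup>2 / 2) * ennreal (K (\<xi> - \<eta>))"
  have [measurable]: "K \<in> borel_measurable borel" unfolding K_def by measurable
  have Kint: "(\<integral>\<^sup>+\<eta>. ennreal (K (\<xi> - \<eta>)) \<partial>lborel) = ennreal ((2 * pi) ^ N)" for \<xi>
    unfolding K_def N_def by (rule nn_integral_gauss_kernel[OF c])
  have Ksym: "K (\<xi> - \<eta>) = K (\<eta> - \<xi>)" for \<xi> \<eta>
    unfolding K_def using gauss_minus[of "1 / c" "\<xi> - \<eta>"] by simp
  \<comment> \<open>Reflection and conjugation express the conjugate of the transform as a transform again.\<close>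
  define G' where "G' \<eta> = cnj (G (- \<eta>))" for \<eta>
  have G': "integrable lborel G'"
    unfolding G'_def using integrable_lborel_reflect[OF G] by simp
  have ftG': "cnj (fourier G x) = fourier G' x" for x
  proof -
    have "fourier G' x = (LINT \<eta>|lborel. cnj (cis (x \<bullet> (- \<eta>)) * G (- \<eta>)))"
      unfolding fourier_def G'_def by (intro Bochner_Integration.integral_cong refl) (simp add: cis_cnj)
    also have "\<dots> = cnj (LINT \<eta>|lborel. cis (x \<bullet> (- \<eta>)) * G (- \<eta>))"
      by (rule Bochner_Integration.integral_cnj)
    also have "(LINT \<eta>|lborel. cis (x \<bullet> (- \<eta>)) * G (- \<eta>)) = (LINT \<eta>|lborel. cis (x \<bullet> \<eta>) * G \<eta>)"
      by (rule integral_lborel_reflect[OF integrable_fourier_integrand[OF G, of x]])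
    finally show ?thesis by (simp add: fourier_def)
  qed
  define \<psi> where "\<psi> = (\<lambda>x. fourier G' x * complex_of_real (gauss c x))"
  have g: "integrable lborel (\<lambda>x::real^'n. complex_of_real (gauss c x))"
    using integrable_gauss[OF c, where 'n='n] by (simp add: complex_of_real_integrable_eq)
  have gt: "integrable lborel (\<lambda>x. cis (\<xi> \<bullet> x) * complex_of_real (gauss c x))" for \<xi> :: "real^'n"
    using integrable_cis_gauss[OF c, of \<xi>] by (simp add: inner_commute)
  have \<psi>: "integrable lborel \<psi>" unfolding \<psi>_def by (rule integrable_fourier_mult[OF G' g])
  have fourier\<psi>: "fourier \<psi> \<xi> = (LINT \<eta>|lborel. G' \<eta> * complex_of_real (K (\<xi> + \<eta>)))" for \<xi>
  proof -
    have "fourier \<psi> \<xi> = (LINT x|lborel. fourier G' x * (cis (\<xi> \<bullet> x) * complex_of_real (gauss c x)))"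
      unfolding fourier_def[of \<psi>] unfolding \<psi>_def by (simp add: mult_ac)
    also have "\<dots> = (LINT \<eta>|lborel. G' \<eta> * fourier (\<lambda>x. cis (\<xi> \<bullet> x) * complex_of_real (gauss c x)) \<eta>)"
      by (rule fourier_duality[OF G' gt])
    finally have 1: "fourier \<psi> \<xi> = (LINT \<eta>|lborel. G' \<eta> * fourier (\<lambda>x. cis (\<xi> \<bullet> x) * complex_of_real (gauss c x)) \<eta>)" .
    have "fourier (\<lambda>x. cis (\<xi> \<bullet> x) * complex_of_real (gauss c x)) \<eta> = complex_of_real (K (\<xi> + \<eta>))" for \<eta>
    proof -
      have "fourier (\<lambda>x. cis (\<xi> \<bullet> x) * complex_of_real (gauss c x)) \<eta> = (LINT x|lborel. cis (x \<bullet> (\<xi> + \<eta>)) * complex_of_real (gauss c x))"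
        unfolding fourier_def
        by (intro Bochner_Integration.integral_cong refl)
          (simp add: inner_commute inner_add_right cis_mult[symmetric] mult.assoc add.commute)
      then show ?thesis unfolding integral_cis_gauss[OF c] by (simp add: K_def N_def)
    qed
    then show ?thesis unfolding 1 by simp
  qed
  have fourier\<psi>_le: "ennreal (norm (fourier \<psi> \<xi>)) \<le> (\<integral>\<^sup>+\<eta>. ennreal (norm (G \<eta>) * K (\<xi> - \<eta>)) \<partial>lborel)" for \<xi>
  proof (cases "integrable lborel (\<lambda>\<eta>. G' \<eta> * complex_of_real (K (\<xi> + \<eta>)))")
    case True
    have "ennreal (norm (fourier \<psi> \<xi>)) \<le> (\<integral>\<^sup>+\<eta>. ennreal (norm (G' \<eta> * complex_of_real (K (\<xi> + \<eta>)))) \<partial>lborel)"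
      unfolding fourier\<psi> by (rule integral_norm_bound_ennreal[OF True])
    also have "\<dots> = (\<integral>\<^sup>+\<eta>. ennreal (norm (G (- \<eta>)) * K (\<xi> - (- \<eta>))) \<partial>lborel)"
      using K0 by (simp add: norm_mult G'_def)
    also have "\<dots> = (\<integral>\<^sup>+\<eta>. ennreal (norm (G \<eta>) * K (\<xi> - \<eta>)) \<partial>lborel)"
      by (rule nn_integral_lborel_reflect) (use Gm in measurable)
    finally show ?thesis .
  qed (simp add: fourier\<psi> not_integrable_integral_eq)
  have e: "complex_of_real ((norm (fourier G x))\<^sup>2 * gauss c x) = fourier G x * \<psi> x" for x
    unfolding \<psi>_def ftG'[symmetric] by (simp flip: complex_norm_square)
  have i0: "integrable lborel (\<lambda>x. fourier G x * \<psi> x)" by (rule integrable_fourier_mult[OF G \<psi>])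
  then have "integrable lborel (\<lambda>x. complex_of_real ((norm (fourier G x))\<^sup>2 * gauss c x))"
    by (simp only: e)
  then have i: "integrable lborel (\<lambda>x. (norm (fourier G x))\<^sup>2 * gauss c x)"
    by (simp only: complex_of_real_integrable_eq)
  have "(\<integral>\<^sup>+x. ennreal ((norm (fourier G x))\<^sup>2 * gauss c x) \<partial>lborel) = ennreal (LINT x|lborel. (norm (fourier G x))\<^sup>2 * gauss c x)"
    by (rule nn_integral_eq_integral[OF i]) simp
  also have "\<dots> = ennreal (norm (LINT x|lborel. fourier G x * \<psi> x))"
    unfolding e[symmetric] integral_complex_of_real by (simp add: integral_nonneg_AE)
  also have "\<dots> = ennreal (norm (LINT \<xi>|lborel. G \<xi> * fourier \<psi> \<xi>))"
    by (simp only: fourier_duality[OF G \<psi>])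
  also have "\<dots> \<le> (\<integral>\<^sup>+\<xi>. ennreal (norm (G \<xi> * fourier \<psi> \<xi>)) \<partial>lborel)"
    by (rule integral_norm_bound_ennreal) (use integrable_fourier_mult[OF \<psi> G] in \<open>simp add: mult.commute\<close>)
  also have "\<dots> \<le> (\<integral>\<^sup>+\<xi>. ennreal (norm (G \<xi>)) * (\<integral>\<^sup>+\<eta>. ennreal (norm (G \<eta>) * K (\<xi> - \<eta>)) \<partial>lborel) \<partial>lborel)"
    by (intro nn_integral_mono) (auto simp: norm_mult ennreal_mult intro!: mult_left_mono fourier\<psi>_le)
  also have "\<dots> = (\<integral>\<^sup>+\<xi>. (\<integral>\<^sup>+\<eta>. ennreal (norm (G \<xi>)) * ennreal (norm (G \<eta>) * K (\<xi> - \<eta>)) \<partial>lborel) \<partial>lborel)"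
    by (intro nn_integral_cong nn_integral_cmult[symmetric]) measurable
  also have "\<dots> \<le> (\<integral>\<^sup>+\<xi>. (\<integral>\<^sup>+\<eta>. ?P \<xi> \<eta> + ?Q \<xi> \<eta> \<partial>lborel) \<partial>lborel)"
  proof (intro nn_integral_mono)
    fix \<xi> \<eta>
    have "norm (G \<xi>) * norm (G \<eta>) \<le> (norm (G \<xi>))\<^sup>2 / 2 + (norm (G \<eta>))\<^sup>2 / 2"
      using sum_squares_bound[of "norm (G \<xi>)" "norm (G \<eta>)"] by simp
    then have "norm (G \<xi>) * norm (G \<eta>) * K (\<xi> - \<eta>) \<le> ((norm (G \<xi>))\<^sup>2 / 2 + (norm (G \<eta>))\<^sup>2 / 2) * K (\<xi> - \<eta>)"
      by (rule mult_right_mono[OF _ K0])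
    then show "ennreal (norm (G \<xi>)) * ennreal (norm (G \<eta>) * K (\<xi> - \<eta>)) \<le>
      ?P \<xi> \<eta> + ?Q \<xi> \<eta>"
      using K0 by (simp add: distrib_right mult.assoc flip: ennreal_mult ennreal_plus)
  qed
  also have "\<dots> = (\<integral>\<^sup>+\<xi>. (\<integral>\<^sup>+\<eta>. ?P \<xi> \<eta> \<partial>lborel) \<partial>lborel)
     + (\<integral>\<^sup>+\<xi>. (\<integral>\<^sup>+\<eta>. ?Q \<xi> \<eta> \<partial>lborel) \<partial>lborel)"
    by (subst nn_integral_add[symmetric]) (simp_all add: nn_integral_add)
  also have "(\<integral>\<^sup>+\<xi>. (\<integral>\<^sup>+\<eta>. ?Q \<xi> \<eta> \<partial>lborel) \<partial>lborel)
     = (\<integral>\<^sup>+\<eta>. (\<integral>\<^sup>+\<xi>. ?Q \<xi> \<eta> \<partial>lborel) \<partial>lborel)"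
    by (rule lborel_pair.Fubini') measurable
  also have "\<dots> = (\<integral>\<^sup>+\<xi>. (\<integral>\<^sup>+\<eta>. ?P \<xi> \<eta> \<partial>lborel) \<partial>lborel)"
    by (intro nn_integral_cong) (metis Ksym)
  also have "(\<integral>\<^sup>+\<xi>. (\<integral>\<^sup>+\<eta>. ?P \<xi> \<eta> \<partial>lborel) \<partial>lborel)
     = (\<integral>\<^sup>+\<xi>. ennreal ((norm (G \<xi>))\<^sup>2 / 2) * ennreal ((2 * pi) ^ N) \<partial>lborel)"
    by (intro nn_integral_cong) (simp add: nn_integral_cmult Kint)
  also have "\<dots> + \<dots> = (\<integral>\<^sup>+\<xi>. ennreal ((norm (G \<xi>))\<^sup>2 / 2) * ennreal ((2 * pi) ^ N) + ennreal ((norm (G \<xi>))\<^sup>2 / 2) * ennreal ((2 * pi) ^ N) \<partial>lborel)"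
    by (rule nn_integral_add[symmetric]) measurable
  also have "\<dots> = (\<integral>\<^sup>+\<xi>. ennreal ((2 * pi) ^ N) * ennreal ((norm (G \<xi>))\<^sup>2) \<partial>lborel)"
    by (intro nn_integral_cong) (simp flip: ennreal_mult ennreal_plus)
  also have "\<dots> = ennreal ((2 * pi) ^ N) * (\<integral>\<^sup>+\<xi>. ennreal ((norm (G \<xi>))\<^sup>2) \<partial>lborel)"
    by (rule nn_integral_cmult) measurable
  finally show ?thesis unfolding N_def .
qed

text \<open>Let the Gaussian weight tend to \<open>1\<close> and apply Fatou's lemma.\<close>

lemma fourier_bessel:
  fixes G :: "real^'n::finite \<Rightarrow> complex"
  assumes G: "integrable lborel G"
  shows "(\<integral>\<^sup>+x. ennreal ((norm (fourier G x))\<^sup>2) \<partial>lborel)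
    \<le> ennreal ((2 * pi) ^ CARD('n)) * (\<integral>\<^sup>+\<xi>. ennreal ((norm (G \<xi>))\<^sup>2) \<partial>lborel)"
proof -
  note [measurable] = borel_measurable_fourier[OF G]
  define c where "c m = inverse (real (Suc m))" for m
  have c: "c m > 0" for m by (simp add: c_def)
  have c0: "c \<longlonglongrightarrow> 0" unfolding c_def by (rule LIMSEQ_inverse_real_of_nat)
  have lim: "(\<lambda>m. ennreal ((norm (fourier G x))\<^sup>2 * gauss (c m) x)) \<longlonglongrightarrow> ennreal ((norm (fourier G x))\<^sup>2)" for x
  proof -
    have "(\<lambda>m. (norm (fourier G x))\<^sup>2 * gauss (c m) x) \<longlonglongrightarrow> (norm (fourier G x))\<^sup>2 * exp (- (0\<^sup>2 * (norm x)\<^sup>2) / 2)"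
      unfolding gauss_def by (intro tendsto_intros c0) simp
    then show ?thesis by (intro tendsto_ennrealI) simp
  qed
  have "(\<integral>\<^sup>+x. ennreal ((norm (fourier G x))\<^sup>2) \<partial>lborel) = (\<integral>\<^sup>+x. liminf (\<lambda>m. ennreal ((norm (fourier G x))\<^sup>2 * gauss (c m) x)) \<partial>lborel)"
    by (intro nn_integral_cong lim_imp_Liminf[symmetric] lim) simp
  also have "\<dots> \<le> liminf (\<lambda>m. \<integral>\<^sup>+x. ennreal ((norm (fourier G x))\<^sup>2 * gauss (c m) x) \<partial>lborel)"
    by (rule nn_integral_liminf) measurable
  also have "\<dots> \<le> ennreal ((2 * pi) ^ CARD('n)) * (\<integral>\<^sup>+\<xi>. ennreal ((norm (G \<xi>))\<^sup>2) \<partial>lborel)"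
    by (intro Liminf_le always_eventually allI fourier_gauss_weighted G c) simp
  finally show ?thesis .
qed

section \<open>Schwartz functions and wave packets\<close>

text \<open>A Schwartz function is dominated by a multiple of the product of the functions
  \<open>1 / (1 + (x $ i)\<^sup>2)\<close>, because that product is at least \<open>(1 + (norm x)\<^sup>2) powr - n\<close>.\<close>

lemma schwartz_integrable:
  fixes \<psi> :: "real^'n::finite \<Rightarrow> complex"
  assumes "\<psi> \<in> schwartz"
  shows "integrable lborel \<psi>"
proof -
  define N where "N = CARD('n)"
  have diff: "\<psi> differentiable (at x)" for x
    using assms by (auto simp: schwartz_def dest!: spec[of _ "[]"])
  have bd: "bounded (range (\<lambda>x. norm x ^ m *\<^sub>R \<psi> x))" for m :: nat
    using assms by (auto simp: schwartz_def dest!: spec[of _ "[]"])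
  have "continuous_on UNIV \<psi>"
    using diff by (simp add: continuous_on_eq_continuous_at differentiable_imp_continuous_within)
  then have [measurable]: "\<psi> \<in> borel_measurable borel" by (rule borel_measurable_continuous_onI)
  obtain B0 where B0: "\<And>x. norm (\<psi> x) \<le> B0"
    using bd[of 0] by (auto simp: bounded_iff)
  obtain B1 where B1: "\<And>x. norm (norm x ^ (2 * N) *\<^sub>R \<psi> x) \<le> B1"
    using bd[of "2 * N"] by (auto simp: bounded_iff)
  have "set_integrable lborel (einterval (-\<infinity>) \<infinity>) (\<lambda>x. inverse (1 + x^2))"
    by (rule integrable_inverse_1_plus_square)
  then have i1: "integrable lborel (\<lambda>x::real. inverse (1 + x^2))"
    by (simp add: set_integrable_def)
  have ip: "integrable lborel (\<lambda>x::real^'n. \<Prod>i\<in>UNIV. inverse (1 + (x $ i)^2))"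
    by (rule integrable_lborel_prod_coords[OF i1])
  have key: "norm (\<psi> x) \<le> 2 ^ N * (B0 + B1) * (\<Prod>i\<in>UNIV. inverse (1 + (x $ i)^2))" for x
  proof -
    define t where "t = (norm x)\<^sup>2"
    have t0: "t \<ge> 0" by (simp add: t_def)
    have tN: "t ^ N = norm x ^ (2 * N)" by (simp only: t_def power_mult)
    have "(x $ i)^2 \<le> t" for i
      using component_le_norm_cart[of x i] unfolding t_def by (metis abs_ge_zero power2_abs power_mono)
    then have "(\<Prod>i\<in>UNIV. 1 + (x $ i)^2) \<le> (\<Prod>i\<in>(UNIV::'n set). 1 + t)"
      by (intro prod_mono) auto
    then have "(\<Prod>i\<in>UNIV. 1 + (x $ i)^2) \<le> (1 + t) ^ N" by (simp add: N_def)
    also have "\<dots> \<le> 2 ^ N * (1 + t ^ N)"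
    proof (cases "t \<le> 1")
      case True
      then have "(1 + t) ^ N \<le> 2 ^ N" using t0 by (intro power_mono) auto
      also have "\<dots> \<le> 2 ^ N * (1 + t ^ N)" using t0 by simp
      finally show ?thesis .
    next
      case False
      then have "(1 + t) ^ N \<le> (2 * t) ^ N" using t0 by (intro power_mono) auto
      also have "\<dots> \<le> 2 ^ N * (1 + t ^ N)" by (simp add: power_mult_distrib)
      finally show ?thesis .
    qed
    finally have "(\<Prod>i\<in>UNIV. 1 + (x $ i)^2) * norm (\<psi> x) \<le> 2 ^ N * (1 + t ^ N) * norm (\<psi> x)"
      by (rule mult_right_mono) simp
    also have "\<dots> = 2 ^ N * (norm (\<psi> x) + norm (norm x ^ (2 * N) *\<^sub>R \<psi> x))"
      by (simp add: tN algebra_simps)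
    also have "\<dots> \<le> 2 ^ N * (B0 + B1)"
      using B0[of x] B1[of x] by (intro mult_left_mono add_mono) auto
    finally have "(\<Prod>i\<in>UNIV. 1 + (x $ i)^2) * norm (\<psi> x) \<le> 2 ^ N * (B0 + B1)" .
    moreover have "(\<Prod>i\<in>UNIV. 1 + (x $ i)^2) > 0"
      by (intro prod_pos) (simp add: add_pos_nonneg)
    ultimately have "norm (\<psi> x) \<le> 2 ^ N * (B0 + B1) / (\<Prod>i\<in>UNIV. 1 + (x $ i)^2)"
      by (simp add: pos_le_divide_eq mult.commute)
    then show ?thesis by (simp add: divide_inverse prod_inversef[symmetric] comp_def)
  qed
  show ?thesis
  proof (rule Bochner_Integration.integrable_bound)
    show "integrable lborel (\<lambda>x::real^'n. 2 ^ N * (B0 + B1) * (\<Prod>i\<in>UNIV. inverse (1 + (x $ i)^2)))"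
      using ip by simp
    show "AE x in lborel. norm (\<psi> x) \<le> norm (2 ^ N * (B0 + B1) * (\<Prod>i\<in>UNIV. inverse (1 + (x $ i)^2)))"
      by (intro AE_I2 order_trans[OF key]) simp
  qed measurable
qed

text \<open>A Gaussian centred at \<open>y\<close> and modulated so that its Fourier transform concentrates
  around the frequency \<open>\<omega>\<close>.\<close>

definition wave_packet :: "real^'n::finite \<Rightarrow> real \<Rightarrow> real^'n \<Rightarrow> real^'n \<Rightarrow> complex" where
  "wave_packet \<omega> c y x = cis (- (x \<bullet> \<omega>)) * complex_of_real (gauss c (x - y))"

lemma norm_wave_packet [simp]: "norm (wave_packet \<omega> c y x) = gauss c (x - y)"
  by (simp add: wave_packet_def norm_mult)

lemma has_derivative_wave_packet:
  "(wave_packet \<omega> c y has_derivative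
     (\<lambda>h. (complex_of_real (- c\<^sup>2 * (h \<bullet> (x - y))) - \<i> * complex_of_real (h \<bullet> \<omega>)) * wave_packet \<omega> c y x)) (at x)"
proof -
  let ?q = "\<lambda>x. complex_of_real (- (c\<^sup>2 / 2) * ((x - y) \<bullet> (x - y))) - \<i> * complex_of_real (x \<bullet> \<omega>)"
  have w: "wave_packet \<omega> c y = (\<lambda>x. exp (?q x))"
  proof
    fix x
    have "exp (?q x) = exp (complex_of_real (- (c\<^sup>2 / 2) * ((x - y) \<bullet> (x - y)))) * exp (\<i> * complex_of_real (- (x \<bullet> \<omega>)))"
      by (simp flip: exp_add)
    then show "wave_packet \<omega> c y x = exp (?q x)"
      by (simp add: wave_packet_def gauss_def cis_conv_exp exp_of_real power2_norm_eq_inner mult.commute del: of_real_minus)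
  qed
  have "((\<lambda>x. - (c\<^sup>2 / 2) * ((x - y) \<bullet> (x - y))) has_derivative (\<lambda>h. - c\<^sup>2 * (h \<bullet> (x - y)))) (at x)"
    by (auto intro!: derivative_eq_intros simp: inner_commute algebra_simps)
  moreover have "((\<lambda>x. x \<bullet> \<omega>) has_derivative (\<lambda>h. h \<bullet> \<omega>)) (at x)"
    by (auto intro!: derivative_eq_intros)
  ultimately have "(?q has_derivative (\<lambda>h. complex_of_real (- c\<^sup>2 * (h \<bullet> (x - y))) - \<i> * complex_of_real (h \<bullet> \<omega>))) (at x)"
    by (intro has_derivative_diff has_derivative_mult_right has_derivative_of_real)
  from has_derivative_compose[OF this DERIV_exp[unfolded has_field_derivative_def]]
  show ?thesis unfolding w by (simp add: mult.commute)
qed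

text \<open>Polynomial multiples of a wave packet are closed under differentiation, so every
  derivative of a wave packet has this form.\<close>

lemma partial_poly_wave_packet:
  fixes A B :: "real^'n::finite \<Rightarrow> real" and \<omega> y :: "real^'n" and c :: real
  assumes A: "real_polynomial_function A" and B: "real_polynomial_function B"
  defines "g \<equiv> \<lambda>x. Complex (A x) (B x) * wave_packet \<omega> c y x"
  shows "g differentiable (at x)"
    and "partial i g = (\<lambda>x. Complex
       (partial i A x + B x * \<omega> $ i - c\<^sup>2 * ((x $ i - y $ i) * A x))
       (partial i B x - A x * \<omega> $ i - c\<^sup>2 * ((x $ i - y $ i) * B x)) * wave_packet \<omega> c y x)"
proof -
  have g: "g = (\<lambda>x. (complex_of_real (A x) + \<i> * complex_of_real (B x)) * wave_packet \<omega> c y x)"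
    by (simp add: g_def Complex_eq)
  have d: "(g has_derivative (\<lambda>h. (complex_of_real (A x) + \<i> * complex_of_real (B x)) *
       ((complex_of_real (- c\<^sup>2 * (h \<bullet> (x - y))) - \<i> * complex_of_real (h \<bullet> \<omega>)) * wave_packet \<omega> c y x)
     + (complex_of_real (\<Sum>i\<in>UNIV. h $ i * partial i A x) + \<i> * complex_of_real (\<Sum>i\<in>UNIV. h $ i * partial i B x)) * wave_packet \<omega> c y x)) (at x)" for x
    unfolding g
    by (intro has_derivative_mult has_derivative_add has_derivative_mult_right has_derivative_of_real
        has_derivative_partial differentiable_at_real_polynomial_function A B has_derivative_wave_packet)
  show "g differentiable (at x)" using d by (rule differentiableI)
  show "partial i g = (\<lambda>x. Complex
       (partial i A x + B x * \<omega> $ i - c\<^sup>2 * ((x $ i - y $ i) * A x))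
       (partial i B x - A x * \<omega> $ i - c\<^sup>2 * ((x $ i - y $ i) * B x)) * wave_packet \<omega> c y x)"
  proof
    fix x
    have s: "(\<Sum>j\<in>UNIV. axis i 1 $ j * partial j P x) = partial i P x" for P :: "real^'n \<Rightarrow> real"
      by (simp add: axis_def if_distrib[where f="\<lambda>y. y * _"] cong: if_cong)
    have ip: "axis i 1 \<bullet> v = v $ i" for v :: "real^'n" by (simp add: inner_axis')
    show "partial i g x = Complex
       (partial i A x + B x * \<omega> $ i - c\<^sup>2 * ((x $ i - y $ i) * A x))
       (partial i B x - A x * \<omega> $ i - c\<^sup>2 * ((x $ i - y $ i) * B x)) * wave_packet \<omega> c y x"
      unfolding partial_eq[OF d] s ip Complex_eq
      by (simp add: algebra_simps)
  qed
qed

text \<open>Compare both factors with exponentials of \<open>r = norm (x - y)\<close>: the polynomial is at most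
  a constant times \<open>exp (1 + r)\<close>, and \<open>r \<le> c\<^sup>2 * r\<^sup>2 / 2 + 1 / (2 * c\<^sup>2)\<close>.\<close>

lemma gauss_decay:
  fixes y :: "'a::real_normed_vector"
  assumes c: "c > 0"
  shows "\<exists>K. \<forall>x. (1 + norm x) ^ d * gauss c (x - y) \<le> K"
proof (intro exI allI)
  fix x
  define r where "r = norm (x - y)"
  \<comment> \<open>The exponent \<open>Suc d\<close> keeps the divisor positive for \<open>d = 0\<close>.\<close>
  define D where "D = real (Suc d)"
  have r: "r \<ge> 0" by (simp add: r_def)
  have D: "D > 0" by (simp add: D_def)
  have "norm x \<le> norm y + r" unfolding r_def by (metis add.commute norm_triangle_sub)
  then have "1 + norm x \<le> 1 + norm y + r" by simp
  also have "\<dots> \<le> (1 + norm y) * (1 + r)" using r by (simp add: algebra_simps)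
  also have "\<dots> \<le> (1 + norm y) * (D * exp ((1 + r) / D))"
  proof (intro mult_left_mono)
    have "(1 + r) / D \<le> exp ((1 + r) / D)" using exp_ge_add_one_self[of "(1 + r) / D"] by linarith
    then show "1 + r \<le> D * exp ((1 + r) / D)" using D by (simp add: field_simps)
  qed simp
  finally have "1 + norm x \<le> (1 + norm y) * D * exp ((1 + r) / D)" by (simp add: mult.assoc)
  then have "(1 + norm x) ^ Suc d \<le> ((1 + norm y) * D * exp ((1 + r) / D)) ^ Suc d"
    by (intro power_mono) auto
  also have "\<dots> = ((1 + norm y) * D) ^ Suc d * exp (1 + r)"
    using D unfolding power_mult_distrib exp_of_nat_mult[symmetric] D_def[symmetric] by simp
  finally have 1: "(1 + norm x) ^ Suc d \<le> ((1 + norm y) * D) ^ Suc d * exp (1 + r)" .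
  have "1 + r - c\<^sup>2 * r\<^sup>2 / 2 \<le> 1 + 1 / (2 * c\<^sup>2)"
  proof -
    have "0 \<le> (c * r - 1 / c)\<^sup>2" by simp
    also have "\<dots> = c\<^sup>2 * r\<^sup>2 - 2 * r + 1 / c\<^sup>2"
      using c by (simp add: power2_diff power_mult_distrib power_divide)
    finally show ?thesis by simp
  qed
  then have 2: "exp (1 + r) * gauss c (x - y) \<le> exp (1 + 1 / (2 * c\<^sup>2))"
    by (simp add: gauss_def flip: exp_add r_def)
  have "(1 + norm x) ^ d * gauss c (x - y) \<le> (1 + norm x) ^ Suc d * gauss c (x - y)"
    by (intro mult_right_mono power_increasing) auto
  also have "\<dots> \<le> (((1 + norm y) * D) ^ Suc d * exp (1 + r)) * gauss c (x - y)"
    by (intro mult_right_mono 1) auto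
  also have "\<dots> \<le> ((1 + norm y) * D) ^ Suc d * exp (1 + 1 / (2 * c\<^sup>2))"
    unfolding mult.assoc[of "((1 + norm y) * D) ^ Suc d"] using D by (intro mult_left_mono 2) auto
  finally show "(1 + norm x) ^ d * gauss c (x - y) \<le> ((1 + norm y) * real (Suc d)) ^ Suc d * exp (1 + 1 / (2 * c\<^sup>2))"
    by (simp only: D_def)
qed

lemma polynomial_growth:
  fixes A :: "'a::real_normed_vector \<Rightarrow> real"
  assumes "real_polynomial_function A"
  shows "\<exists>C\<ge>0. \<exists>d::nat. \<forall>x. \<bar>A x\<bar> \<le> C * (1 + norm x) ^ d"
  using assms
proof induction
  case (linear f)
  then interpret bounded_linear f .
  obtain K where "K \<ge> 0" "\<And>x. norm (f x) \<le> norm x * K" using nonneg_bounded by blast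
  moreover have "norm x * K \<le> K * (1 + norm x) ^ 1" if "K \<ge> 0" for x
    using that by (simp add: algebra_simps)
  ultimately show ?case by (metis order_trans real_norm_def)
next
  case (const c)
  show ?case by (intro exI[of _ "\<bar>c\<bar>"] conjI exI[of _ 0]) auto
next
  case (add f g)
  then obtain C d C' d' where *: "C \<ge> 0" "\<And>x. \<bar>f x\<bar> \<le> C * (1 + norm x) ^ d"
    "C' \<ge> 0" "\<And>x. \<bar>g x\<bar> \<le> C' * (1 + norm x) ^ d'" by blast
  have "\<bar>f x + g x\<bar> \<le> (C + C') * (1 + norm x) ^ (d + d')" for x
  proof -
    have "\<bar>f x + g x\<bar> \<le> C * (1 + norm x) ^ d + C' * (1 + norm x) ^ d'"
      using *(2)[of x] *(4)[of x] by linarith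
    also have "\<dots> \<le> C * (1 + norm x) ^ (d + d') + C' * (1 + norm x) ^ (d + d')"
      using * by (intro add_mono mult_left_mono power_increasing) auto
    finally show ?thesis by (simp add: distrib_right)
  qed
  then show ?case using * by (intro exI[of _ "C + C'"]) auto
next
  case (mult f g)
  then obtain C d C' d' where *: "C \<ge> 0" "\<And>x. \<bar>f x\<bar> \<le> C * (1 + norm x) ^ d"
    "C' \<ge> 0" "\<And>x. \<bar>g x\<bar> \<le> C' * (1 + norm x) ^ d'" by blast
  have "\<bar>f x * g x\<bar> \<le> (C * C') * (1 + norm x) ^ (d + d')" for x
    using mult_mono[OF *(2)[of x] *(4)[of x]] * by (simp add: abs_mult power_add mult_ac)
  then show ?case using * by (intro exI[of _ "C * C'"]) auto
qed

lemma wave_packet_schwartz: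
  assumes c: "c > 0"
  shows "wave_packet \<omega> c y \<in> (schwartz :: (real^'n::finite \<Rightarrow> complex) set)"
proof -
  have form: "\<exists>A B. real_polynomial_function A \<and> real_polynomial_function B \<and>
     foldr partial js (wave_packet \<omega> c y) = (\<lambda>x. Complex (A x) (B x) * wave_packet \<omega> c y x)" for js
  proof (induction js)
    case Nil
    have "wave_packet \<omega> c y = (\<lambda>x. Complex 1 0 * wave_packet \<omega> c y x)" by (simp add: Complex_eq)
    then show ?case
      by (intro exI[of _ "\<lambda>x. 1"] exI[of _ "\<lambda>x. 0"]) auto
  next
    case (Cons i js)
    then obtain A B where AB: "real_polynomial_function A" "real_polynomial_function B"
      "foldr partial js (wave_packet \<omega> c y) = (\<lambda>x. Complex (A x) (B x) * wave_packet \<omega> c y x)" by blast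
    have xi: "real_polynomial_function (\<lambda>x::real^'n. x $ i - y $ i)"
      by (intro real_polynomial_function_diff polynomial_component real_polynomial_function.intros(2))
    let ?A = "\<lambda>x. partial i A x + B x * \<omega> $ i - c\<^sup>2 * ((x $ i - y $ i) * A x)"
    let ?B = "\<lambda>x. partial i B x - A x * \<omega> $ i - c\<^sup>2 * ((x $ i - y $ i) * B x)"
    have "real_polynomial_function ?A" "real_polynomial_function ?B"
      by (intro real_polynomial_function_diff real_polynomial_function.intros(2-4) polynomial_partial AB(1,2) xi)+
    moreover have "foldr partial (i # js) (wave_packet \<omega> c y) = (\<lambda>x. Complex (?A x) (?B x) * wave_packet \<omega> c y x)"
      unfolding foldr_Cons comp_apply AB(3) by (rule partial_poly_wave_packet(2)[OF AB(1,2)])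
    ultimately show ?case by blast
  qed
  have "(foldr partial js (wave_packet \<omega> c y)) differentiable (at x) \<and>
      bounded (range (\<lambda>x. norm x ^ m *\<^sub>R foldr partial js (wave_packet \<omega> c y) x))" for js x and m :: nat
  proof -
    obtain A B where AB: "real_polynomial_function A" "real_polynomial_function B"
      "foldr partial js (wave_packet \<omega> c y) = (\<lambda>x. Complex (A x) (B x) * wave_packet \<omega> c y x)"
      using form[of js] by blast
    obtain C d C' d' where *: "C \<ge> 0" "\<And>x. \<bar>A x\<bar> \<le> C * (1 + norm x) ^ d"
      "C' \<ge> 0" "\<And>x. \<bar>B x\<bar> \<le> C' * (1 + norm x) ^ d'"
      using polynomial_growth[OF AB(1)] polynomial_growth[OF AB(2)] by blast
    define e where "e = m + d + d'"
    obtain K where K: "\<And>x::real^'n. (1 + norm x) ^ e * gauss c (x - y) \<le> K"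
      using gauss_decay[OF c] by metis
    have "norm (norm x ^ m *\<^sub>R (Complex (A x) (B x) * wave_packet \<omega> c y x)) \<le> (C + C') * K" for x
    proof -
      have "norm (Complex (A x) (B x)) \<le> \<bar>A x\<bar> + \<bar>B x\<bar>"
        using cmod_le[of "Complex (A x) (B x)"] by simp
      also have "\<dots> \<le> C * (1 + norm x) ^ (d + d') + C' * (1 + norm x) ^ (d + d')"
        using * by (intro add_mono order_trans[OF *(2)] order_trans[OF *(4)] mult_left_mono power_increasing) auto
      finally have 1: "norm (Complex (A x) (B x)) \<le> (C + C') * (1 + norm x) ^ (d + d')" by (simp add: distrib_right)
      have "norm x ^ m * norm (Complex (A x) (B x)) \<le> (1 + norm x) ^ m * ((C + C') * (1 + norm x) ^ (d + d'))"
        using * by (intro mult_mono power_mono 1) auto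
      also have "\<dots> = (C + C') * (1 + norm x) ^ e" by (simp add: e_def power_add mult_ac)
      finally have "norm x ^ m * norm (Complex (A x) (B x)) * gauss c (x - y) \<le> (C + C') * (1 + norm x) ^ e * gauss c (x - y)"
        by (rule mult_right_mono) simp
      also have "\<dots> \<le> (C + C') * K"
        unfolding mult.assoc[of "C + C'"] using * by (intro mult_left_mono K) auto
      finally show ?thesis by (simp add: norm_mult mult.assoc)
    qed
    then show ?thesis
      unfolding AB(3) using partial_poly_wave_packet(1)[OF AB(1,2)] by (auto simp: bounded_iff)
  qed
  then show ?thesis unfolding schwartz_def by blast
qed

lemma fourier_wave_packet:
  fixes \<omega> :: "real^'n::finite"
  assumes c: "c > 0"
  shows "integrable lborel (wave_packet \<omega> c y)"
    and "fourier (wave_packet \<omega> c y) \<xi> = cis (y \<bullet> (\<xi> - \<omega>)) * complex_of_real ((sqrt (2 * pi) / c) ^ CARD('n) * gauss (1 / c) (\<xi> - \<omega>))"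
proof -
  define h where "h = (\<lambda>z. cis (z \<bullet> (\<xi> - \<omega>)) * complex_of_real (gauss c z))"
  have h: "integrable lborel h" unfolding h_def by (rule integrable_cis_gauss[OF c])
  have e: "cis (\<xi> \<bullet> x) * wave_packet \<omega> c y x = cis (y \<bullet> (\<xi> - \<omega>)) * h (- y + x)" for x
  proof -
    have "\<xi> \<bullet> x + - (x \<bullet> \<omega>) = y \<bullet> (\<xi> - \<omega>) + (- y + x) \<bullet> (\<xi> - \<omega>)"
      by (simp add: algebra_simps inner_diff_right inner_add_left inner_commute)
    then show ?thesis
      by (simp add: h_def wave_packet_def mult.assoc[symmetric] cis_mult)
  qed
  have "integrable lborel (\<lambda>z. cis (z \<bullet> 0) * complex_of_real (gauss c (z::real^'n)))"
    by (rule integrable_cis_gauss[OF c])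
  from integrable_lborel_translate[OF this, of "- y"]
  have "integrable lborel (\<lambda>z. complex_of_real (gauss c (- y + z)))" by simp
  then show "integrable lborel (wave_packet \<omega> c y)"
  proof (rule Bochner_Integration.integrable_bound)
    show "wave_packet \<omega> c y \<in> borel_measurable lborel"
      unfolding wave_packet_def[abs_def] by measurable
  qed (simp add: norm_minus_commute)
  show "fourier (wave_packet \<omega> c y) \<xi> = cis (y \<bullet> (\<xi> - \<omega>)) * complex_of_real ((sqrt (2 * pi) / c) ^ CARD('n) * gauss (1 / c) (\<xi> - \<omega>))"
    unfolding fourier_def e integral_mult_right_zero integral_lborel_translate[OF h]
    unfolding h_def integral_cis_gauss[OF c] ..
qed

section \<open>The Knapp bump\<close>

definition bump :: "'n::finite \<Rightarrow> real^'n \<Rightarrow> real" where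
  "bump i x = (1 + x $ i) / 2"

definition shell :: "real \<Rightarrow> real \<Rightarrow> real" where
  "shell d r = indicator {1..1 + d} r"

lemma shell_measurable [measurable]: "shell d \<in> borel_measurable borel"
  unfolding shell_def[abs_def] by measurable

lemma shell_simps: "shell d r \<ge> 0" "shell d r \<le> 1" "shell d r \<noteq> 0 \<longleftrightarrow> 1 \<le> r \<and> r \<le> 1 + d"
  "1 \<le> r \<Longrightarrow> r \<le> 1 + d \<Longrightarrow> shell d r = 1" "shell d r * shell d r = shell d r"
  by (auto simp: shell_def split: split_indicator)

lemma integrable_shell_mult:
  fixes h :: "real^'n::finite \<Rightarrow> real"
  assumes [measurable]: "h \<in> borel_measurable borel" and h: "\<And>\<xi>. shell d (norm \<xi>) \<noteq> 0 \<Longrightarrow> \<bar>h \<xi>\<bar> \<le> B"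
  shows "integrable lborel (\<lambda>\<xi>. shell d (norm \<xi>) * h \<xi>)"
proof (rule Bochner_Integration.integrable_bound)
  have "emeasure lborel (cball (0::real^'n) (1 + d)) < \<infinity>"
    by (rule emeasure_bounded_finite) simp
  then show "integrable lborel (\<lambda>\<xi>::real^'n. B * indicator (cball 0 (1 + d)) \<xi>)"
    by (intro integrable_mult_right integrable_real_indicator) auto
  show "(\<lambda>\<xi>. shell d (norm \<xi>) * h \<xi>) \<in> borel_measurable lborel" by measurable
  show "AE \<xi> in lborel. norm (shell d (norm \<xi>) * h \<xi>) \<le> norm (B * indicator (cball 0 (1 + d)) \<xi> :: real)"
  proof (rule AE_I2)
    fix \<xi> :: "real^'n"
    show "norm (shell d (norm \<xi>) * h \<xi>) \<le> norm (B * indicator (cball 0 (1 + d)) \<xi> :: real)"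
    proof (cases "shell d (norm \<xi>) = 0")
      case False
      with h[OF False] show ?thesis by (auto simp: shell_simps abs_le_iff)
    qed simp
  qed
qed

lemma norm_diff_axis:
  fixes \<xi> :: "real^'n::finite"
  shows "(norm (\<xi> - axis i 1))\<^sup>2 = (norm \<xi> - 1)\<^sup>2 + 2 * (norm \<xi> - \<xi> $ i)"
proof -
  have "(norm (\<xi> - axis i 1))\<^sup>2 = (norm \<xi>)\<^sup>2 - 2 * \<xi> $ i + 1"
    by (simp add: power2_norm_eq_inner inner_diff_left inner_diff_right inner_axis inner_axis' inner_axis_axis)
  then show ?thesis by (simp add: power2_diff)
qed

lemma bump_range:
  fixes \<xi> :: "real^'n::finite"
  shows "0 \<le> bump i (dir \<xi>)" "bump i (dir \<xi>) \<le> 1"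
proof -
  have "\<bar>dir \<xi> $ i\<bar> \<le> 1" using order_trans[OF component_le_norm_cart norm_dir_le[of \<xi>]] .
  then show "0 \<le> bump i (dir \<xi>)" "bump i (dir \<xi>) \<le> 1" unfolding bump_def by auto
qed

lemma knapp_scale_le_1:
  fixes M :: nat and d :: real
  assumes M: "M \<ge> 2" and d: "d > 0" "d\<^sup>2 * real M = 1"
  shows "d \<le> 1"
proof -
  have "d\<^sup>2 * 1 \<le> d\<^sup>2 * real M" using M by (intro mult_left_mono) auto
  then have "d\<^sup>2 \<le> 1" using d(2) by simp
  then show ?thesis using d(1) by (simp add: power2_le_iff_abs_le abs_square_le_1)
qed

text \<open>From \<open>1 + y \<le> exp y\<close>, powers of the bump decay like a Gaussian in \<open>1 - \<omega> $ i\<close>, and on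
  the shell this quantity controls the squared distance to the axis vector up to an error \<open>d\<^sup>2\<close>. The
  exponent \<open>2 * M - 2\<close> is the one that occurs in the energy bound.\<close>

lemma bump_power_le_gauss:
  fixes \<xi> :: "real^'n::finite" and M :: nat
  assumes M: "M \<ge> 2" and d: "d > 0" "d\<^sup>2 * real M = 1" and \<xi>: "shell d (norm \<xi>) \<noteq> 0"
  shows "bump i (dir \<xi>) ^ (2 * M - 2) \<le> exp (1/8) * gauss (1 / (2 * d)) (\<xi> - axis i 1)"
proof -
  define r where "r = norm \<xi>"
  have r: "1 \<le> r" "r \<le> 1 + d" using \<xi> by (auto simp: shell_simps r_def)
  have d1: "d \<le> 1" by (rule knapp_scale_le_1[OF M d])
  define z where "z = 1 - dir \<xi> $ i"
  have z: "z \<ge> 0" unfolding z_def using bump_range(2)[of i \<xi>] by (simp add: bump_def)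
  have "norm \<xi> - \<xi> $ i = r * z" using r by (simp add: z_def r_def field_simps)
  then have "(norm (\<xi> - axis i 1))\<^sup>2 = (r - 1)\<^sup>2 + 2 * (r * z)"
    unfolding norm_diff_axis r_def by simp
  also have "\<dots> \<le> d\<^sup>2 + 2 * (2 * z)"
    using r d1 z by (intro add_mono mult_left_mono power_mono mult_right_mono) auto
  finally have dist: "(norm (\<xi> - axis i 1))\<^sup>2 \<le> d\<^sup>2 + 4 * z" by simp
  have "bump i (dir \<xi>) = 1 + (- z / 2)" by (simp add: bump_def z_def field_simps)
  also have "\<dots> \<le> exp (- z / 2)" by (rule exp_ge_add_one_self)
  finally have "bump i (dir \<xi>) ^ (2 * M - 2) \<le> exp (- z / 2) ^ (2 * M - 2)"
    by (intro power_mono bump_range)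
  also have "\<dots> = exp (- (real M - 1) * z)"
    using M by (simp add: exp_of_nat_mult[symmetric] of_nat_diff algebra_simps)
  also have "\<dots> \<le> exp (- (real M / 2) * z)"
  proof -
    have "real M / 2 * z \<le> (real M - 1) * z" using z M by (intro mult_right_mono) auto
    then show ?thesis by (simp only: exp_le_cancel_iff mult_minus_left neg_le_iff_le)
  qed
  also have "\<dots> \<le> exp (1/8 - real M / 8 * (norm (\<xi> - axis i 1))\<^sup>2)"
  proof -
    have "real M * (norm (\<xi> - axis i 1))\<^sup>2 \<le> real M * (d\<^sup>2 + 4 * z)"
      by (intro mult_left_mono dist) simp
    then show ?thesis using d(2) by (simp add: algebra_simps)
  qed
  also have "\<dots> = exp (1/8) * gauss (1 / (2 * d)) (\<xi> - axis i 1)"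
  proof -
    have "(1 / (2 * d))\<^sup>2 = real M / 4"
      using d by (simp add: power_divide power_mult_distrib field_simps)
    then show ?thesis unfolding gauss_def by (simp flip: exp_add)
  qed
  finally show ?thesis .
qed

lemma bump_power_mass:
  fixes M :: nat and i :: "'n::finite"
  assumes M: "M \<ge> 2" and d: "d > 0" "d\<^sup>2 * real M = 1"
  shows "integrable lborel (\<lambda>\<xi>::real^'n. shell d (norm \<xi>) * bump i (dir \<xi>) ^ (2 * M - 2))"
    and "(LINT \<xi>|(lborel :: (real^'n) measure). shell d (norm \<xi>) * bump i (dir \<xi>) ^ (2 * M - 2))
      \<le> exp (1/8) * (2 * sqrt (2 * pi) * d) ^ CARD('n)"
proof -
  have g: "integrable lborel (\<lambda>\<xi>::real^'n. gauss (1 / (2 * d)) (- axis i 1 + \<xi>))"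
    by (intro integrable_lborel_translate integrable_gauss) (use d in simp)
  have [measurable]: "(\<lambda>\<xi>::real^'n. bump i (dir \<xi>)) \<in> borel_measurable borel"
    unfolding bump_def cart_eq_inner_axis by measurable
  show int: "integrable lborel (\<lambda>\<xi>::real^'n. shell d (norm \<xi>) * bump i (dir \<xi>) ^ (2 * M - 2))"
  proof (rule integrable_shell_mult[where B=1])
    show "\<bar>bump i (dir \<xi>) ^ (2 * M - 2)\<bar> \<le> 1" for \<xi> :: "real^'n"
      using bump_range[of i \<xi>] by (simp add: power_le_one)
  qed measurable
  have "(LINT \<xi>|(lborel :: (real^'n) measure). shell d (norm \<xi>) * bump i (dir \<xi>) ^ (2 * M - 2))
    \<le> (LINT \<xi>|(lborel :: (real^'n) measure). exp (1/8) * gauss (1 / (2 * d)) (- axis i 1 + \<xi>))"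
  proof (rule integral_mono[OF int integrable_mult_right[OF g]])
    fix \<xi> :: "real^'n"
    show "shell d (norm \<xi>) * bump i (dir \<xi>) ^ (2 * M - 2) \<le> exp (1/8) * gauss (1 / (2 * d)) (- axis i 1 + \<xi>)"
    proof (cases "shell d (norm \<xi>) = 0")
      case False
      then show ?thesis using bump_power_le_gauss[OF M d False, of i] by (simp add: shell_simps)
    qed simp
  qed
  also have "\<dots> = exp (1/8) * (sqrt (2 * pi) / (1 / (2 * d))) ^ CARD('n)"
    by (subst integral_mult_right_zero, subst integral_lborel_translate[OF integrable_gauss], use d in simp,
      subst integral_gauss, use d in auto)
  finally show "(LINT \<xi>|(lborel :: (real^'n) measure). shell d (norm \<xi>) * bump i (dir \<xi>) ^ (2 * M - 2))
      \<le> exp (1/8) * (2 * sqrt (2 * pi) * d) ^ CARD('n)"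
    by (simp add: mult_ac)
qed

lemma bump_power_lower:
  fixes \<xi> :: "real^'n::finite" and M :: nat
  assumes d: "d > 0" "d\<^sup>2 * real M = 1" and \<xi>: "\<xi> \<in> ball ((1 + d / 2) *\<^sub>R axis i 1) (d / 2)"
  shows "shell d (norm \<xi>) = 1" and "bump i (dir \<xi>) ^ M \<ge> 7/8" and "norm (\<xi> - axis i 1) \<le> d"
proof -
  let ?e = "axis i 1 :: real^'n"
  define v where "v = \<xi> - (1 + d / 2) *\<^sub>R ?e"
  have v: "norm v < d / 2" using \<xi> by (simp add: v_def dist_norm norm_minus_commute)
  have \<xi>v: "\<xi> = (1 + d / 2) *\<^sub>R ?e + v" by (simp add: v_def)
  have "norm \<xi> \<le> norm ((1 + d / 2) *\<^sub>R ?e) + norm v" unfolding \<xi>v by (rule norm_triangle_ineq)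
  then have u: "norm \<xi> \<le> 1 + d" using v d by simp
  have "norm ((1 + d / 2) *\<^sub>R ?e) - norm v \<le> norm \<xi>" unfolding \<xi>v by (rule norm_diff_ineq)
  then have l: "1 \<le> norm \<xi>" using v d by simp
  show "shell d (norm \<xi>) = 1" using u l by (simp add: shell_simps)
  have "\<xi> - ?e = (d / 2) *\<^sub>R ?e + v" by (simp add: \<xi>v algebra_simps)
  then have "norm (\<xi> - ?e) \<le> norm ((d / 2) *\<^sub>R ?e) + norm v" by (simp only: norm_triangle_ineq)
  then show "norm (\<xi> - ?e) \<le> d" using v d by simp
  have xi: "\<xi> $ i = 1 + d / 2 + v $ i" by (simp add: \<xi>v)
  have vi: "\<bar>v $ i\<bar> < d / 2" using component_le_norm_cart[of v i] v by linarith
  then have xi0: "\<xi> $ i > 0" unfolding xi using d by linarith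
  \<comment> \<open>The defect \<open>1 - \<omega> $ i\<close> is quadratic in the distance to the axis.\<close>
  have "(norm \<xi>)\<^sup>2 - (\<xi> $ i)\<^sup>2 \<le> (norm v)\<^sup>2"
  proof -
    have "(norm \<xi>)\<^sup>2 = (1 + d / 2)\<^sup>2 + 2 * (1 + d / 2) * v $ i + (norm v)\<^sup>2"
    proof -
      have "(norm (p *\<^sub>R ?e + v))\<^sup>2 = p\<^sup>2 + 2 * p * v $ i + (norm v)\<^sup>2" for p
        unfolding power2_norm_eq_inner
        by (simp add: inner_add_left inner_add_right inner_axis inner_axis' inner_axis_axis)
          (simp add: power2_eq_square distrib_left)
      then show ?thesis unfolding \<xi>v .
    qed
    moreover have "(\<xi> $ i)\<^sup>2 = (1 + d / 2)\<^sup>2 + 2 * (1 + d / 2) * v $ i + (v $ i)\<^sup>2"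
      unfolding xi by (simp add: power2_eq_square algebra_simps)
    ultimately show ?thesis by simp
  qed
  also have "\<dots> \<le> (d / 2)\<^sup>2" using v by (intro power_mono) auto
  finally have "(norm \<xi> - \<xi> $ i) * (norm \<xi> + \<xi> $ i) \<le> d\<^sup>2 / 4"
    by (simp add: power2_eq_square algebra_simps)
  moreover have "norm \<xi> - \<xi> $ i \<ge> 0" using component_le_norm_cart[of \<xi> i] by simp
  then have "(norm \<xi> - \<xi> $ i) * 1 \<le> (norm \<xi> - \<xi> $ i) * (norm \<xi> + \<xi> $ i)"
    using l xi0 by (intro mult_left_mono) auto
  ultimately have q: "norm \<xi> - \<xi> $ i \<le> d\<^sup>2 / 4" by (metis mult.right_neutral order_trans)
  have "1 - dir \<xi> $ i \<ge> 0" using bump_range(2)[of i \<xi>] by (simp add: bump_def)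
  then have "(1 - dir \<xi> $ i) * 1 \<le> (1 - dir \<xi> $ i) * norm \<xi>"
    using l by (intro mult_left_mono)
  moreover have "(1 - dir \<xi> $ i) * norm \<xi> = norm \<xi> - \<xi> $ i"
  proof -
    have "norm \<xi> \<noteq> 0" using l by linarith
    then have "dir \<xi> $ i * norm \<xi> = \<xi> $ i" by simp
    then show ?thesis by (simp only: left_diff_distrib mult_1)
  qed
  ultimately have z: "1 - dir \<xi> $ i \<le> d\<^sup>2 / 4" using q by simp
  define y where "y = - (1 - dir \<xi> $ i) / 2"
  have b: "bump i (dir \<xi>) = 1 + y" by (simp add: bump_def y_def field_simps)
  have "7 / 8 \<le> 1 + real M * y"
  proof -
    have "real M * (1 - dir \<xi> $ i) \<le> real M * (d\<^sup>2 / 4)" by (intro mult_left_mono z) simp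
    also have "real M * (d\<^sup>2 / 4) = 1 / 4" using d(2) by (simp add: mult.commute)
    finally have "real M * (1 - dir \<xi> $ i) \<le> 1 / 4" .
    moreover have "real M * y = - (real M * (1 - dir \<xi> $ i)) / 2" by (simp only: y_def mult_minus_right times_divide_eq_right)
    ultimately show ?thesis by linarith
  qed
  also have "\<dots> \<le> (1 + y) ^ M"
    using bump_range(1)[of i \<xi>] unfolding b by (intro Bernoulli_inequality) simp
  finally show "bump i (dir \<xi>) ^ M \<ge> 7/8" unfolding b .
qed

lemma powr_taylor_bound:
  fixes a r :: real
  assumes a: "a > 1" and r: "1 \<le> r" "r \<le> 2"
  shows "\<bar>r powr a - 1 - a * (r - 1)\<bar> \<le> a * (a - 1) * 2 powr a * (r - 1)\<^sup>2"
proof (cases "r = 1")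
  case False
  then have r1: "1 < r" using r by simp
  have "\<exists>z. 1 < z \<and> z < r \<and> (r powr a - a * r) - (1 powr a - a * 1) = (r - 1) * (a * z powr (a - 1) - a)"
    by (rule MVT2[OF r1]) (auto intro!: derivative_eq_intros)
  then obtain z where z: "1 < z" "z < r" "r powr a - a * r - 1 + a = (r - 1) * (a * (z powr (a - 1) - 1))"
    by (auto simp: algebra_simps)
  have "\<exists>y. 1 < y \<and> y < z \<and> z powr (a - 1) - 1 powr (a - 1) = (z - 1) * ((a - 1) * y powr (a - 1 - 1))"
    by (rule MVT2[OF z(1)]) (auto intro!: derivative_eq_intros)
  then obtain y where y: "1 < y" "y < z" "z powr (a - 1) - 1 = (z - 1) * ((a - 1) * y powr (a - 2))"
    by auto
  have "y powr (a - 2) \<le> 2 powr a"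
  proof -
    have "y powr (a - 2) \<le> y powr a" using y by (intro powr_mono) auto
    also have "\<dots> \<le> 2 powr a" using y z r a by (intro powr_mono2) auto
    finally show ?thesis .
  qed
  then have "(r - 1) * (a * ((z - 1) * ((a - 1) * y powr (a - 2)))) \<le> (r - 1) * (a * ((r - 1) * ((a - 1) * 2 powr a)))"
    using a r1 z by (intro mult_mono mult_nonneg_nonneg) auto
  moreover have "0 \<le> (r - 1) * (a * ((z - 1) * ((a - 1) * y powr (a - 2))))"
    using a r1 z by (intro mult_nonneg_nonneg) auto
  moreover have "r powr a - 1 - a * (r - 1) = (r - 1) * (a * ((z - 1) * ((a - 1) * y powr (a - 2))))"
    using z(3) unfolding y(3) by (simp add: algebra_simps)
  ultimately show ?thesis by (simp add: power2_eq_square mult_ac)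
qed simp

text \<open>The phase agrees to first order at the axis vector with its linearization, along which
  the evolution is a translation. In the transversal directions the error is \<open>norm \<xi> - \<xi> $ i\<close>, which
  is at most half the squared distance.\<close>

lemma phase_bound:
  fixes \<xi> :: "real^'n::finite"
  assumes a: "a > 1" and r: "1 \<le> norm \<xi>" "norm \<xi> \<le> 2"
  shows "\<bar>norm \<xi> powr a - 1 - a * (\<xi> $ i - 1)\<bar> \<le> (a * (a - 1) * 2 powr a + a) * (norm (\<xi> - axis i 1))\<^sup>2"
proof -
  let ?D = "(norm (\<xi> - axis i 1))\<^sup>2"
  have le: "\<xi> $ i \<le> norm \<xi>" using component_le_norm_cart[of \<xi> i] by simp
  have 1: "(norm \<xi> - 1)\<^sup>2 \<le> ?D" using le by (simp add: norm_diff_axis)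
  have 2: "norm \<xi> - \<xi> $ i \<le> ?D" using le by (simp add: norm_diff_axis) (smt (verit) zero_le_power2)
  have "\<bar>norm \<xi> powr a - 1 - a * (\<xi> $ i - 1)\<bar> = \<bar>(norm \<xi> powr a - 1 - a * (norm \<xi> - 1)) + a * (norm \<xi> - \<xi> $ i)\<bar>"
    by (simp add: algebra_simps)
  also have "\<dots> \<le> a * (a - 1) * 2 powr a * (norm \<xi> - 1)\<^sup>2 + a * (norm \<xi> - \<xi> $ i)"
    using powr_taylor_bound[OF a r] a le by (intro order_trans[OF abs_triangle_ineq] add_mono) (auto simp: abs_mult)
  also have "\<dots> \<le> a * (a - 1) * 2 powr a * ?D + a * ?D"
    using a by (intro add_mono mult_left_mono 1 2) auto
  finally show ?thesis by (simp add: distrib_right)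
qed

section \<open>Distributions with integrable Fourier transform\<close>

text \<open>The distribution with Fourier transform \<open>V\<close>.\<close>

definition freq_dist :: "(real^'n::finite \<Rightarrow> complex) \<Rightarrow> 'n distribution" where
  "freq_dist V \<psi> = (LINT \<xi>|lborel. V \<xi> * inv_fourier \<psi> \<xi>)"

lemma integrable_mult_inv_fourier:
  fixes V :: "real^'n::finite \<Rightarrow> complex"
  assumes V: "integrable lborel V" and \<psi>: "\<psi> \<in> schwartz"
  shows "integrable lborel (\<lambda>\<xi>. V \<xi> * inv_fourier \<psi> \<xi>)"
proof -
  have "integrable lborel (\<lambda>\<xi>. complex_of_real (1 / (2 * pi) ^ CARD('n)) * (fourier \<psi> \<xi> * V \<xi>))"
    by (intro integrable_mult_right integrable_fourier_mult schwartz_integrable \<psi> V)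
  then show ?thesis by (simp add: inv_fourier_eq_fourier mult_ac)
qed

lemma represents_freq_dist:
  fixes V :: "real^'n::finite \<Rightarrow> complex"
  assumes V: "integrable lborel V"
  shows "represents (\<lambda>x. complex_of_real (1 / (2 * pi) ^ CARD('n)) * fourier V x) (freq_dist V)"
  unfolding represents_def
proof (intro conjI ballI)
  let ?c = "complex_of_real (1 / (2 * pi) ^ CARD('n))"
  note [measurable] = borel_measurable_fourier[OF V]
  show "(\<lambda>x. ?c * fourier V x) \<in> borel_measurable lborel" by measurable
  fix \<psi> :: "real^'n \<Rightarrow> complex" assume "\<psi> \<in> schwartz"
  then have \<psi>: "integrable lborel \<psi>" by (rule schwartz_integrable)
  have "integrable lborel (\<lambda>x. ?c * (fourier V x * \<psi> x))"
    by (intro integrable_mult_right integrable_fourier_mult V \<psi>)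
  then show "integrable lborel (\<lambda>x. ?c * fourier V x * \<psi> x)" by (simp only: mult.assoc)
  have "freq_dist V \<psi> = (LINT \<xi>|lborel. ?c * (V \<xi> * fourier \<psi> \<xi>))"
    unfolding freq_dist_def inv_fourier_eq_fourier by (simp only: mult.left_commute)
  also have "\<dots> = (LINT x|lborel. ?c * (fourier V x * \<psi> x))"
    unfolding integral_mult_right_zero fourier_duality[OF V \<psi>] ..
  finally show "freq_dist V \<psi> = (LINT x|lborel. ?c * fourier V x * \<psi> x)" by (simp only: mult.assoc)
qed

lemma ennreal_powr_le:
  assumes "x \<le> ennreal B" "B \<ge> 0" "r \<ge> 0"
  shows "ennreal_powr x r \<le> ennreal (B powr r)"
proof -
  have "x < \<infinity>" using assms(1) by (metis ennreal_less_top infinity_ennreal_def order_le_less_trans)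
  moreover have "enn2real x \<le> B" using enn2real_mono[OF assms(1)] assms(2) by simp
  ultimately show ?thesis
    using assms by (auto simp: ennreal_powr_def intro!: ennreal_leI powr_mono2)
qed

lemma ennreal_powr_ge:
  assumes "ennreal B \<le> x" "B \<ge> 0" "r \<ge> 0"
  shows "ennreal (B powr r) \<le> ennreal_powr x r"
proof (cases "x = \<infinity>")
  case False
  then have "B \<le> enn2real x" using enn2real_mono[OF assms(1)] assms(2) by (simp add: top.not_eq_extremum)
  then show ?thesis
    using False assms by (auto simp: ennreal_powr_def intro!: ennreal_leI powr_mono2)
qed (simp add: ennreal_powr_def)

lemma Lp_norm_2_freq_dist:
  fixes V :: "real^'n::finite \<Rightarrow> complex"
  assumes V: "integrable lborel V" and A: "(\<integral>\<^sup>+\<xi>. ennreal ((norm (V \<xi>))\<^sup>2) \<partial>lborel) \<le> ennreal A" "A \<ge> 0"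
  shows "Lp_norm 2 (freq_dist V) \<le> ennreal (sqrt A)"
proof -
  define c where "c = 1 / (2 * pi) ^ CARD('n)"
  have c: "0 \<le> c" "c * (2 * pi) ^ CARD('n) = 1" by (simp_all add: c_def)
  have "(1::real) \<le> (2 * pi) ^ CARD('n)" by (rule one_le_power) (use pi_gt3 in linarith)
  then have c1: "c \<le> 1" by (simp add: c_def)
  note [measurable] = borel_measurable_fourier[OF V]
  have "(\<integral>\<^sup>+x. ennreal (norm (complex_of_real c * fourier V x) powr 2) \<partial>lborel) = (\<integral>\<^sup>+x. ennreal (c\<^sup>2) * ennreal ((norm (fourier V x))\<^sup>2) \<partial>lborel)"
    using c(1) by (intro nn_integral_cong) (simp add: norm_mult power_mult_distrib flip: ennreal_mult)
  also have "\<dots> = ennreal (c\<^sup>2) * (\<integral>\<^sup>+x. ennreal ((norm (fourier V x))\<^sup>2) \<partial>lborel)"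
    by (rule nn_integral_cmult) measurable
  also have "\<dots> \<le> ennreal (c\<^sup>2) * (ennreal ((2 * pi) ^ CARD('n)) * ennreal A)"
    by (intro mult_left_mono order_trans[OF fourier_bessel[OF V]] A) auto
  also have "\<dots> = ennreal (c * (c * (2 * pi) ^ CARD('n)) * A)"
    using c(1) A(2) by (simp add: power2_eq_square mult.assoc flip: ennreal_mult)
  also have "\<dots> \<le> ennreal A" unfolding c(2) using c1 A(2) by (intro ennreal_leI) (simp add: mult_left_le_one_le c(1))
  finally have "ennreal_powr (\<integral>\<^sup>+x. ennreal (norm (complex_of_real c * fourier V x) powr 2) \<partial>lborel) (1 / 2) \<le> ennreal (A powr (1 / 2))"
    by (rule ennreal_powr_le) (use A in auto)
  moreover have "Lp_norm 2 (freq_dist V) \<le> ennreal_powr (\<integral>\<^sup>+x. ennreal (norm (complex_of_real c * fourier V x) powr 2) \<partial>lborel) (1 / 2)"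
    unfolding Lp_norm_def by (rule INF_lower) (use represents_freq_dist[OF V] in \<open>simp add: c_def\<close>)
  ultimately show ?thesis using A(2) by (simp add: powr_half_sqrt)
qed

lemma harmonic_expansion_freq_dist:
  fixes W :: "nat \<Rightarrow> real^'n::finite \<Rightarrow> complex"
  assumes comp: "\<And>k. harmonic_component k (\<mu> k) (W k)" and int: "\<And>k. integrable lborel (W k)"
    and fin: "\<And>k \<xi>. k > M \<Longrightarrow> W k \<xi> = 0"
  shows "harmonic_expansion (freq_dist (\<lambda>\<xi>. \<Sum>k\<le>M. W k \<xi>)) \<mu> W"
  unfolding harmonic_expansion_def
proof (intro conjI allI ballI)
  fix \<psi> :: "real^'n \<Rightarrow> complex" assume \<psi>: "\<psi> \<in> schwartz"
  show i: "integrable lborel (\<lambda>\<xi>. W k \<xi> * inv_fourier \<psi> \<xi>)" for k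
    by (rule integrable_mult_inv_fourier[OF int \<psi>])
  have "(\<lambda>k. LINT \<xi>|lborel. W k \<xi> * inv_fourier \<psi> \<xi>) sums (\<Sum>k\<le>M. LINT \<xi>|lborel. W k \<xi> * inv_fourier \<psi> \<xi>)"
    by (rule sums_finite) (use fin in auto)
  also have "(\<Sum>k\<le>M. LINT \<xi>|lborel. W k \<xi> * inv_fourier \<psi> \<xi>) = freq_dist (\<lambda>\<xi>. \<Sum>k\<le>M. W k \<xi>) \<psi>"
    unfolding freq_dist_def using i by (simp add: sum_distrib_right)
  finally show "(\<lambda>k. LINT \<xi>|lborel. W k \<xi> * inv_fourier \<psi> \<xi>) sums freq_dist (\<lambda>\<xi>. \<Sum>k\<le>M. W k \<xi>) \<psi>" .
qed (rule comp)

text \<open>Splitting at a threshold \<open>K\<close>, \<open>norm (f x) \<le> K + K powr (1 - p) * norm (f x) powr p\<close>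
  pointwise, replaces the Hoelder inequality. The choice \<open>K = c / (2 * B)\<close> lets the first term account
  for at most half of the pairing.\<close>

lemma Lp_norm_lower:
  fixes v :: "'n::finite distribution" and \<psi> :: "real^'n \<Rightarrow> complex"
  assumes \<psi>: "\<psi> \<in> schwartz" "\<And>x. norm (\<psi> x) \<le> 1" "(LINT x|lborel. norm (\<psi> x)) \<le> B" "B > 0"
    and v: "norm (v \<psi>) \<ge> c" "c > 0" and p: "p > 1"
  shows "Lp_norm p v \<ge> ennreal ((c / 2) powr (1 / p) * (c / (2 * B)) powr (1 - 1 / p))"
  unfolding Lp_norm_def
proof (rule INF_greatest)
  fix f assume "f \<in> {f. represents f v}"
  then have f [measurable]: "f \<in> borel_measurable lborel" and fi: "integrable lborel (\<lambda>x. f x * \<psi> x)"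
    and fv: "v \<psi> = (LINT x|lborel. f x * \<psi> x)"
    using \<psi>(1) by (auto simp: represents_def)
  define K where "K = c / (2 * B)"
  have K: "K > 0" using v \<psi>(4) by (simp add: K_def)
  note \<psi>i = integrable_norm[OF schwartz_integrable[OF \<psi>(1)]]
  note [measurable] = borel_measurable_integrable[OF schwartz_integrable[OF \<psi>(1)]]
  let ?I = "\<integral>\<^sup>+x. ennreal (norm (f x) powr p) \<partial>lborel"
  have ptw: "norm (f x * \<psi> x) \<le> K * norm (\<psi> x) + K powr (1 - p) * norm (f x) powr p" for x
  proof (cases "norm (f x) \<le> K")
    case True
    then have "norm (f x * \<psi> x) \<le> K * norm (\<psi> x)" by (simp add: norm_mult mult_right_mono)
    then show ?thesis by (simp add: add_increasing2)
  next
    case False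
    then have fp: "norm (f x) > 0" using K by linarith
    have "norm (f x) powr (1 - p) \<le> K powr (1 - p)"
      using False K p by (intro powr_mono2') auto
    then have "norm (f x) powr p * norm (f x) powr (1 - p) \<le> norm (f x) powr p * K powr (1 - p)"
      by (intro mult_left_mono) auto
    then have "norm (f x) \<le> K powr (1 - p) * norm (f x) powr p"
      using fp by (simp add: mult.commute flip: powr_add)
    moreover have "norm (f x * \<psi> x) \<le> norm (f x)" using \<psi>(2)[of x] by (simp add: norm_mult mult_left_le)
    moreover have "0 \<le> K * norm (\<psi> x)" using K by simp
    ultimately show ?thesis by linarith
  qed
  have "ennreal c \<le> ennreal (norm (LINT x|lborel. f x * \<psi> x))" using v fv by (intro ennreal_leI) simp
  also have "\<dots> \<le> (\<integral>\<^sup>+x. ennreal (norm (f x * \<psi> x)) \<partial>lborel)" by (rule integral_norm_bound_ennreal[OF fi])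
  also have "\<dots> \<le> (\<integral>\<^sup>+x. ennreal (K * norm (\<psi> x)) + ennreal (K powr (1 - p)) * ennreal (norm (f x) powr p) \<partial>lborel)"
    using K ptw by (intro nn_integral_mono) (simp flip: ennreal_mult ennreal_plus)
  also have "\<dots> = (\<integral>\<^sup>+x. ennreal (K * norm (\<psi> x)) \<partial>lborel) + ennreal (K powr (1 - p)) * ?I"
    by (subst nn_integral_add) (auto simp: nn_integral_cmult)
  also have "(\<integral>\<^sup>+x. ennreal (K * norm (\<psi> x)) \<partial>lborel) = ennreal (K * (LINT x|lborel. norm (\<psi> x)))"
    using K \<psi>i by (subst nn_integral_eq_integral) auto
  also have "\<dots> \<le> ennreal (c / 2)"
  proof (rule ennreal_leI)
    have "K * (LINT x|lborel. norm (\<psi> x)) \<le> K * B" using K \<psi>(3) by (intro mult_left_mono) auto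
    then show "K * (LINT x|lborel. norm (\<psi> x)) \<le> c / 2" using \<psi>(4) by (simp add: K_def)
  qed
  finally have main: "ennreal c \<le> ennreal (c / 2) + ennreal (K powr (1 - p)) * ?I" by (simp add: add_right_mono)
  have "ennreal (c / 2 * K powr (p - 1)) \<le> ?I"
  proof (cases ?I)
    case (real J)
    then have "c \<le> c / 2 + K powr (1 - p) * J"
      using main v K by (simp flip: ennreal_mult ennreal_plus)
    then have "c / 2 * K powr (p - 1) \<le> (K powr (1 - p) * J) * K powr (p - 1)" by (intro mult_right_mono) auto
    also have "\<dots> = J * (K powr (1 - p) * K powr (p - 1))" by (simp only: mult_ac)
    also have "\<dots> = J" using K by (simp flip: powr_add)
    finally show ?thesis using real by (simp add: ennreal_leI)
  qed simp
  then have "ennreal ((c / 2 * K powr (p - 1)) powr (1 / p)) \<le> ennreal_powr ?I (1 / p)"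
    by (rule ennreal_powr_ge) (use v K p in auto)
  also have "(c / 2 * K powr (p - 1)) powr (1 / p) = (c / 2) powr (1 / p) * K powr ((p - 1) * (1 / p))"
    by (subst powr_mult) (simp only: powr_powr)
  also have "(p - 1) * (1 / p) = 1 - 1 / p" using p by (simp add: field_simps)
  finally show "ennreal ((c / 2) powr (1 / p) * (c / (2 * B)) powr (1 - 1 / p)) \<le> ennreal_powr ?I (1 / p)"
    unfolding K_def .
qed

lemma LqLp_norm_lower:
  assumes T: "T > 0" and q: "q > 0" and L: "L \<ge> 0" "\<And>t. \<bar>t\<bar> \<le> T \<Longrightarrow> ennreal L \<le> Lp_norm p (u t)"
  shows "ennreal (L * (2 * T) powr (1 / q)) \<le> LqLp_norm q p u"
proof -
  have "ennreal (2 * T * L powr q) = (\<integral>\<^sup>+t. ennreal (L powr q) * indicator {-T..T} t \<partial>lborel)"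
    using T by (simp add: nn_integral_cmult_indicator mult.commute flip: ennreal_mult)
  also have "\<dots> \<le> (\<integral>\<^sup>+t. ennreal_powr (Lp_norm p (u t)) q \<partial>lborel)"
    using L q by (intro nn_integral_mono) (auto split: split_indicator intro!: ennreal_powr_ge)
  finally have "ennreal ((2 * T * L powr q) powr (1 / q)) \<le> LqLp_norm q p u"
    unfolding LqLp_norm_def by (rule ennreal_powr_ge) (use T q in auto)
  also have "(2 * T * L powr q) powr (1 / q) = L * (2 * T) powr (1 / q)"
    using T q L by (simp add: powr_mult powr_powr)
  finally show ?thesis .
qed

section \<open>The angular Sobolev norm of the bump\<close>

text \<open>The eigenvalue of minus the spherical Laplacian on harmonics of degree \<open>k\<close> in dimension \<open>n\<close>.\<close>

definition sph_eigenvalue :: "nat \<Rightarrow> nat \<Rightarrow> real" where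
  "sph_eigenvalue n k = real k * (real k + real n - 2)"

lemma sph_eigenvalue_nonneg: "n \<ge> 2 \<Longrightarrow> sph_eigenvalue n k \<ge> 0"
  by (simp add: sph_eigenvalue_def)

lemma bump_harmonics:
  "\<exists>H. (\<forall>k. H k \<in> spherical_harmonics k) \<and> (\<forall>k>M. H k = (\<lambda>x. 0)) \<and>
     (\<forall>x::real^'n::finite. norm x = 1 \<longrightarrow> bump i x ^ M = (\<Sum>k\<le>M. H k x))"
proof -
  obtain H where H: "\<forall>k. H k \<in> spherical_harmonics k"
    "\<forall>x::real^'n. norm x = 1 \<longrightarrow> ((1 + x $ i) / 2) ^ M = (\<Sum>k\<le>M. H k x)"
    using sphere_expansion_bump[of i M] by (auto simp: sphere_expansion_def)
  have "(\<lambda>x. if k \<le> M then H k x else 0) \<in> spherical_harmonics k" for k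
    using H(1) spherical_harmonics_zero by (cases "k \<le> M") auto
  then show ?thesis
    by (intro exI[of _ "\<lambda>k x. if k \<le> M then H k x else 0"]) (use H(2) in \<open>auto simp: bump_def\<close>)
qed

text \<open>Interpolation between the exponents \<open>0\<close> and \<open>1\<close> at the scale \<open>l = 1 / d\<^sup>2\<close>:
  for \<open>y = d\<^sup>2 * l\<close> one has \<open>y powr \<beta> \<le> 1 + y\<close>.\<close>

lemma powr_split_scale:
  fixes l d \<alpha> \<beta> :: real
  assumes l: "l \<ge> 1" and d: "d > 0" and ab: "\<alpha> \<le> \<beta>" "0 \<le> \<beta>" "\<beta> \<le> 1"
  shows "l powr \<alpha> \<le> d powr (- 2 * \<beta>) * (1 + d\<^sup>2 * l)"
proof -
  define y where "y = d\<^sup>2 * l"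
  have y: "y > 0" using l d by (simp add: y_def)
  have "y powr \<beta> \<le> 1 + y"
  proof (cases "y \<le> 1")
    case True
    then have "y powr \<beta> \<le> 1 powr \<beta>" using y ab by (intro powr_mono2) auto
    then show ?thesis using y by simp
  next
    case False
    then have "y powr \<beta> \<le> y powr 1" using ab by (intro powr_mono) auto
    then show ?thesis using y by simp
  qed
  moreover have "l powr \<beta> = d powr (- 2 * \<beta>) * y powr \<beta>"
  proof -
    have "y powr \<beta> = d powr (2 * \<beta>) * l powr \<beta>"
      using d l unfolding y_def by (simp add: powr_mult powr_powr flip: powr_numeral)
    then show ?thesis using d by (simp add: powr_minus)
  qed
  moreover have "l powr \<alpha> \<le> l powr \<beta>" using l ab by (intro powr_mono) auto
  ultimately show ?thesis unfolding y_def by (simp add: mult_left_mono order_trans)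
qed

text \<open>By orthogonality the norm is \<open>\<Sum>k. (1 + \<mu> k) powr \<alpha> * I k\<close>, where \<open>I k\<close> is the mass of
  the component of degree \<open>k\<close>. Interpolation reduces it to the sums of \<open>I k\<close> and of \<open>\<mu> k * I k\<close>,
  the mass and the angular energy of the bump. The energy is larger than the mass by a factor of order
  \<open>M = 1 / d\<^sup>2\<close>, which the weight \<open>d\<^sup>2\<close> compensates.\<close>

lemma bump_sobolev_bound:
  fixes H :: "nat \<Rightarrow> real^'n::finite \<Rightarrow> real" and M :: nat
  assumes n: "CARD('n) \<ge> 2" and M: "M \<ge> 2" and d: "d > 0" "d\<^sup>2 * real M = 1"
    and H: "\<And>k. H k \<in> spherical_harmonics k"
    and HF: "\<And>x. norm x = 1 \<Longrightarrow> bump i x ^ M = (\<Sum>k\<le>M. H k x)"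
    and \<alpha>: "\<alpha> \<le> \<beta>" "0 \<le> \<beta>" "\<beta> \<le> 1"
  defines "S \<equiv> \<lambda>x. \<Sum>k\<le>M. (1 + sph_eigenvalue CARD('n) k) powr (\<alpha> / 2) * H k x"
  shows "integrable lborel (\<lambda>\<xi>. shell d (norm \<xi>) * (norm \<xi> powr s)\<^sup>2 * (S (dir \<xi>) * S (dir \<xi>)))"
    and "(LINT \<xi>|lborel. shell d (norm \<xi>) * (norm \<xi> powr s)\<^sup>2 * (S (dir \<xi>) * S (dir \<xi>)))
      \<le> d powr (- 2 * \<beta>) * ((real CARD('n) + 2) * ((2 powr \<bar>s\<bar>)\<^sup>2 * (exp (1/8) * (2 * sqrt (2 * pi) * d) ^ CARD('n))))"
proof -
  define N where "N = real CARD('n)"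
  define \<mu> where "\<mu> = sph_eigenvalue CARD('n)"
  define Q where "Q = (\<lambda>x::real^'n. bump i x ^ M)"
  define w where "w r = shell d r * (r powr s)\<^sup>2" for r
  define P where "P = (\<lambda>\<xi>::real^'n. bump i (dir \<xi>) ^ (2 * M - 2))"
  define B where "B = (2 powr \<bar>s\<bar>)\<^sup>2"
  have \<mu>0: "\<mu> k \<ge> 0" for k unfolding \<mu>_def by (rule sph_eigenvalue_nonneg[OF n])
  have Hp: "real_polynomial_function (H k)" for k using H[of k] by (auto simp: spherical_harmonics_def)
  have Qp: "real_polynomial_function Q" unfolding Q_def bump_def by (rule polynomial_bump_power)
  have Sp: "real_polynomial_function S"
    unfolding S_def by (intro real_polynomial_function_sum real_polynomial_function.intros(2,4) Hp) auto
  have d1: "d \<le> 1" by (rule knapp_scale_le_1[OF M d])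
  then have d2: "d\<^sup>2 \<le> 1" using d(1) by (simp add: power_le_one)
  have w0: "w r \<ge> 0" for r by (simp add: w_def shell_simps)
  have rs: "(r powr s)\<^sup>2 \<le> B" if "shell d r \<noteq> 0" for r
  proof -
    have r: "1 \<le> r" "r \<le> 2" using that d1 by (auto simp: shell_simps)
    have "r powr s \<le> r powr \<bar>s\<bar>" using r by (intro powr_mono) auto
    also have "\<dots> \<le> 2 powr \<bar>s\<bar>" using r by (intro powr_mono2) auto
    finally show ?thesis unfolding B_def by (intro power_mono) auto
  qed
  have wB: "w r \<le> B * shell d r" for r
    using rs[of r] shell_simps(1)[of d r] by (cases "shell d r = 0") (auto simp: w_def mult.commute mult_left_mono)
  have w: "integrable lborel (\<lambda>\<xi>::real^'n. w (norm \<xi>))"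
    unfolding w_def by (rule integrable_shell_mult[where B=B]) (use rs in auto)
  have dir1: "norm (dir \<xi>) = 1" if "w (norm \<xi>) \<noteq> 0" for \<xi> :: "real^'n"
    using that by (auto simp: w_def shell_simps)
  have "integrable lborel (\<lambda>\<xi>. w (norm \<xi>) * (S (dir \<xi>) * S (dir \<xi>)))"
    by (rule integrable_radial_polynomial[OF w, of "\<lambda>x. S x * S x"]) (intro real_polynomial_function.intros(4) Sp)
  then show "integrable lborel (\<lambda>\<xi>. shell d (norm \<xi>) * (norm \<xi> powr s)\<^sup>2 * (S (dir \<xi>) * S (dir \<xi>)))"
    by (simp only: w_def)
  have P0: "P \<xi> \<ge> 0" for \<xi> unfolding P_def by (intro zero_le_power bump_range)
  have Pi: "integrable lborel (\<lambda>\<xi>::real^'n. w (norm \<xi>) * P \<xi>)"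
    unfolding P_def by (rule integrable_radial_polynomial[OF w, of "\<lambda>x. bump i x ^ (2 * M - 2)"]) (simp add: bump_def polynomial_bump_power)
  define J where "J = (LINT \<xi>|lborel. w (norm \<xi>) * P \<xi>)"
  have J: "J \<le> B * (exp (1/8) * (2 * sqrt (2 * pi) * d) ^ CARD('n))"
  proof -
    note m = bump_power_mass[OF M d, of i]
    have "J \<le> (LINT \<xi>|lborel. B * (shell d (norm \<xi>) * P \<xi>))"
      unfolding J_def
    proof (rule integral_mono[OF Pi])
      show "integrable lborel (\<lambda>\<xi>. B * (shell d (norm \<xi>) * P \<xi>))"
        unfolding P_def by (rule integrable_mult_right[OF m(1)])
      show "w (norm \<xi>) * P \<xi> \<le> B * (shell d (norm \<xi>) * P \<xi>)" for \<xi>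
        using mult_right_mono[OF wB P0, of "norm \<xi>" \<xi>] by (simp add: mult.assoc)
    qed
    also have "\<dots> = B * (LINT \<xi>|lborel. shell d (norm \<xi>) * P \<xi>)" by (rule integral_mult_right_zero)
    also have "\<dots> \<le> B * (exp (1/8) * (2 * sqrt (2 * pi) * d) ^ CARD('n))"
      unfolding P_def by (intro mult_left_mono m(2)) (simp add: B_def)
    finally show ?thesis .
  qed
  define I where "I k = (LINT \<xi>|lborel. w (norm \<xi>) * (H k (dir \<xi>))\<^sup>2)" for k
  let ?E = "\<lambda>\<xi>. \<Sum>k\<le>M. \<mu> k * H k (dir \<xi>)"
  let ?F = "\<lambda>\<xi>. \<Sum>k\<le>M. H k (dir \<xi>)"
  have I0: "I k \<ge> 0" for k unfolding I_def using w0 by (intro integral_nonneg_AE) auto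
  note inner = harmonic_sum_inner[OF w H n, of _ M, folded I_def]
  \<comment> \<open>Two powers of the bump are thrown away so that \<open>J\<close> bounds mass and energy alike.\<close>
  have E0: "(\<Sum>k\<le>M. I k) \<le> J"
  proof -
    have "(\<Sum>k\<le>M. I k) = (LINT \<xi>|lborel. w (norm \<xi>) * (?F \<xi> * ?F \<xi>))"
      using inner[of "\<lambda>k. 1" "\<lambda>k. 1"] by simp
    also have "\<dots> \<le> J"
      unfolding J_def
    proof (rule integral_mono[OF _ Pi])
      show "integrable lborel (\<lambda>\<xi>. w (norm \<xi>) * (?F \<xi> * ?F \<xi>))"
        by (rule integrable_radial_polynomial[OF w, of "\<lambda>x. (\<Sum>k\<le>M. H k x) * (\<Sum>k\<le>M. H k x)"])
          (intro real_polynomial_function.intros(4) real_polynomial_function_sum Hp, auto)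
      fix \<xi> :: "real^'n"
      show "w (norm \<xi>) * (?F \<xi> * ?F \<xi>) \<le> w (norm \<xi>) * P \<xi>"
      proof (cases "w (norm \<xi>) = 0")
        case False
        have "?F \<xi> * ?F \<xi> = bump i (dir \<xi>) ^ (2 * M)"
          unfolding HF[OF dir1[OF False], symmetric] by (simp add: mult_2 power_add)
        also have "\<dots> \<le> P \<xi>" unfolding P_def by (intro power_decreasing bump_range) simp
        finally show ?thesis by (rule mult_left_mono[OF _ w0])
      qed simp
    qed
    finally show ?thesis .
  qed
  \<comment> \<open>On the sphere the sum weighted by the eigenvalues is minus the spherical Laplacian of the explicit polynomial.\<close>
  have E1: "(\<Sum>k\<le>M. \<mu> k * I k) \<le> N * real M * J"
  proof -
    have lap: "sph_laplacian Q x = - (\<Sum>k\<le>M. \<mu> k * H k x)" if "norm x = 1" for x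
    proof -
      have "sph_laplacian Q x = sph_laplacian (\<lambda>x. \<Sum>k\<le>M. H k x) x"
        using HF that by (intro sph_laplacian_sphere_cong Qp real_polynomial_function_sum Hp) (auto simp: Q_def)
      also have "\<dots> = (\<Sum>k\<le>M. sph_laplacian (H k) x)" by (subst sph_laplacian_sum) (use Hp in auto)
      also have "\<dots> = - (\<Sum>k\<le>M. \<mu> k * H k x)"
        by (simp add: spherical_harmonics_eigenvalue[OF H] \<mu>_def sph_eigenvalue_def sum_negf)
      finally show ?thesis .
    qed
    have "(\<Sum>k\<le>M. \<mu> k * I k) = (LINT \<xi>|lborel. w (norm \<xi>) * (?F \<xi> * ?E \<xi>))"
      using inner[of "\<lambda>k. 1" \<mu>] by simp
    also have "\<dots> \<le> (LINT \<xi>|lborel. N * real M * (w (norm \<xi>) * P \<xi>))"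
    proof (rule integral_mono[OF _ integrable_mult_right[OF Pi]])
      show "integrable lborel (\<lambda>\<xi>. w (norm \<xi>) * (?F \<xi> * ?E \<xi>))"
        by (rule integrable_radial_polynomial[OF w, of "\<lambda>x. (\<Sum>k\<le>M. H k x) * (\<Sum>k\<le>M. \<mu> k * H k x)"])
          (intro real_polynomial_function.intros(2,4) real_polynomial_function_sum Hp, auto)
      fix \<xi> :: "real^'n"
      show "w (norm \<xi>) * (?F \<xi> * ?E \<xi>) \<le> N * real M * (w (norm \<xi>) * P \<xi>)"
      proof (cases "w (norm \<xi>) = 0")
        case False
        note u = dir1[OF False]
        have "?F \<xi> * ?E \<xi> = - (bump i (dir \<xi>) ^ M * sph_laplacian Q (dir \<xi>))"
          unfolding lap[OF u] HF[OF u] by simp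
        also have "\<dots> \<le> N * real M * P \<xi>"
          using bump_energy_bound[OF u _ n bump_def[of i "dir \<xi>"], of M] M
          by (simp add: Q_def bump_def N_def P_def)
        finally have "w (norm \<xi>) * (?F \<xi> * ?E \<xi>) \<le> w (norm \<xi>) * (N * real M * P \<xi>)"
          by (rule mult_left_mono[OF _ w0])
        then show ?thesis by (simp add: mult_ac)
      qed simp
    qed
    also have "\<dots> = N * real M * J" unfolding J_def by (rule integral_mult_right_zero)
    finally show ?thesis .
  qed
  have J0: "J \<ge> 0" unfolding J_def using w0 P0 by (intro integral_nonneg_AE) auto
  have "(LINT \<xi>|lborel. w (norm \<xi>) * (S (dir \<xi>) * S (dir \<xi>))) = (\<Sum>k\<le>M. (1 + \<mu> k) powr (\<alpha> / 2) * (1 + \<mu> k) powr (\<alpha> / 2) * I k)"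
    unfolding S_def \<mu>_def by (rule inner)
  also have "\<dots> = (\<Sum>k\<le>M. (1 + \<mu> k) powr \<alpha> * I k)"
    by (simp flip: powr_add)
  also have "\<dots> \<le> (\<Sum>k\<le>M. d powr (- 2 * \<beta>) * (1 + d\<^sup>2 * (1 + \<mu> k)) * I k)"
    using \<mu>0 d \<alpha> I0 by (intro sum_mono mult_right_mono powr_split_scale) auto
  also have "\<dots> = d powr (- 2 * \<beta>) * ((1 + d\<^sup>2) * (\<Sum>k\<le>M. I k) + d\<^sup>2 * (\<Sum>k\<le>M. \<mu> k * I k))"
    unfolding sum_distrib_left sum.distrib[symmetric] by (intro sum.cong refl) (simp add: algebra_simps)
  also have "\<dots> \<le> d powr (- 2 * \<beta>) * ((1 + 1) * J + d\<^sup>2 * (N * real M * J))"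
    using E0 E1 d2 J0 I0 by (intro mult_left_mono add_mono mult_mono) (auto intro!: sum_nonneg)
  also have "(1 + 1) * J + d\<^sup>2 * (N * real M * J) = (N + 2) * J"
  proof -
    have "d\<^sup>2 * (N * real M * J) = (d\<^sup>2 * real M) * (N * J)" by (simp only: mult_ac)
    then show ?thesis unfolding d(2) by (simp add: algebra_simps)
  qed
  also have "d powr (- 2 * \<beta>) * ((N + 2) * J) \<le> d powr (- 2 * \<beta>) * ((N + 2) * (B * (exp (1/8) * (2 * sqrt (2 * pi) * d) ^ CARD('n))))"
    by (intro mult_left_mono J) (auto simp: N_def)
  finally show "(LINT \<xi>|lborel. shell d (norm \<xi>) * (norm \<xi> powr s)\<^sup>2 * (S (dir \<xi>) * S (dir \<xi>)))
      \<le> d powr (- 2 * \<beta>) * ((real CARD('n) + 2) * ((2 powr \<bar>s\<bar>)\<^sup>2 * (exp (1/8) * (2 * sqrt (2 * pi) * d) ^ CARD('n))))"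
    unfolding w_def N_def B_def .
qed

section \<open>Persistence of the bump\<close>

lemma cos_ge_one_minus_abs: "cos (x::real) \<ge> 1 - \<bar>x\<bar>"
proof -
  have "cos x = 1 - 2 * (sin (x / 2))\<^sup>2" using cos_double_sin[of "x / 2"] by simp
  moreover have "(sin (x / 2))\<^sup>2 \<le> \<bar>sin (x / 2)\<bar> * 1"
    unfolding power2_eq_square abs_mult_self_eq[of "sin (x/2)", symmetric] by (intro mult_left_mono) auto
  moreover have "\<bar>sin (x / 2)\<bar> \<le> \<bar>x / 2\<bar>" by (rule abs_sin_x_le_abs_x)
  ultimately show ?thesis by simp
qed

lemma gauss_second_moment:
  fixes z :: "'a::real_normed_vector"
  assumes d: "d > 0"
  shows "(norm z)\<^sup>2 * gauss (1 / d) z \<le> 4 * d\<^sup>2 * gauss (1 / (sqrt 2 * d)) z"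
proof -
  define y where "y = (norm z)\<^sup>2 / (4 * d\<^sup>2)"
  have g1: "gauss (1 / d) z = exp (- y) * exp (- y)" and g2: "gauss (1 / (sqrt 2 * d)) z = exp (- y)"
    by (simp_all add: gauss_def y_def power_divide power_mult_distrib flip: exp_add)
  have "y \<le> exp y" using exp_ge_add_one_self[of y] by linarith
  then have "y * exp (- y) \<le> 1" by (simp add: exp_minus field_simps)
  then have "(y * exp (- y)) * exp (- y) \<le> 1 * exp (- y)" by (intro mult_right_mono) auto
  then have "(4 * d\<^sup>2) * ((y * exp (- y)) * exp (- y)) \<le> (4 * d\<^sup>2) * (1 * exp (- y))" by (intro mult_left_mono) auto
  moreover have "(norm z)\<^sup>2 = 4 * d\<^sup>2 * y" using d by (simp add: y_def)
  ultimately show ?thesis unfolding g1 g2 by (simp add: mult.assoc)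
qed

text \<open>Up to a constant phase, the oscillating factor differs from \<open>1\<close> by at most \<open>\<bar>t\<bar>\<close> times the
  second order remainder of the phase. The Gaussian makes the mean of that remainder \<open>O(d\<^sup>2)\<close>, so for
  \<open>\<bar>t\<bar>\<close> below a small multiple of \<open>1 / d\<^sup>2\<close> there is no cancellation.\<close>

lemma bump_oscillatory_lower:
  fixes i :: "'n::finite" and M :: nat
  assumes a: "a > 1" and d: "d > 0" "d \<le> 1" "d\<^sup>2 * real M = 1"
  defines "c1 \<equiv> 7 / 8 * exp (- 1 / 2) * (unit_ball_vol (real CARD('n)) / 2 ^ CARD('n))"
  defines "Ca \<equiv> a * (a - 1) * 2 powr a + a"
  assumes t: "\<bar>t\<bar> * (Ca * (4 * (2 * sqrt pi) ^ CARD('n)) * d\<^sup>2) \<le> c1 / 2"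
  shows "norm (LINT \<xi>|(lborel :: (real^'n) measure). complex_of_real (shell d (norm \<xi>) * bump i (dir \<xi>) ^ M * gauss (1 / d) (\<xi> - axis i 1))
     * cis (t * (norm \<xi> powr a - a * (\<xi> $ i - 1)))) \<ge> c1 / 2 * d ^ CARD('n)"
proof -
  let ?e = "axis i 1 :: real^'n"
  define \<rho> where "\<rho> \<xi> = shell d (norm \<xi>) * bump i (dir \<xi>) ^ M * gauss (1 / d) (\<xi> - ?e)" for \<xi> :: "real^'n"
  define \<Theta> where "\<Theta> \<xi> = norm \<xi> powr a - a * (\<xi> $ i - 1)" for \<xi> :: "real^'n"
  define h where "h \<xi> = \<bar>t\<bar> * Ca * (4 * d\<^sup>2) * gauss (1 / (sqrt 2 * d)) (- ?e + \<xi>)" for \<xi> :: "real^'n"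
  have Ca: "Ca > 0" using a by (simp add: Ca_def add_nonneg_pos)
  have h0: "h \<xi> \<ge> 0" for \<xi> using Ca by (simp add: h_def)
  have b01: "0 \<le> bump i (dir \<xi>) ^ M" "bump i (dir \<xi>) ^ M \<le> 1" for \<xi> :: "real^'n"
    using bump_range[of i \<xi>] by (auto intro: power_le_one)
  have \<rho>0: "\<rho> \<xi> \<ge> 0" for \<xi> unfolding \<rho>_def using b01[of \<xi>] by (simp add: shell_simps)
  have [measurable]: "(\<lambda>\<xi>::real^'n. bump i (dir \<xi>)) \<in> borel_measurable borel"
    unfolding bump_def cart_eq_inner_axis by measurable
  have [measurable]: "\<rho> \<in> borel_measurable borel" unfolding \<rho>_def[abs_def] by measurable
  have [measurable]: "\<Theta> \<in> borel_measurable borel" unfolding \<Theta>_def[abs_def] cart_eq_inner_axis by measurable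
  have \<rho>i: "integrable lborel \<rho>"
  proof -
    have "integrable lborel (\<lambda>\<xi>. shell d (norm \<xi>) * (bump i (dir \<xi>) ^ M * gauss (1 / d) (\<xi> - ?e)))"
    proof (rule integrable_shell_mult[where B=1])
      show "\<bar>bump i (dir \<xi>) ^ M * gauss (1 / d) (\<xi> - ?e)\<bar> \<le> 1" for \<xi>
        using b01[of \<xi>] by (simp add: abs_mult mult_le_one)
    qed measurable
    then show ?thesis by (simp only: \<rho>_def[abs_def] mult.assoc)
  qed
  have hi: "integrable lborel h"
    unfolding h_def by (intro integrable_mult_right integrable_lborel_translate integrable_gauss) (use d in simp)
  have hint: "(LINT \<xi>|lborel. h \<xi>) = \<bar>t\<bar> * Ca * (4 * d\<^sup>2) * (2 * sqrt pi * d) ^ CARD('n)"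
  proof -
    have d': "1 / (sqrt 2 * d) > 0" using d by simp
    have "(LINT \<xi>|lborel. h \<xi>) = \<bar>t\<bar> * Ca * (4 * d\<^sup>2) * (sqrt (2 * pi) / (1 / (sqrt 2 * d))) ^ CARD('n)"
      unfolding h_def integral_mult_right_zero integral_lborel_translate[OF integrable_gauss[OF d']] integral_gauss[OF d'] ..
    also have "sqrt (2 * pi) / (1 / (sqrt 2 * d)) = 2 * sqrt pi * d" by (simp add: real_sqrt_mult)
    finally show ?thesis .
  qed
  \<comment> \<open>A ball of radius comparable to \<open>d\<close> on which the weight is bounded below.\<close>
  let ?B = "ball ((1 + d / 2) *\<^sub>R ?e) (d / 2)"
  have \<rho>int: "c1 * d ^ CARD('n) \<le> (LINT \<xi>|lborel. \<rho> \<xi>)"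
  proof -
    have fin: "emeasure lborel ?B < \<infinity>" by (rule emeasure_bounded_finite) simp
    have "c1 * d ^ CARD('n) = (7 / 8 * exp (- 1 / 2)) * measure lborel ?B"
      using d by (simp add: c1_def content_ball power_divide)
    also have "\<dots> = (LINT \<xi>|lborel. (7 / 8 * exp (- 1 / 2)) * indicator ?B \<xi>)"
      by (simp add: integral_mult_right_zero)
    also have "\<dots> \<le> (LINT \<xi>|lborel. \<rho> \<xi>)"
    proof (rule integral_mono[OF _ \<rho>i])
      show "integrable lborel (\<lambda>\<xi>. (7 / 8 * exp (- 1 / 2)) * indicator ?B \<xi> :: real)"
        using fin by (intro integrable_mult_right integrable_real_indicator) auto
      fix \<xi> :: "real^'n"
      show "(7 / 8 * exp (- 1 / 2)) * indicator ?B \<xi> \<le> \<rho> \<xi>"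
      proof (cases "\<xi> \<in> ?B")
        case True
        note l = bump_power_lower[OF d(1,3) True]
        have "exp (- 1 / 2) \<le> gauss (1 / d) (\<xi> - ?e)"
          unfolding gauss_def using power_mono[OF l(3), of 2] d by (simp add: power_divide)
        then have "7 / 8 * exp (- 1 / 2) \<le> bump i (dir \<xi>) ^ M * gauss (1 / d) (\<xi> - ?e)"
          using l(2) by (intro mult_mono) auto
        then show ?thesis using True by (simp add: \<rho>_def l(1))
      qed (use \<rho>0 in auto)
    qed
    finally show ?thesis .
  qed
  have oi: "integrable lborel (\<lambda>\<xi>. complex_of_real (\<rho> \<xi>) * cis (t * (\<Theta> \<xi> - 1)))"
    by (rule Bochner_Integration.integrable_bound[OF \<rho>i]) (auto simp: norm_mult)
  have ri: "integrable lborel (\<lambda>\<xi>. \<rho> \<xi> * cos (t * (\<Theta> \<xi> - 1)))"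
    using integrable_Re[OF oi] by simp
  have "c1 / 2 * d ^ CARD('n) \<le> (LINT \<xi>|lborel. \<rho> \<xi>) - (LINT \<xi>|lborel. h \<xi>)"
  proof -
    have "(LINT \<xi>|lborel. h \<xi>) = (\<bar>t\<bar> * (Ca * (4 * (2 * sqrt pi) ^ CARD('n)) * d\<^sup>2)) * d ^ CARD('n)"
      unfolding hint power_mult_distrib by (simp only: mult_ac)
    also have "\<dots> \<le> c1 / 2 * d ^ CARD('n)" using d by (intro mult_right_mono t) simp
    finally show ?thesis using \<rho>int by simp
  qed
  also have "\<dots> = (LINT \<xi>|lborel. \<rho> \<xi> - h \<xi>)" using \<rho>i hi by simp
  also have "\<dots> \<le> (LINT \<xi>|lborel. \<rho> \<xi> * cos (t * (\<Theta> \<xi> - 1)))"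
  proof (rule integral_mono[OF _ ri])
    show "integrable lborel (\<lambda>\<xi>. \<rho> \<xi> - h \<xi>)" using \<rho>i hi by simp
    fix \<xi> :: "real^'n"
    show "\<rho> \<xi> - h \<xi> \<le> \<rho> \<xi> * cos (t * (\<Theta> \<xi> - 1))"
    proof (cases "shell d (norm \<xi>) = 0")
      case False
      then have r: "1 \<le> norm \<xi>" "norm \<xi> \<le> 2" using d by (auto simp: shell_simps)
      have "\<rho> \<xi> \<le> 1 * gauss (1 / d) (\<xi> - ?e)"
        unfolding \<rho>_def using b01[of \<xi>] by (intro mult_right_mono mult_le_one) (auto simp: shell_simps)
      then have "\<rho> \<xi> * (norm (\<xi> - ?e))\<^sup>2 \<le> gauss (1 / d) (\<xi> - ?e) * (norm (\<xi> - ?e))\<^sup>2"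
        by (intro mult_right_mono) auto
      also have "\<dots> \<le> 4 * d\<^sup>2 * gauss (1 / (sqrt 2 * d)) (\<xi> - ?e)"
        using gauss_second_moment[OF d(1), of "\<xi> - ?e"] by (simp only: mult.commute)
      finally have m: "\<rho> \<xi> * (norm (\<xi> - ?e))\<^sup>2 \<le> 4 * d\<^sup>2 * gauss (1 / (sqrt 2 * d)) (- ?e + \<xi>)" by simp
      have "\<rho> \<xi> * \<bar>t * (\<Theta> \<xi> - 1)\<bar> = \<bar>t\<bar> * (\<rho> \<xi> * \<bar>norm \<xi> powr a - 1 - a * (\<xi> $ i - 1)\<bar>)"
      proof -
        have "\<Theta> \<xi> - 1 = norm \<xi> powr a - 1 - a * (\<xi> $ i - 1)" by (simp add: \<Theta>_def)
        then show ?thesis by (simp only: abs_mult mult.left_commute)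
      qed
      also have "\<dots> \<le> \<bar>t\<bar> * (\<rho> \<xi> * (Ca * (norm (\<xi> - ?e))\<^sup>2))"
        unfolding Ca_def by (intro mult_left_mono phase_bound a r \<rho>0) auto
      also have "\<dots> = \<bar>t\<bar> * Ca * (\<rho> \<xi> * (norm (\<xi> - ?e))\<^sup>2)" by (simp only: mult_ac)
      also have "\<dots> \<le> \<bar>t\<bar> * Ca * (4 * d\<^sup>2 * gauss (1 / (sqrt 2 * d)) (- ?e + \<xi>))"
        using Ca by (intro mult_left_mono m) auto
      also have "\<dots> = h \<xi>" by (simp only: h_def mult.assoc)
      finally have "\<rho> \<xi> - h \<xi> \<le> \<rho> \<xi> * (1 - \<bar>t * (\<Theta> \<xi> - 1)\<bar>)" by (simp add: right_diff_distrib)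
      also have "\<dots> \<le> \<rho> \<xi> * cos (t * (\<Theta> \<xi> - 1))" by (intro mult_left_mono cos_ge_one_minus_abs \<rho>0)
      finally show ?thesis .
    qed (use h0 in \<open>simp add: \<rho>_def\<close>)
  qed
  also have "\<dots> = Re (LINT \<xi>|lborel. complex_of_real (\<rho> \<xi>) * cis (t * (\<Theta> \<xi> - 1)))"
    using integral_Re[OF oi] by simp
  also have "\<dots> \<le> norm (LINT \<xi>|lborel. complex_of_real (\<rho> \<xi>) * cis (t * (\<Theta> \<xi> - 1)))"
    by (rule complex_Re_le_cmod)
  also have "(LINT \<xi>|lborel. complex_of_real (\<rho> \<xi>) * cis (t * (\<Theta> \<xi> - 1)))
    = cis (- t) * (LINT \<xi>|lborel. complex_of_real (\<rho> \<xi>) * cis (t * \<Theta> \<xi>))"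
    unfolding integral_mult_right_zero[symmetric]
    by (intro Bochner_Integration.integral_cong refl) (simp add: mult.left_commute cis_mult algebra_simps)
  finally show ?thesis by (simp add: norm_mult \<rho>_def \<Theta>_def)
qed

text \<open>The wave packet is centred at \<open>- (a * t)\<close> times the axis vector, because the group velocity
  at frequency \<open>e\<close> is \<open>- a *\<^sub>R e\<close> in the sign convention of the equation. The constants depend only on \<open>a\<close> and
  the dimension.\<close>

lemma bump_evolution_lower:
  fixes i :: "'n::finite" and a :: real
  assumes a: "a > 1"
  shows "\<exists>c \<kappa>. c > 0 \<and> \<kappa> > 0 \<and> (\<forall>M d t. d > 0 \<longrightarrow> d \<le> 1 \<longrightarrow> d\<^sup>2 * real M = 1 \<longrightarrow> \<bar>t\<bar> \<le> \<kappa> / d\<^sup>2 \<longrightarrow>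
     norm (LINT \<xi>|lborel. complex_of_real (shell d (norm \<xi>) * bump i (dir \<xi>) ^ M) * cis (t * norm \<xi> powr a)
       * inv_fourier (wave_packet (axis i 1) d (- (a * t) *\<^sub>R axis i 1)) \<xi>) \<ge> c)"
proof -
  define n where "n = CARD('n)"
  define c1 where "c1 = 7 / 8 * exp (- 1 / 2) * (unit_ball_vol (real n) / 2 ^ n)"
  define Ca where "Ca = a * (a - 1) * 2 powr a + a"
  define A where "A = 1 / (2 * pi) ^ n * sqrt (2 * pi) ^ n"
  define R where "R = Ca * (4 * (2 * sqrt pi) ^ n)"
  define \<kappa> where "\<kappa> = c1 / (2 * R)"
  have c1: "c1 > 0" unfolding c1_def by (intro mult_pos_pos divide_pos_pos unit_ball_vol_pos) auto
  have "Ca > 0" using a by (simp add: Ca_def add_nonneg_pos)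
  then have R: "R > 0" by (simp add: R_def)
  have A: "A > 0" by (simp add: A_def)
  have "norm (LINT \<xi>|lborel. complex_of_real (shell d (norm \<xi>) * bump i (dir \<xi>) ^ M) * cis (t * norm \<xi> powr a)
       * inv_fourier (wave_packet (axis i 1) d (- (a * t) *\<^sub>R axis i 1)) \<xi>) \<ge> A * (c1 / 2)"
    if d: "d > 0" "d \<le> 1" "d\<^sup>2 * real M = 1" and t: "\<bar>t\<bar> \<le> \<kappa> / d\<^sup>2" for M d t
  proof -
    let ?e = "axis i 1 :: real^'n"
    let ?\<rho> = "\<lambda>\<xi>. complex_of_real (shell d (norm \<xi>) * bump i (dir \<xi>) ^ M * gauss (1 / d) (\<xi> - ?e))
     * cis (t * (norm \<xi> powr a - a * (\<xi> $ i - 1)))"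
    have "complex_of_real (shell d (norm \<xi>) * bump i (dir \<xi>) ^ M) * cis (t * norm \<xi> powr a)
       * inv_fourier (wave_packet ?e d (- (a * t) *\<^sub>R ?e)) \<xi> = complex_of_real (A / d ^ n) * ?\<rho> \<xi>" for \<xi>
    proof -
      have y: "(- (a * t) *\<^sub>R ?e) \<bullet> (\<xi> - ?e) = - (a * t) * (\<xi> $ i - 1)"
        by (simp add: inner_diff_right inner_axis' inner_axis_axis algebra_simps)
      have "inv_fourier (wave_packet ?e d (- (a * t) *\<^sub>R ?e)) \<xi>
        = complex_of_real (A / d ^ n * gauss (1 / d) (\<xi> - ?e)) * cis (- (a * t) * (\<xi> $ i - 1))"
        unfolding inv_fourier_eq_fourier fourier_wave_packet(2)[OF d(1)] y by (simp add: A_def n_def power_divide)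
      moreover have "cis (t * norm \<xi> powr a) * cis (- (a * t) * (\<xi> $ i - 1)) = cis (t * (norm \<xi> powr a - a * (\<xi> $ i - 1)))"
        unfolding cis_mult by (simp add: algebra_simps)
      ultimately show ?thesis by (simp add: mult_ac)
    qed
    then have e: "(LINT \<xi>|lborel. complex_of_real (shell d (norm \<xi>) * bump i (dir \<xi>) ^ M) * cis (t * norm \<xi> powr a)
       * inv_fourier (wave_packet ?e d (- (a * t) *\<^sub>R ?e)) \<xi>) = complex_of_real (A / d ^ n) * (LINT \<xi>|lborel. ?\<rho> \<xi>)"
      by (simp only: integral_mult_right_zero)
    have "\<bar>t\<bar> * (R * d\<^sup>2) \<le> \<kappa> / d\<^sup>2 * (R * d\<^sup>2)" using R by (intro mult_right_mono t) auto
    also have "\<dots> = c1 / 2" using R d(1) by (simp add: \<kappa>_def)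
    finally have "norm (LINT \<xi>|lborel. ?\<rho> \<xi>) \<ge> c1 / 2 * d ^ n"
      unfolding n_def c1_def R_def Ca_def by (intro bump_oscillatory_lower a d)
    then have "(A / d ^ n) * (c1 / 2 * d ^ n) \<le> (A / d ^ n) * norm (LINT \<xi>|lborel. ?\<rho> \<xi>)"
      using A d(1) by (intro mult_left_mono) auto
    then show ?thesis unfolding e using A d(1) by (simp add: norm_mult norm_divide norm_power)
  qed
  moreover have "A * (c1 / 2) > 0" "\<kappa> > 0" using A c1 R by (simp_all add: \<kappa>_def)
  ultimately show ?thesis by blast
qed

section \<open>The Knapp datum and its evolution\<close>

lemma harmonic_component_single:
  fixes H :: "real^'n::finite \<Rightarrow> real"
  assumes H: "H \<in> spherical_harmonics k"
  shows "harmonic_component k (sph_eigenvalue CARD('n) k) (\<lambda>\<xi>. b (norm \<xi>) * complex_of_real (H (dir \<xi>)))"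
  unfolding harmonic_component_def
  by (intro exI[of _ "{H}"] exI[of _ "\<lambda>Y. b"])
    (use H spherical_harmonics_eigenvalue[OF H] in \<open>simp add: sph_eigenvalue_def\<close>)

text \<open>The expansion into harmonics is finite, so the datum, its evolution and its image under
  \<open>D\<^sup>s \<Lambda>\<^sub>\<omega>\<^sup>\<alpha>\<close> all arise by multiplying the components. Powers of \<open>norm \<xi>\<close> cause no trouble on the
  shell, which stays away from the origin.\<close>

lemma knapp_datum:
  fixes i :: "'n::finite" and M :: nat
  assumes n: "CARD('n) \<ge> 2" and M: "M \<ge> 2" and d: "d > 0" "d\<^sup>2 * real M = 1"
    and \<alpha>: "\<alpha> \<le> \<beta>" "0 \<le> \<beta>" "\<beta> \<le> 1"
  shows "\<exists>(u0 :: 'n distribution) u. u0 \<in> hdot s \<alpha> \<and> is_solution a u0 u \<and>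
    hdot_norm s \<alpha> u0 \<le> ennreal (sqrt (d powr (- 2 * \<beta>) * ((real CARD('n) + 2) * ((2 powr \<bar>s\<bar>)\<^sup>2 * (exp (1/8) * (2 * sqrt (2 * pi) * d) ^ CARD('n)))))) \<and>
    (\<forall>t \<psi>. u t \<psi> = (LINT \<xi>|lborel. complex_of_real (shell d (norm \<xi>) * bump i (dir \<xi>) ^ M) * cis (t * norm \<xi> powr a) * inv_fourier \<psi> \<xi>))"
proof -
  obtain H where H: "\<And>k. H k \<in> spherical_harmonics k" and H0: "\<And>k. k > M \<Longrightarrow> H k = (\<lambda>x. 0)"
    and HF: "\<And>x::real^'n. norm x = 1 \<Longrightarrow> bump i x ^ M = (\<Sum>k\<le>M. H k x)"
    using bump_harmonics[of M i] by blast
  define \<mu> where "\<mu> = sph_eigenvalue CARD('n)"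
  have \<mu>0: "\<mu> k \<ge> 0" for k unfolding \<mu>_def by (rule sph_eigenvalue_nonneg[OF n])
  have Hp: "real_polynomial_function (H k)" for k using H[of k] by (auto simp: spherical_harmonics_def)
  have d1: "d \<le> 1" by (rule knapp_scale_le_1[OF M d])
  have sh: "integrable lborel (\<lambda>\<xi>::real^'n. shell d (norm \<xi>))"
    using integrable_shell_mult[of "\<lambda>_::real^'n. 1" d 1] by simp
  define U where "U k \<xi> = complex_of_real (shell d (norm \<xi>) * H k (dir \<xi>))" for k and \<xi> :: "real^'n"
  let ?m = "\<lambda>r. complex_of_real (r powr s)"
  have Ui: "integrable lborel (U k)" for k
    unfolding U_def using integrable_radial_polynomial[OF sh Hp[of k]] by (simp only: complex_of_real_integrable_eq)
  have U0: "U k \<xi> = 0" if "\<not> (1 \<le> norm \<xi> \<and> norm \<xi> \<le> 2)" for k \<xi>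
    using that d1 by (auto simp: U_def shell_def)
  \<comment> \<open>One family contains the datum, its evolution and its image under \<open>D\<^sup>s \<Lambda>\<^sub>\<omega>\<^sup>\<alpha>\<close>.\<close>
  define W where "W c m k \<xi> = complex_of_real (c k) * m (norm \<xi>) * U k \<xi>" for c :: "nat \<Rightarrow> real" and m :: "real \<Rightarrow> complex" and k and \<xi> :: "real^'n"
  have Wi: "integrable lborel (W c m k)"
    if m: "m \<in> borel_measurable borel" "\<And>r. 1 \<le> r \<Longrightarrow> r \<le> 2 \<Longrightarrow> norm (m r) \<le> K" for c m k K
  proof (rule Bochner_Integration.integrable_bound)
    note [measurable] = m(1) borel_measurable_integrable[OF Ui]
    show "integrable lborel (\<lambda>\<xi>. complex_of_real (c k * K) * U k \<xi>)" using Ui by simp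
    show "W c m k \<in> borel_measurable lborel" unfolding W_def[abs_def] by measurable
    show "AE \<xi> in lborel. norm (W c m k \<xi>) \<le> norm (complex_of_real (c k * K) * U k \<xi>)"
    proof (rule AE_I2)
      fix \<xi> :: "real^'n"
      show "norm (W c m k \<xi>) \<le> norm (complex_of_real (c k * K) * U k \<xi>)"
      proof (cases "1 \<le> norm \<xi> \<and> norm \<xi> \<le> 2")
        case True
        then have "norm (m (norm \<xi>)) \<le> \<bar>K\<bar>" using m(2)[of "norm \<xi>"] by linarith
        then have "\<bar>c k\<bar> * norm (m (norm \<xi>)) * norm (U k \<xi>) \<le> \<bar>c k\<bar> * \<bar>K\<bar> * norm (U k \<xi>)"
          by (intro mult_right_mono mult_left_mono) auto
        then show ?thesis by (simp add: W_def norm_mult abs_mult)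
      qed (simp add: W_def U0)
    qed
  qed
  have comp: "harmonic_component k (\<mu> k) (W c m k)" for c m k
  proof -
    have "W c m k = (\<lambda>\<xi>. (complex_of_real (c k) * m (norm \<xi>) * complex_of_real (shell d (norm \<xi>))) * complex_of_real (H k (dir \<xi>)))"
      by (simp add: fun_eq_iff W_def U_def)
    then show ?thesis
      using harmonic_component_single[OF H[of k], of "\<lambda>r. complex_of_real (c k) * m r * complex_of_real (shell d r)"]
      by (simp only: \<mu>_def)
  qed
  have expansion: "harmonic_expansion (freq_dist (\<lambda>\<xi>. \<Sum>k\<le>M. W c m k \<xi>)) \<mu> (W c m)"
    if "m \<in> borel_measurable borel" "\<And>r. 1 \<le> r \<Longrightarrow> r \<le> 2 \<Longrightarrow> norm (m r) \<le> K" for c m K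
  proof (rule harmonic_expansion_freq_dist[OF comp Wi[OF that]])
    show "W c m k \<xi> = 0" if "k > M" for k \<xi>
      using H0[OF that] by (simp add: W_def U_def)
  qed
  have powr_m: "?m \<in> borel_measurable borel" by measurable
  have powr_b: "norm (complex_of_real (r powr s)) \<le> 2 powr \<bar>s\<bar>" if "1 \<le> r" "r \<le> 2" for r
  proof -
    have "r powr s \<le> r powr \<bar>s\<bar>" using that by (intro powr_mono) auto
    also have "\<dots> \<le> 2 powr \<bar>s\<bar>" using that by (intro powr_mono2) auto
    finally show ?thesis by simp
  qed
  define c where "c \<gamma> k = (1 + \<mu> k) powr (\<gamma> / 2)" for \<gamma> k
  define u0 where "u0 = freq_dist (\<lambda>\<xi>. \<Sum>k\<le>M. W (\<lambda>k. 1) (\<lambda>r. 1) k \<xi>)"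
  define u where "u t = freq_dist (\<lambda>\<xi>. \<Sum>k\<le>M. W (c 0) (\<lambda>r. cis (t * r powr a)) k \<xi>)" for t
  define G where "G = (\<lambda>\<xi>. \<Sum>k\<le>M. W (c \<alpha>) ?m k \<xi>)"
  define g where "g = freq_dist G"
  have E0: "harmonic_expansion u0 \<mu> U"
  proof -
    have "W (\<lambda>k. 1) (\<lambda>r. 1) = U" by (simp add: fun_eq_iff W_def)
    then show ?thesis using expansion[of "\<lambda>r. 1" 1 "\<lambda>k. 1"] unfolding u0_def by simp
  qed
  have Et: "harmonic_expansion (u t) \<mu> (W (c 0) (\<lambda>r. cis (t * r powr a)))" for t
    unfolding u_def
  proof (rule expansion[where K=1])
    show "(\<lambda>r. cis (t * r powr a)) \<in> borel_measurable borel" by measurable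
  qed simp
  have Eg: "harmonic_expansion g \<mu> (W (c \<alpha>) ?m)"
    unfolding g_def G_def by (rule expansion[OF powr_m powr_b])
  have sol: "is_solution a u0 u"
    unfolding is_solution_def radial_angular_multiplier_def
  proof (intro allI exI conjI)
    show "harmonic_expansion u0 \<mu> U" by (rule E0)
    show "harmonic_expansion (u t) \<mu> (\<lambda>k \<xi>. complex_of_real ((1 + \<mu> k) powr (0 / 2)) * cis (t * norm \<xi> powr a) * U k \<xi>)" for t
      using Et[of t] by (simp only: W_def[abs_def] c_def)
  qed
  have DL: "D_Lambda s \<alpha> u0 g"
    unfolding D_Lambda_def radial_angular_multiplier_def
  proof (intro exI conjI)
    show "harmonic_expansion u0 \<mu> U" by (rule E0)
    show "harmonic_expansion g \<mu> (\<lambda>k \<xi>. complex_of_real ((1 + \<mu> k) powr (\<alpha> / 2)) * complex_of_real (norm \<xi> powr s) * U k \<xi>)"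
      using Eg by (simp only: W_def[abs_def] c_def)
  qed
  have DLinv: "D_Lambda (- s) (- \<alpha>) g u0"
    unfolding D_Lambda_def radial_angular_multiplier_def
  proof (intro exI conjI)
    show "harmonic_expansion g \<mu> (W (c \<alpha>) ?m)" by (rule Eg)
    have "complex_of_real ((1 + \<mu> k) powr (- \<alpha> / 2)) * complex_of_real (norm \<xi> powr - s) * W (c \<alpha>) ?m k \<xi> = U k \<xi>" for k \<xi>
    proof (cases "1 \<le> norm \<xi> \<and> norm \<xi> \<le> 2")
      case True
      have 1: "(1 + \<mu> k) powr (- \<alpha> / 2) * (1 + \<mu> k) powr (\<alpha> / 2) = 1"
        using \<mu>0[of k] by (simp flip: powr_add)
      have 2: "norm \<xi> powr - s * norm \<xi> powr s = 1" using True by (auto simp flip: powr_add)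
      have "complex_of_real ((1 + \<mu> k) powr (- \<alpha> / 2)) * complex_of_real (norm \<xi> powr - s) * W (c \<alpha>) ?m k \<xi>
        = complex_of_real ((1 + \<mu> k) powr (- \<alpha> / 2) * (1 + \<mu> k) powr (\<alpha> / 2)) * complex_of_real (norm \<xi> powr - s * norm \<xi> powr s) * U k \<xi>"
        unfolding W_def c_def of_real_mult by (simp only: mult_ac)
      then show ?thesis unfolding 1 2 by simp
    qed (simp add: W_def U0)
    then have "(\<lambda>k \<xi>. complex_of_real ((1 + \<mu> k) powr (- \<alpha> / 2)) * complex_of_real (norm \<xi> powr - s) * W (c \<alpha>) ?m k \<xi>) = U"
      by (intro ext)
    then show "harmonic_expansion u0 \<mu> (\<lambda>k \<xi>. complex_of_real ((1 + \<mu> k) powr (- \<alpha> / 2)) * complex_of_real (norm \<xi> powr - s) * W (c \<alpha>) ?m k \<xi>)"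
      using E0 by simp
  qed
  define A where "A = d powr (- 2 * \<beta>) * ((real CARD('n) + 2) * ((2 powr \<bar>s\<bar>)\<^sup>2 * (exp (1/8) * (2 * sqrt (2 * pi) * d) ^ CARD('n))))"
  have A0: "A \<ge> 0" unfolding A_def using d by (intro mult_nonneg_nonneg) auto
  have gA: "Lp_norm 2 g \<le> ennreal (sqrt A)"
    unfolding g_def
  proof (rule Lp_norm_2_freq_dist[OF _ _ A0])
    show "integrable lborel G"
      unfolding G_def using Wi[OF powr_m powr_b] by (intro Bochner_Integration.integrable_sum)
    define S where "S x = (\<Sum>k\<le>M. (1 + sph_eigenvalue CARD('n) k) powr (\<alpha> / 2) * H k x)" for x
    note b = bump_sobolev_bound[OF n M d H HF \<alpha>, of s, folded S_def, folded A_def]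
    have "(norm (G \<xi>))\<^sup>2 = shell d (norm \<xi>) * (norm \<xi> powr s)\<^sup>2 * (S (dir \<xi>) * S (dir \<xi>))" for \<xi>
    proof -
      have "G \<xi> = complex_of_real (shell d (norm \<xi>) * norm \<xi> powr s * S (dir \<xi>))"
        unfolding G_def W_def U_def c_def S_def \<mu>_def sum_distrib_left of_real_sum
        by (intro sum.cong refl) (simp add: mult_ac)
      then have "norm (G \<xi>) = \<bar>shell d (norm \<xi>) * norm \<xi> powr s * S (dir \<xi>)\<bar>" by (simp only: norm_of_real)
      then have "(norm (G \<xi>))\<^sup>2 = (shell d (norm \<xi>) * shell d (norm \<xi>)) * (norm \<xi> powr s)\<^sup>2 * (S (dir \<xi>) * S (dir \<xi>))"
        by (simp add: power2_eq_square mult_ac)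
      then show ?thesis by (simp only: shell_simps)
    qed
    then have "(\<integral>\<^sup>+\<xi>. ennreal ((norm (G \<xi>))\<^sup>2) \<partial>lborel) = ennreal (LINT \<xi>|lborel. shell d (norm \<xi>) * (norm \<xi> powr s)\<^sup>2 * (S (dir \<xi>) * S (dir \<xi>)))"
      using nn_integral_eq_integral[OF b(1)] by (simp add: shell_simps)
    also have "\<dots> \<le> ennreal A" by (rule ennreal_leI[OF b(2)])
    finally show "(\<integral>\<^sup>+\<xi>. ennreal ((norm (G \<xi>))\<^sup>2) \<partial>lborel) \<le> ennreal A" .
  qed
  have hd: "u0 \<in> hdot s \<alpha>"
    unfolding hdot_def using DLinv le_less_trans[OF gA ennreal_less_top] by auto
  have hn: "hdot_norm s \<alpha> u0 \<le> ennreal (sqrt A)"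
  proof (rule order_trans[OF _ gA])
    show "hdot_norm s \<alpha> u0 \<le> Lp_norm 2 g"
      unfolding hdot_norm_def by (rule INF_lower) (use DL in simp)
  qed
  have ut: "u t \<psi> = (LINT \<xi>|lborel. complex_of_real (shell d (norm \<xi>) * bump i (dir \<xi>) ^ M) * cis (t * norm \<xi> powr a) * inv_fourier \<psi> \<xi>)" for t \<psi>
  proof -
    have "(\<Sum>k\<le>M. W (c 0) (\<lambda>r. cis (t * r powr a)) k \<xi>) = complex_of_real (shell d (norm \<xi>) * bump i (dir \<xi>) ^ M) * cis (t * norm \<xi> powr a)" for \<xi>
    proof (cases "shell d (norm \<xi>) = 0")
      case False
      then have "\<xi> \<noteq> 0" by (auto simp: shell_simps)
      then have "norm (dir \<xi>) = 1" by simp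
      note F = HF[OF this]
      have "1 + \<mu> k \<noteq> 0" for k using \<mu>0[of k] by linarith
      then show ?thesis
        unfolding F W_def U_def c_def of_real_mult of_real_sum sum_distrib_left sum_distrib_right
        by (intro sum.cong refl) (simp add: mult_ac)
    qed (simp add: W_def U_def)
    then show ?thesis unfolding u_def freq_dist_def by simp
  qed
  show ?thesis using hd sol hn ut unfolding A_def by blast
qed

theorem proposition1:
  fixes a q p s \<alpha> :: real
  assumes n: "CARD('n::finite) \<ge> 2"
    and a: "a > 1"
    and q: "q \<ge> 2" and p: "p \<ge> 2"
    and lower: "real CARD('n) / 2 * (1 / 2 - 1 / p) < 1 / q"
    and upper: "1 / q \<le> (2 * real CARD('n) - 1) / 2 * (1 / 2 - 1 / p)"
    and s: "s = real CARD('n) * (1 / 2 - 1 / p) - a / q"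
    and estimate: "\<exists>C\<ge>0. \<forall>(u0 :: 'n distribution) u.
      u0 \<in> hdot s \<alpha> \<longrightarrow> is_solution a u0 u \<longrightarrow>
      LqLp_norm q p u \<le> ennreal C * hdot_norm s \<alpha> u0"
  shows "\<alpha> \<ge> 2 / q + real CARD('n) / p - real CARD('n) / 2"
proof (rule ccontr)
  define N where "N = CARD('n)"
  define \<alpha>0 where "\<alpha>0 = 2 / q + real N / p - real N / 2"
  assume "\<not> \<alpha> \<ge> 2 / q + real CARD('n) / p - real CARD('n) / 2"
  then have lt: "\<alpha> < \<alpha>0" by (simp add: \<alpha>0_def N_def)
  have \<alpha>0_pos: "\<alpha>0 > 0" using lower by (simp add: \<alpha>0_def N_def field_simps)
  have "real N / p \<le> real N / 2" using p by (intro divide_left_mono) auto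
  moreover have "2 / q \<le> 1" using q by (simp add: field_simps)
  ultimately have \<alpha>0_le: "\<alpha>0 \<le> 1" unfolding \<alpha>0_def by linarith
  \<comment> \<open>Negative regularity is replaced by \<open>0\<close>, since the interpolation needs an exponent in \<open>[0, 1]\<close>.\<close>
  define \<beta> where "\<beta> = max \<alpha> 0"
  have \<beta>: "\<alpha> \<le> \<beta>" "0 \<le> \<beta>" "\<beta> \<le> 1" "\<beta> < \<alpha>0" using lt \<alpha>0_pos \<alpha>0_le by (auto simp: \<beta>_def)
  obtain C where C: "C \<ge> 0" and est: "\<And>(u0 :: 'n distribution) u. u0 \<in> hdot s \<alpha> \<Longrightarrow> is_solution a u0 u \<Longrightarrow>
      LqLp_norm q p u \<le> ennreal C * hdot_norm s \<alpha> u0"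
    using estimate by blast
  obtain i :: 'n where True by blast
  obtain c \<kappa> where c: "c > 0" and \<kappa>: "\<kappa> > 0" and evol: "\<And>M d t. d > 0 \<Longrightarrow> d \<le> 1 \<Longrightarrow> d\<^sup>2 * real M = 1 \<Longrightarrow> \<bar>t\<bar> \<le> \<kappa> / d\<^sup>2 \<Longrightarrow>
     norm (LINT \<xi>|lborel. complex_of_real (shell d (norm \<xi>) * bump i (dir \<xi>) ^ M) * cis (t * norm \<xi> powr a)
       * inv_fourier (wave_packet (axis i 1) d (- (a * t) *\<^sub>R axis i 1)) \<xi>) \<ge> c"
    using bump_evolution_lower[OF a, of i] by blast
  define K1 where "K1 = (c / 2) powr (1 / p) * (c / (2 * sqrt (2 * pi) ^ N)) powr (1 - 1 / p) * (2 * \<kappa>) powr (1 / q)"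
  define K2 where "K2 = C * sqrt ((real N + 2) * ((2 powr \<bar>s\<bar>)\<^sup>2 * (exp (1/8) * (2 * sqrt (2 * pi)) ^ N)))"
  have K1: "K1 > 0" using c \<kappa> by (simp add: K1_def)
  have key: "K1 \<le> K2 * real M powr (- (\<alpha>0 - \<beta>) / 2)" if M: "M \<ge> 2" for M
  proof -
    define d where "d = 1 / sqrt (real M)"
    have d: "d > 0" "d\<^sup>2 * real M = 1" using M by (simp_all add: d_def power_divide)
    have d1: "d \<le> 1" by (rule knapp_scale_le_1[OF M d])
    have dn: "d ^ N = d powr real N" using d by (simp add: powr_realpow)
    let ?A = "d powr (- 2 * \<beta>) * ((real N + 2) * ((2 powr \<bar>s\<bar>)\<^sup>2 * (exp (1/8) * (2 * sqrt (2 * pi) * d) ^ N)))"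
    obtain u0 :: "'n distribution" and u where u0: "u0 \<in> hdot s \<alpha>" and u: "is_solution a u0 u"
      and hn: "hdot_norm s \<alpha> u0 \<le> ennreal (sqrt (?A))"
      and ut: "\<And>t \<psi>. u t \<psi> = (LINT \<xi>|lborel. complex_of_real (shell d (norm \<xi>) * bump i (dir \<xi>) ^ M) * cis (t * norm \<xi> powr a) * inv_fourier \<psi> \<xi>)"
      using knapp_datum[OF n M d \<beta>(1-3), of s a i] unfolding N_def by blast
    define B where "B = (sqrt (2 * pi) / d) ^ N"
    have B: "B > 0" using d by (simp add: B_def)
    define L where "L = (c / 2) powr (1 / p) * (c / (2 * B)) powr (1 - 1 / p)"
    have "ennreal L \<le> Lp_norm p (u t)" if t: "\<bar>t\<bar> \<le> \<kappa> / d\<^sup>2" for t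
      unfolding L_def
    proof (rule Lp_norm_lower[OF wave_packet_schwartz[OF d(1)] _ _ B _ c])
      let ?\<psi> = "wave_packet (axis i 1) d (- (a * t) *\<^sub>R axis i 1)"
      show "norm (?\<psi> x) \<le> 1" for x by simp
      have "(LINT x|lborel. norm (?\<psi> x)) = (LINT x|(lborel :: (real^'n) measure). gauss d ((a * t) *\<^sub>R axis i 1 + x))"
        by (intro Bochner_Integration.integral_cong refl) (simp add: add.commute)
      also have "\<dots> = B"
        unfolding integral_lborel_translate[OF integrable_gauss[OF d(1)]] integral_gauss[OF d(1)] B_def N_def ..
      finally show "(LINT x|lborel. norm (?\<psi> x)) \<le> B" by simp
      show "c \<le> norm (u t ?\<psi>)" unfolding ut by (rule evol[OF d(1) d1 d(2) t])
      show "p > 1" using p by simp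
    qed
    then have "ennreal (L * (2 * (\<kappa> / d\<^sup>2)) powr (1 / q)) \<le> LqLp_norm q p u"
      using \<kappa> d q by (intro LqLp_norm_lower) (auto simp: L_def)
    also have "\<dots> \<le> ennreal C * hdot_norm s \<alpha> u0" by (rule est[OF u0 u])
    also have "\<dots> \<le> ennreal C * ennreal (sqrt (?A))"
      by (intro mult_left_mono hn) simp
    also have "\<dots> = ennreal (C * sqrt (?A))"
      using C by (simp flip: ennreal_mult')
    finally have "L * (2 * (\<kappa> / d\<^sup>2)) powr (1 / q) \<le> C * sqrt (?A)"
      using C d by (subst (asm) ennreal_le_iff) auto
    moreover have "L * (2 * (\<kappa> / d\<^sup>2)) powr (1 / q) = K1 * d powr (real N * (1 - 1 / p) - 2 / q)"
    proof -
      have "c / (2 * B) = c / (2 * sqrt (2 * pi) ^ N) * d powr real N"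
        unfolding B_def dn[symmetric] by (simp add: power_divide)
      then have e1: "(c / (2 * B)) powr (1 - 1 / p) = (c / (2 * sqrt (2 * pi) ^ N)) powr (1 - 1 / p) * d powr (real N * (1 - 1 / p))"
        by (simp only: powr_mult powr_powr)
      have "d powr (- 2) = 1 / d\<^sup>2"
        using d(1) by (simp add: powr_minus_divide)
      then have "2 * (\<kappa> / d\<^sup>2) = 2 * \<kappa> * d powr (- 2)" by simp
      then have e2: "(2 * (\<kappa> / d\<^sup>2)) powr (1 / q) = (2 * \<kappa>) powr (1 / q) * d powr (- 2 * (1 / q))"
        by (simp only: powr_mult powr_powr)
      have "L * (2 * (\<kappa> / d\<^sup>2)) powr (1 / q) = K1 * (d powr (real N * (1 - 1 / p)) * d powr (- 2 * (1 / q)))"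
        unfolding L_def K1_def e1 e2 by (simp only: mult_ac)
      also have "d powr (real N * (1 - 1 / p)) * d powr (- 2 * (1 / q)) = d powr (real N * (1 - 1 / p) - 2 / q)"
        unfolding powr_add[symmetric] by simp
      finally show ?thesis .
    qed
    moreover have "C * sqrt (?A) = K2 * d powr (real N / 2 - \<beta>)"
    proof -
      have "?A
        = ((real N + 2) * ((2 powr \<bar>s\<bar>)\<^sup>2 * (exp (1/8) * (2 * sqrt (2 * pi)) ^ N))) * (d powr (- 2 * \<beta>) * d powr real N)"
        unfolding power_mult_distrib[of _ d] dn by (simp only: mult_ac)
      moreover have "sqrt (d powr (- 2 * \<beta>) * d powr real N) = d powr (real N / 2 - \<beta>)"
      proof -
        have "sqrt (d powr (- 2 * \<beta>) * d powr real N) = (d powr (- 2 * \<beta> + real N)) powr (1 / 2)"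
          unfolding powr_add[symmetric] by (rule powr_half_sqrt[symmetric]) simp
        also have "\<dots> = d powr ((- 2 * \<beta> + real N) * (1 / 2))" by (rule powr_powr)
        also have "(- 2 * \<beta> + real N) * (1 / 2) = real N / 2 - \<beta>" by (simp add: field_simps)
        finally show ?thesis .
      qed
      ultimately show ?thesis by (simp only: K2_def real_sqrt_mult mult.assoc)
    qed
    ultimately have "K1 * d powr (real N * (1 - 1 / p) - 2 / q) \<le> K2 * d powr (real N / 2 - \<beta>)" by simp
    then have "K1 * d powr (real N * (1 - 1 / p) - 2 / q) * d powr - (real N * (1 - 1 / p) - 2 / q)
        \<le> K2 * d powr (real N / 2 - \<beta>) * d powr - (real N * (1 - 1 / p) - 2 / q)"
      by (rule mult_right_mono) simp
    also have "K1 * d powr (real N * (1 - 1 / p) - 2 / q) * d powr - (real N * (1 - 1 / p) - 2 / q) = K1"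
      using d unfolding mult.assoc powr_add[symmetric] by simp
    also have "K2 * d powr (real N / 2 - \<beta>) * d powr - (real N * (1 - 1 / p) - 2 / q) = K2 * d powr (\<alpha>0 - \<beta>)"
    proof -
      have e: "real N / 2 - \<beta> + - (real N * (1 - 1 / p) - 2 / q) = \<alpha>0 - \<beta>"
        by (simp add: \<alpha>0_def right_diff_distrib)
      show ?thesis unfolding mult.assoc powr_add[symmetric] e ..
    qed
    also have "d powr (\<alpha>0 - \<beta>) = real M powr (- (\<alpha>0 - \<beta>) / 2)"
    proof -
      have "d = real M powr (- 1 / 2)"
        using M powr_half_sqrt[of "real M"] powr_minus_divide[of "real M" "1 / 2"] by (simp add: d_def)
      then have "d powr (\<alpha>0 - \<beta>) = real M powr (- 1 / 2 * (\<alpha>0 - \<beta>))" by (simp only: powr_powr)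
      also have "- 1 / 2 * (\<alpha>0 - \<beta>) = - (\<alpha>0 - \<beta>) / 2" by linarith
      finally show ?thesis .
    qed
    finally show ?thesis .
  qed
  have "((\<lambda>M. real M powr (- (\<alpha>0 - \<beta>) / 2)) \<longlongrightarrow> 0) sequentially"
    using \<beta>(4) by (intro tendsto_neg_powr filterlim_real_sequentially) simp
  then have "((\<lambda>M. K2 * real M powr (- (\<alpha>0 - \<beta>) / 2)) \<longlongrightarrow> K2 * 0) sequentially"
    by (intro tendsto_mult tendsto_const)
  moreover have "\<forall>\<^sub>F M in sequentially. K1 \<le> K2 * real M powr (- (\<alpha>0 - \<beta>) / 2)"
    using eventually_ge_at_top[of "2::nat"] by eventually_elim (rule key)
  ultimately have "K1 \<le> K2 * 0" by (rule tendsto_lowerbound) simp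
  then show False using K1 by simp
qed

end
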